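(* Let $\mathcal X$ be the GK curve, let $\tilde m,\tilde s\in\mathbb N$ (where $\tilde s=0$ is allowed), and let $c_0=0,c_1,\ldots,c_{\tilde s}$ be $\tilde s+1$ distinct elements of $\Gamma_0$. Let $\tilde{\mathcal G}=\left(\bigcup_{i=0}^{\tilde s}(\mathcal X\cap\zeta_{c_i})\right)\setminus\{P_\infty\}$, $\tilde{\mathcal D}=\mathcal X(\mathbb F_{q^6})\setminus\tilde{\mathcal G}$, $\tilde G=\sum_{P\in\tilde{\mathcal G}}\tilde mP$, $\tilde D=\sum_{P\in\tilde{\mathcal D}}P$, and let $\tilde C=C_{\mathcal L}(\tilde D,\tilde G)$ be the associated functional AG code over $\mathbb F_{q^6}$, of length $\tilde n=\deg\tilde D$. Let $\tilde d^*=\tilde n-\deg\tilde G=q^8-q^6+q^5-(\tilde m+1)(\tilde s+1)q^3+1$ be its designed minimum distance. Whenever $\tilde d^*>0$, $\tilde C$ attains the designed minimum distance, that is, the minimum distance of $\tilde C$ equals $\tilde d^*$.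
   Context: Let $q$ be a prime power. The GK curve $\mathcal X$ is the non-singular projective curve in $PG(3,\overline{\mathbb F}_q)$ defined by the affine equations $Y^{q+1}=X^q+X$, $Z^{q^2-q+1}=Y^{q^2}-Y$. It has a unique point at infinity $P_\infty$, which is $\mathbb F_{q^2}$-rational, genus $g=\frac{q^5-2q^3+q^2}{2}$, and $|\mathcal X(\mathbb F_{q^6})|=q^8-q^6+q^5+1$, where $\mathcal X(\mathbb F_{q^6})$ is the set of $\mathbb F_{q^6}$-rational points. For $c\in\mathbb F_{q^6}$, $\zeta_c$ is the plane with affine equation $Z=c$ (it contains $P_\infty$). $\Gamma=\{c\in\mathbb F_{q^6} : c^{(q^3+1)(q^2-1)}+c^{(q^3+1)(q^2-q)}+1=0\}$ and $\Gamma_0=\Gamma\cup\{0\}$; for $c\in\Gamma_0$ the set $\mathcal X\cap\zeta_c$ consists of $q^3+1$ $\mathbb F_{q^6}$-rational points, $P_\infty$ included. Thus $\deg\tilde G=\tilde m(\tilde s+1)q^3$ and $\deg\tilde D=q^8-q^6+q^5-(\tilde s+1)q^3+1$. Functional code: for an $\mathbb F_{q^6}$-rational divisor $G$, $\mathcal L(G)=\{f\in\mathbb F_{q^6}(\mathcal X)\setminus\{0\}: (f)+G\ge 0\}\cup\{0\}$. For $D=P_1+\cdots+P_n$ with distinct $\mathbb F_{q^6}$-rational $P_i$ not in $\mathrm{supp}(G)$, $C_{\mathcal L}(D,G)=\{(f(P_1),\ldots,f(P_n)) : f\in\mathcal L(G)\}\subseteq\mathbb F_{q^6}^n$. *)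

theory Defs
  imports
    "HOL-Analysis.Cartesian_Space"
    "HOL-Algebra.Algebraic_Closure_Type"
    "HOL-Library.Poly_Mapping"
    "HOL-Number_Theory.Prime_Powers"
begin

section \<open>Projective 3-space and its forms\<close>

text \<open>
  Homogeneous coordinates of \<open>PG(3,F)\<close> are \<open>(X : Y : Z : T) = (v $ 1 : v $ 2 : v $ 3 : v $ 4)\<close>,
  the plane at infinity being \<open>T = 0\<close>. A point is the set of all its coordinate vectors.
\<close>

type_synonym 'a point3 = "('a ^ 4) set"

definition proj_point :: "'a::field ^ 4 \<Rightarrow> 'a point3" where
  "proj_point v = {a *s v | a. a \<noteq> 0}"

definition PG3 :: "'a::field point3 set" where
  "PG3 = {proj_point v | v. v \<noteq> 0}"

type_synonym 'a poly4 = "(4 \<Rightarrow>\<^sub>0 nat) \<Rightarrow>\<^sub>0 'a"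

definition eval4 :: "'a::field poly4 \<Rightarrow> 'a ^ 4 \<Rightarrow> 'a" where
  "eval4 F v = (\<Sum>m\<in>Poly_Mapping.keys F.
     Poly_Mapping.lookup F m * (\<Prod>i\<in>UNIV. (v $ i) ^ Poly_Mapping.lookup m i))"

text \<open>The zero polynomial counts as a form of every degree.\<close>

definition form :: "nat \<Rightarrow> 'a::field poly4 \<Rightarrow> bool" where
  "form d F \<longleftrightarrow> (\<forall>m\<in>Poly_Mapping.keys F. (\<Sum>i\<in>UNIV. Poly_Mapping.lookup m i) = d)"

definition vanishes_at :: "'a::field poly4 \<Rightarrow> 'a point3 \<Rightarrow> bool" where
  "vanishes_at F P \<longleftrightarrow> (\<forall>v\<in>P. eval4 F v = 0)"

definition projective_closure :: "'a::field point3 set \<Rightarrow> 'a point3 set" where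
  "projective_closure A = {P \<in> PG3. \<forall>d F. form d F \<longrightarrow> (\<forall>Q\<in>A. vanishes_at F Q) \<longrightarrow> vanishes_at F P}"


section \<open>Function field of an irreducible projective curve\<close>

text \<open>
  Throughout, \<open>\<X>\<close> is the set of points of a curve over an algebraically closed field. A rational
  function is a class of quotients \<open>F/H\<close> of forms of equal degree, where \<open>H\<close> does not
  vanish identically on \<open>\<X>\<close>, and \<open>F/H = F'/H'\<close> iff \<open>F H' - F' H\<close> vanishes on \<open>\<X>\<close>.
\<close>

definition quotients :: "'a::field point3 set \<Rightarrow> ('a poly4 \<times> 'a poly4) set" where
  "quotients \<X> = {(F, H). (\<exists>d. form d F \<and> form d H) \<and> \<not> (\<forall>P\<in>\<X>. vanishes_at H P)}"

definition quot_rel ::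
    "'a::field point3 set \<Rightarrow> (('a poly4 \<times> 'a poly4) \<times> ('a poly4 \<times> 'a poly4)) set" where
  "quot_rel \<X> = {((F, H), (F', H')). (F, H) \<in> quotients \<X> \<and> (F', H') \<in> quotients \<X> \<and>
     (\<forall>P\<in>\<X>. vanishes_at (F * H' - F' * H) P)}"

type_synonym 'a ratfun = "('a poly4 \<times> 'a poly4) set"

definition ratfun :: "'a::field point3 set \<Rightarrow> 'a poly4 \<Rightarrow> 'a poly4 \<Rightarrow> 'a ratfun" where
  "ratfun \<X> F H = quot_rel \<X> `` {(F, H)}"

definition function_field :: "'a::field point3 set \<Rightarrow> 'a ratfun ring" where
  "function_field \<X> = \<lparr>
     carrier = quotients \<X> // quot_rel \<X>,
     monoid.mult = (\<lambda>f g. \<Union>(F, H)\<in>f. \<Union>(F', H')\<in>g. ratfun \<X> (F * F') (H * H')),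
     one = ratfun \<X> 1 1,
     ring.zero = ratfun \<X> 0 1,
     add = (\<lambda>f g. \<Union>(F, H)\<in>f. \<Union>(F', H')\<in>g. ratfun \<X> (F * H' + F' * H) (H * H'))\<rparr>"

definition regular_at :: "'a::field point3 \<Rightarrow> 'a ratfun \<Rightarrow> bool" where
  "regular_at P f \<longleftrightarrow> (\<exists>(F, H)\<in>f. \<not> vanishes_at H P)"

definition value_at :: "'a::field point3 \<Rightarrow> 'a ratfun \<Rightarrow> 'a" where
  "value_at P f = (THE a. \<exists>(F, H)\<in>f. \<exists>v\<in>P. eval4 H v \<noteq> 0 \<and> a = eval4 F v / eval4 H v)"

definition local_ring :: "'a::field point3 set \<Rightarrow> 'a point3 \<Rightarrow> 'a ratfun set" where
  "local_ring \<X> P = {f \<in> carrier (function_field \<X>). regular_at P f}"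

definition maximal_ideal_at :: "'a::field point3 set \<Rightarrow> 'a point3 \<Rightarrow> 'a ratfun set" where
  "maximal_ideal_at \<X> P = {f \<in> local_ring \<X> P. value_at P f = 0}"

definition local_parameter :: "'a::field point3 set \<Rightarrow> 'a point3 \<Rightarrow> 'a ratfun \<Rightarrow> bool" where
  "local_parameter \<X> P t \<longleftrightarrow> t \<in> maximal_ideal_at \<X> P \<and>
     (\<forall>g\<in>maximal_ideal_at \<X> P. \<exists>h\<in>local_ring \<X> P. g = t \<otimes>\<^bsub>function_field \<X>\<^esub> h)"

text \<open>
  The order of a nonzero \<open>f\<close> at a non-singular point \<open>P\<close>: the exponent \<open>n\<close> in \<open>f = t\<^sup>n u\<close> with
  \<open>t\<close> a local parameter and \<open>u\<close> a unit of the local ring. The value on the zero function is meaningless.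
\<close>

definition ord_at :: "'a::field point3 set \<Rightarrow> 'a point3 \<Rightarrow> 'a ratfun \<Rightarrow> int" where
  "ord_at \<X> P f = (THE n. \<exists>t u. local_parameter \<X> P t \<and> u \<in> local_ring \<X> P \<and> value_at P u \<noteq> 0 \<and>
     f = (t [^]\<^bsub>function_field \<X>\<^esub> n) \<otimes>\<^bsub>function_field \<X>\<^esub> u)"


section \<open>Rationality over the ground field, divisors and functional codes\<close>

text \<open>
  Curves live over \<open>'k alg_closure\<close>; the ground field is \<open>'k\<close>, embedded by \<^const>\<open>to_ac\<close>.
  Divisors are finitely supported integer functions on points.
\<close>

definition rational_points :: "'k::field alg_closure point3 set \<Rightarrow> 'k alg_closure point3 set" where
  "rational_points \<X> = {P \<in> \<X>. \<exists>v\<in>P. \<forall>i. v $ i \<in> range to_ac}"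

definition rational_functions :: "'k::field alg_closure point3 set \<Rightarrow> 'k alg_closure ratfun set" where
  "rational_functions \<X> = {ratfun \<X> F H | F H. (F, H) \<in> quotients \<X> \<and>
     (\<forall>m. Poly_Mapping.lookup F m \<in> range to_ac) \<and> (\<forall>m. Poly_Mapping.lookup H m \<in> range to_ac)}"

type_synonym 'a divisor3 = "'a point3 \<Rightarrow>\<^sub>0 int"

definition div_degree :: "'a::field divisor3 \<Rightarrow> int" where
  "div_degree G = (\<Sum>P\<in>Poly_Mapping.keys G. Poly_Mapping.lookup G P)"

definition riemann_roch_space ::
    "'k::field alg_closure point3 set \<Rightarrow> 'k alg_closure divisor3 \<Rightarrow> 'k alg_closure ratfun set" where
  "riemann_roch_space \<X> G =
     {f \<in> rational_functions \<X>. f \<noteq> \<zero>\<^bsub>function_field \<X>\<^esub> \<and>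
        (\<forall>P\<in>\<X>. ord_at \<X> P f + Poly_Mapping.lookup G P \<ge> 0)} \<union> {\<zero>\<^bsub>function_field \<X>\<^esub>}"

text \<open>
  \<open>C\<^sub>L(D,G)\<close> for \<open>D = P\<^sub>1 + \<dots> + P\<^sub>n\<close>, given by the list of its (distinct, rational) points; its words
  have entries in \<open>'k\<close>.
\<close>

definition functional_code ::
    "'k::field alg_closure point3 set \<Rightarrow> 'k alg_closure point3 list \<Rightarrow> 'k alg_closure divisor3
      \<Rightarrow> 'k list set" where
  "functional_code \<X> Ps G =
     {w. \<exists>f\<in>riemann_roch_space \<X> G. map to_ac w = map (\<lambda>P. value_at P f) Ps}"

definition hamming_distance :: "'k list \<Rightarrow> 'k list \<Rightarrow> nat" where
  "hamming_distance u w = card {i. i < length u \<and> u ! i \<noteq> w ! i}"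

text \<open>Meaningful only for codes with at least two words.\<close>

definition minimum_distance :: "'k list set \<Rightarrow> nat" where
  "minimum_distance C = Inf {hamming_distance u w | u w. u \<in> C \<and> w \<in> C \<and> u \<noteq> w}"


section \<open>The GK curve\<close>

text \<open>
  The closure is needed: besides the point at infinity of the curve, the two homogenised equations
  have the whole line \<open>Y = T = 0\<close> as common zeros.
\<close>

definition GK_curve :: "nat \<Rightarrow> 'a::field point3 set" where
  "GK_curve q = projective_closure {proj_point (vector [x, y, z, 1]) | x y z.
     y ^ (q + 1) = x ^ q + x \<and> z ^ (q\<^sup>2 - q + 1) = y ^ (q\<^sup>2) - y}"

text \<open>
  The pole orders of \<open>x, y, z\<close> at the point at infinity are \<open>q\<^sup>3 + 1\<close>, \<open>q\<^sup>3 - q\<^sup>2 + q\<close>, \<open>q\<^sup>3\<close>,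
  hence this point is \<open>(1 : 0 : 0 : 0)\<close>.
\<close>

definition P_infinity :: "'a::field point3" where
  "P_infinity = proj_point (vector [1, 0, 0, 0])"

definition zeta_plane :: "'k::field \<Rightarrow> 'k alg_closure point3 set" where
  "zeta_plane c = {P \<in> PG3. \<forall>v\<in>P. v $ 3 = to_ac c * v $ 4}"

definition Gamma_set :: "nat \<Rightarrow> 'k::field set" where
  "Gamma_set q = {c. c ^ ((q ^ 3 + 1) * (q\<^sup>2 - 1)) + c ^ ((q ^ 3 + 1) * (q\<^sup>2 - q)) + 1 = 0}"

definition Gamma0_set :: "nat \<Rightarrow> 'k::field set" where
  "Gamma0_set q = Gamma_set q \<union> {0}"

end

theory Submission
  imports Defs "HOL-Computational_Algebra.Formal_Laurent_Series" "HOL-Number_Theory.Residues"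
begin

text \<open>
  The lower bound for the minimum distance says that a non-zero function with poles bounded by \<open>G\<close>
  has at most \<open>deg G\<close> zeros, and the upper bound needs a function with exactly that many simple
  rational zeros. The latter is a quotient of products of planes \<open>Z = bT\<close>: such a plane meets the
  affine curve in \<open>q\<^sup>3\<close> distinct points, all rational when \<open>b \<in> \<Gamma>\<^sub>0\<close>, and meets it once at infinity.
  With \<open>n = q\<^sup>2 - q + 1\<close>, a trace computation (\<open>rational_fibre\<close>) identifies \<open>\<Gamma>\<^sub>0\<close> as the set of all rational
  values of \<open>z\<close> with rational points above them, and \<open>card_Gamma\<close> counts it. Hence positivity of the
  designed distance, that is \<open>(m + 1)(s + 1) \<le> |\<Gamma>\<^sub>0|\<close>, leaves the \<open>m (s + 1)\<close> free planes needed
  for the numerator (\<open>plane_quotient\<close>).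

  For the lower bound a principal divisor must have degree zero, and the orders of functions,
  which are defined through local parameters, must become computable. Both are obtained from explicit
  power series. At each point the homogeneous coordinates of a generic point of the curve are series
  in a local parameter: \<open>z - a\<close> at an affine point, where the equations of the curve are additive and
  separable in \<open>y\<close> and \<open>x\<close>, and \<open>z/x\<close> at infinity. The locale \<open>branched_curve\<close> shows that such
  branches turn the function field into a field of Laurent series at every point, with \<open>ord_at\<close>
  the order of a series (\<open>ord_at_eq_subdegree\<close>).

  Degree zero follows from Bezout's theorem for the curve (\<open>gk_bezout\<close>), and that from a norm. The
  automorphisms \<open>(x, y, z) \<mapsto> (x + b\<^sup>q y + g, y + b, z)\<close> act simply transitively on the fibres of \<open>z\<close>, so
  the product \<open>N\<close> of the conjugates of a polynomial \<open>F\<close> is a polynomial in \<open>z\<close> alone, and its order at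
  \<open>a\<close> is the number of zeros of \<open>F\<close> above \<open>a\<close>. The normal form of \<open>F\<close>, with monomials \<open>x\<^sup>i y\<^sup>j\<close> for \<open>i < q\<close>
  and \<open>j < q\<^sup>2\<close> over \<open>K[z]\<close>, has terms of pairwise different pole orders at infinity. Therefore a
  polynomial with non-zero normal form vanishes along no branch, which is the irreducibility of the
  curve, and the degree of \<open>N\<close> is the pole order of \<open>F\<close> at infinity (\<open>vanishing_or_norm\<close>).
\<close>

section \<open>Evaluation of quaternary polynomials in algebras\<close>

locale scalar_hom =
  fixes h :: "'a::comm_ring_1 \<Rightarrow> 'b::comm_ring_1"
  assumes hom_add: "h (a + b) = h a + h b"
    and hom_mult: "h (a * b) = h a * h b"
    and hom_one: "h 1 = 1"
begin

lemma hom_zero: "h 0 = 0"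
  using hom_add[of 0 0] by simp

lemma hom_uminus: "h (- a) = - h a"
  using hom_add[of a "- a"] by (simp add: hom_zero eq_neg_iff_add_eq_0 add.commute)

lemma hom_diff: "h (a - b) = h a - h b"
  using hom_add[of a "- b"] by (simp add: hom_uminus)

lemma hom_power: "h (a ^ k) = h a ^ k"
  by (induction k) (simp_all add: hom_one hom_mult)

lemma hom_sum: "h (\<Sum>x\<in>A. f x) = (\<Sum>x\<in>A. h (f x))"
  by (induction A rule: infinite_finite_induct) (simp_all add: hom_zero hom_add)

lemma hom_prod: "h (\<Prod>x\<in>A. f x) = (\<Prod>x\<in>A. h (f x))"
  by (induction A rule: infinite_finite_induct) (simp_all add: hom_one hom_mult)

lemmas homs = hom_add hom_mult hom_one hom_zero hom_uminus hom_diff hom_power hom_sum hom_prod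

end

lemma scalar_hom_id: "scalar_hom (\<lambda>a. a)"
  by unfold_locales simp_all

lemma scalar_hom_fps_const: "scalar_hom fps_const"
  by unfold_locales simp_all

lemma scalar_hom_fls_const: "scalar_hom fls_const"
  by unfold_locales (simp_all add: fls_plus_const fls_const_mult_const)

lemma scalar_hom_fps_nth_0: "scalar_hom (\<lambda>f. fps_nth f 0)"
  by unfold_locales simp_all

lemma scalar_hom_fps_to_fls: "scalar_hom fps_to_fls"
  by unfold_locales (simp_all add: fls_times_fps_to_fls)

definition monom4 :: "(4 \<Rightarrow> 'b::comm_monoid_mult) \<Rightarrow> (4 \<Rightarrow>\<^sub>0 nat) \<Rightarrow> 'b" where
  "monom4 v m = (\<Prod>i\<in>UNIV. v i ^ Poly_Mapping.lookup m i)"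

text \<open>
  The coefficients act through \<open>h\<close>, so that values at points, expansions along power or Laurent
  series and substitution of polynomials into each other are instances of one construction.
\<close>

definition ev :: "('a::comm_ring_1 \<Rightarrow> 'b::comm_ring_1) \<Rightarrow> 'a poly4 \<Rightarrow> (4 \<Rightarrow> 'b) \<Rightarrow> 'b" where
  "ev h F v = (\<Sum>m\<in>Poly_Mapping.keys F. h (Poly_Mapping.lookup F m) * monom4 v m)"

lemma eval4_eq_ev: "eval4 F v = ev (\<lambda>a. a) F (\<lambda>i. v $ i)"
  by (simp add: eval4_def ev_def monom4_def)

lemma monom4_add: "monom4 v (m + m') = monom4 v m * monom4 v m'"
  by (simp add: monom4_def lookup_add power_add prod.distrib)

lemma monom4_zero [simp]: "monom4 v 0 = 1"
  by (simp add: monom4_def)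

lemma monom4_single [simp]: "monom4 v (Poly_Mapping.single i k) = v i ^ k"
proof -
  have "monom4 v (Poly_Mapping.single i k) = (\<Prod>j\<in>UNIV. if j = i then v i ^ k else 1)"
    unfolding monom4_def by (rule prod.cong) (auto simp: lookup_single when_def)
  then show ?thesis by simp
qed

lemma poly4_eq_sum_monomials:
  fixes F :: "'m \<Rightarrow>\<^sub>0 'a::comm_monoid_add"
  shows "F = (\<Sum>m\<in>Poly_Mapping.keys F. Poly_Mapping.single m (Poly_Mapping.lookup F m))"
proof (rule poly_mapping_eqI)
  fix k
  have "Poly_Mapping.lookup (\<Sum>m\<in>Poly_Mapping.keys F. Poly_Mapping.single m (Poly_Mapping.lookup F m)) k
      = (\<Sum>m\<in>Poly_Mapping.keys F. if m = k then Poly_Mapping.lookup F k else 0)"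
    unfolding lookup_sum by (rule sum.cong) (auto simp: lookup_single when_def)
  also have "\<dots> = Poly_Mapping.lookup F k"
    by (simp add: in_keys_iff)
  finally show "Poly_Mapping.lookup F k = Poly_Mapping.lookup
     (\<Sum>m\<in>Poly_Mapping.keys F. Poly_Mapping.single m (Poly_Mapping.lookup F m)) k" by simp
qed

definition const4 :: "'a::comm_ring_1 \<Rightarrow> 'a poly4" where
  "const4 c = Poly_Mapping.single 0 c"

definition var4 :: "4 \<Rightarrow> 'a::comm_ring_1 poly4" where
  "var4 i = Poly_Mapping.single (Poly_Mapping.single i 1) 1"

lemma scalar_hom_const4: "scalar_hom const4"
  by unfold_locales (simp_all add: const4_def single_add mult_single)

context scalar_hom
begin

lemma ev_superset:
  assumes "finite S" "Poly_Mapping.keys F \<subseteq> S"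
  shows "ev h F v = (\<Sum>m\<in>S. h (Poly_Mapping.lookup F m) * monom4 v m)"
  unfolding ev_def
  by (rule sum.mono_neutral_left) (use assms in \<open>auto simp: in_keys_iff hom_zero\<close>)

lemma ev_zero [simp]: "ev h 0 v = 0"
  by (simp add: ev_def)

lemma ev_add: "ev h (F + G) v = ev h F v + ev h G v"
proof -
  let ?S = "Poly_Mapping.keys F \<union> Poly_Mapping.keys G"
  have "ev h (F + G) v = (\<Sum>m\<in>?S. h (Poly_Mapping.lookup (F + G) m) * monom4 v m)"
    by (rule ev_superset) (use keys_add[of F G] in auto)
  also have "\<dots> = (\<Sum>m\<in>?S. h (Poly_Mapping.lookup F m) * monom4 v m)
      + (\<Sum>m\<in>?S. h (Poly_Mapping.lookup G m) * monom4 v m)"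
    by (simp add: lookup_add hom_add distrib_right sum.distrib)
  also have "\<dots> = ev h F v + ev h G v"
    using ev_superset[of ?S F v] ev_superset[of ?S G v] by simp
  finally show ?thesis .
qed

lemma ev_sum: "ev h (\<Sum>x\<in>A. F x) v = (\<Sum>x\<in>A. ev h (F x) v)"
  by (induction A rule: infinite_finite_induct) (simp_all add: ev_add)

lemma ev_single: "ev h (Poly_Mapping.single m c) v = h c * monom4 v m"
  by (cases "c = 0") (simp_all add: ev_def hom_zero)

lemma ev_const4 [simp]: "ev h (const4 c) v = h c"
  by (simp add: const4_def ev_single)

lemma ev_var4 [simp]: "ev h (var4 i) v = v i"
  by (simp add: var4_def ev_single hom_one)

lemma ev_one [simp]: "ev h 1 v = 1"
  using ev_const4[of 1 v] by (simp add: const4_def hom_one)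

lemma ev_mult: "ev h (F * G) v = ev h F v * ev h G v"
proof -
  let ?f = "\<lambda>m. Poly_Mapping.lookup F m" and ?g = "\<lambda>m. Poly_Mapping.lookup G m"
  have "F * G = (\<Sum>m\<in>Poly_Mapping.keys F. Poly_Mapping.single m (?f m))
      * (\<Sum>m\<in>Poly_Mapping.keys G. Poly_Mapping.single m (?g m))"
    using poly4_eq_sum_monomials[of F] poly4_eq_sum_monomials[of G] by simp
  also have "\<dots> = (\<Sum>m\<in>Poly_Mapping.keys F. \<Sum>m'\<in>Poly_Mapping.keys G.
      Poly_Mapping.single (m + m') (?f m * ?g m'))"
    by (simp add: sum_product mult_single)
  finally have "ev h (F * G) v = (\<Sum>m\<in>Poly_Mapping.keys F. \<Sum>m'\<in>Poly_Mapping.keys G.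
      (h (?f m) * monom4 v m) * (h (?g m') * monom4 v m'))"
    by (simp add: ev_sum ev_single monom4_add hom_mult mult_ac)
  then show ?thesis
    by (simp add: ev_def sum_product)
qed

lemma scalar_hom_ev: "scalar_hom (\<lambda>F. ev h F v)"
  by unfold_locales (simp_all add: ev_add ev_mult)

interpretation ev: scalar_hom "\<lambda>F. ev h F v" for v
  by (rule scalar_hom_ev)

lemmas ev_homs = ev_add ev_mult ev.hom_diff ev.hom_uminus ev.hom_power ev.hom_sum ev.hom_prod

lemma hom_ev:
  assumes "scalar_hom \<phi>"
  shows "\<phi> (ev h F v) = ev (\<lambda>a. \<phi> (h a)) F (\<lambda>i. \<phi> (v i))"
proof -
  interpret \<phi>: scalar_hom \<phi> by fact
  show ?thesis by (simp add: ev_def \<phi>.homs monom4_def)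
qed

end

lemma ev_homogeneous:
  fixes h :: "'a::field \<Rightarrow> 'b::comm_ring_1"
  assumes "scalar_hom h" "form d F"
  shows "ev h F (\<lambda>i. c * v i) = c ^ d * ev h F v"
proof -
  have "monom4 (\<lambda>i. c * v i) m = c ^ d * monom4 v m" if "m \<in> Poly_Mapping.keys F" for m
  proof -
    have "(\<Prod>i\<in>UNIV. c ^ Poly_Mapping.lookup m i) = c ^ d"
      using assms(2) that by (simp add: form_def flip: power_sum)
    then show ?thesis by (simp add: monom4_def power_mult_distrib prod.distrib)
  qed
  then show ?thesis
    by (simp add: ev_def sum_distrib_left mult_ac)
qed

lemma ev_const4_var4: "ev const4 F var4 = F"
proof -
  have V: "var4 i ^ k = (Poly_Mapping.single (Poly_Mapping.single i k) 1 :: 'a poly4)" for i k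
  proof (induction k)
    case (Suc k)
    then show ?case by (simp add: var4_def mult_single flip: single_add)
  qed simp
  have P: "(\<Prod>i\<in>A. Poly_Mapping.single (f i) 1) = (Poly_Mapping.single (sum f A) 1 :: 'a poly4)"
    for A :: "4 set" and f
    by (induction A rule: infinite_finite_induct) (simp_all add: mult_single)
  have M: "(\<Sum>i\<in>UNIV. Poly_Mapping.single i (Poly_Mapping.lookup m i)) = m" for m :: "4 \<Rightarrow>\<^sub>0 nat"
  proof (rule poly_mapping_eqI)
    fix k
    have "(\<Sum>i\<in>UNIV. Poly_Mapping.lookup (Poly_Mapping.single i (Poly_Mapping.lookup m i)) k)
       = (\<Sum>i\<in>UNIV. if i = k then Poly_Mapping.lookup m k else 0)"
      by (rule sum.cong) (auto simp: lookup_single when_def)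
    then show "Poly_Mapping.lookup (\<Sum>i\<in>UNIV. Poly_Mapping.single i (Poly_Mapping.lookup m i)) k
        = Poly_Mapping.lookup m k"
      by (simp add: lookup_sum)
  qed
  have "monom4 var4 m = (Poly_Mapping.single m 1 :: 'a poly4)" for m
    by (simp add: monom4_def V P M)
  then have "ev const4 F var4 = (\<Sum>m\<in>Poly_Mapping.keys F. Poly_Mapping.single m (Poly_Mapping.lookup F m))"
    by (simp add: ev_def const4_def mult_single)
  then show ?thesis using poly4_eq_sum_monomials[of F] by simp
qed

lemma form_zero [simp]: "form d 0"
  by (simp add: form_def)

lemma form_add: "form d F \<Longrightarrow> form d G \<Longrightarrow> form d (F + G)"
  using keys_add[of F G] unfolding form_def by blast

lemma form_uminus: "form d F \<Longrightarrow> form d (- F)"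
  by (simp add: form_def in_keys_iff)

lemma form_diff: "form d F \<Longrightarrow> form d G \<Longrightarrow> form d (F - G)"
  using form_add[of d F "- G"] form_uminus[of d G] by simp

lemma form_mult: "form d F \<Longrightarrow> form e G \<Longrightarrow> form (d + e) (F * G)"
  using keys_mult[of F G] by (fastforce simp: form_def lookup_add sum.distrib)

lemma form_const4 [simp]: "form 0 (const4 c)"
  by (simp add: form_def const4_def)

lemma form_one [simp]: "form 0 1"
  by (simp add: form_def)

lemma form_var4 [simp]: "form (Suc 0) (var4 i)"
  by (simp add: form_def var4_def lookup_single when_def)

lemma form_smult_var4 [simp]: "form (Suc 0) (const4 c * var4 i)"
  using form_mult[of 0 "const4 c" "Suc 0" "var4 i"] by simp

lemma form_power: "form d F \<Longrightarrow> form (k * d) (F ^ k)"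
  by (induction k) (simp_all add: form_mult)

lemma form_prod: "(\<And>x. x \<in> A \<Longrightarrow> form d (F x)) \<Longrightarrow> form (card A * d) (\<Prod>x\<in>A. F x)"
  by (induction A rule: infinite_finite_induct) (simp_all add: form_mult)

lemma vanishes_at_proj_point:
  assumes "form d F"
  shows "vanishes_at F (proj_point v) \<longleftrightarrow> eval4 F v = 0"
proof -
  have eq: "eval4 F (a *s v) = a ^ d * eval4 F v" for a
    using ev_homogeneous[OF scalar_hom_id assms, of a "\<lambda>i. v $ i"]
    by (simp add: eval4_eq_ev)
  have "vanishes_at F (proj_point v) \<longleftrightarrow> (\<forall>a. a \<noteq> 0 \<longrightarrow> eval4 F (a *s v) = 0)"
    unfolding vanishes_at_def proj_point_def by blast
  also have "\<dots> \<longleftrightarrow> eval4 F v = 0"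
    unfolding eq using zero_neq_one by fastforce
  finally show ?thesis .
qed

lemma proj_point_scale: "a \<noteq> 0 \<Longrightarrow> proj_point (a *s v) = proj_point v"
  unfolding proj_point_def
  by (auto simp: vector_smult_assoc) (metis divide_self_if mult.commute mult_zero_right no_zero_divisors
      nonzero_mult_div_cancel_right times_divide_eq_left zero_neq_one)

lemma proj_point_self: "v \<in> proj_point v"
  unfolding proj_point_def using vector_smult_lid[of v] zero_neq_one by (metis (mono_tags, lifting) mem_Collect_eq)

section \<open>Branches and the local rings they see\<close>

text \<open>
  The image in \<open>K[[t]]\<close> of the algebraic local ring of the point at the centre of \<open>\<xi>\<close>.
\<close>

definition branch_ring :: "(4 \<Rightarrow> 'a::field fps) \<Rightarrow> 'a fps set" where
  "branch_ring \<xi> = {ev fps_const A \<xi> * inverse (ev fps_const B \<xi>) | A B d.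
     form d A \<and> form d B \<and> fps_nth (ev fps_const B \<xi>) 0 \<noteq> 0}"

interpretation fpsc: scalar_hom fps_const
  by (rule scalar_hom_fps_const)

lemma branch_ringI:
  "form d A \<Longrightarrow> form d B \<Longrightarrow> fps_nth (ev fps_const B \<xi>) 0 \<noteq> 0 \<Longrightarrow>
    ev fps_const A \<xi> * inverse (ev fps_const B \<xi>) \<in> branch_ring \<xi>"
  unfolding branch_ring_def by blast

lemma branch_ringE:
  assumes "f \<in> branch_ring \<xi>"
  obtains A B d where "form d A" "form d B" "fps_nth (ev fps_const B \<xi>) 0 \<noteq> 0"
    "f = ev fps_const A \<xi> * inverse (ev fps_const B \<xi>)"
  using assms unfolding branch_ring_def by blast

lemma fps_to_fls_divide:
  fixes A B :: "'a::field fps"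
  assumes "fps_nth B 0 \<noteq> 0"
  shows "fps_to_fls A / fps_to_fls B = fps_to_fls (A * inverse B)"
proof -
  have B: "B * inverse B = 1" "B \<noteq> 0" using assms by (auto simp: inverse_mult_eq_1')
  then have "fps_to_fls (A * inverse B) * fps_to_fls B = fps_to_fls A"
    by (simp add: mult_ac flip: fls_times_fps_to_fls)
  then show ?thesis using B(2) by (simp add: divide_eq_eq)
qed

lemma branch_ring_const: "fps_const c \<in> branch_ring \<xi>"
  using branch_ringI[of 0 "const4 c" 1 \<xi>] by simp

lemma branch_ring_add:
  assumes "f \<in> branch_ring \<xi>" "g \<in> branch_ring \<xi>"
  shows "f + g \<in> branch_ring \<xi>"
proof -
  from assms(1) obtain A B d where 1: "form d A" "form d B" "fps_nth (ev fps_const B \<xi>) 0 \<noteq> 0"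
    "f = ev fps_const A \<xi> * inverse (ev fps_const B \<xi>)" by (rule branch_ringE)
  from assms(2) obtain A' B' d' where 2: "form d' A'" "form d' B'" "fps_nth (ev fps_const B' \<xi>) 0 \<noteq> 0"
    "g = ev fps_const A' \<xi> * inverse (ev fps_const B' \<xi>)" by (rule branch_ringE)
  have "ev fps_const (A * B' + A' * B) \<xi> * inverse (ev fps_const (B * B') \<xi>) \<in> branch_ring \<xi>"
    using form_mult[OF 1(1) 2(2)] form_mult[OF 2(1) 1(2)] form_mult[OF 1(2) 2(2)] 1(3) 2(3)
    by (intro branch_ringI[of "d + d'"] form_add) (simp_all add: fpsc.ev_homs add.commute)
  also have "ev fps_const (A * B' + A' * B) \<xi> * inverse (ev fps_const (B * B') \<xi>) = f + g"
  proof -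
    let ?b = "ev fps_const B \<xi>" and ?b' = "ev fps_const B' \<xi>"
    have "?b * inverse ?b = 1" "?b' * inverse ?b' = 1"
      using 1(3) 2(3) by (simp_all add: inverse_mult_eq_1')
    moreover have "(a * b' + a' * b) * (i * i') = a * i * (b' * i') + a' * i' * (b * i)"
      for a a' b b' i i' :: "'a fps" by (simp add: algebra_simps)
    ultimately show ?thesis
      unfolding 1(4) 2(4) fpsc.ev_homs fps_inverse_mult by simp
  qed
  finally show ?thesis .
qed

lemma branch_ring_mult:
  assumes "f \<in> branch_ring \<xi>" "g \<in> branch_ring \<xi>"
  shows "f * g \<in> branch_ring \<xi>"
proof -
  from assms(1) obtain A B d where 1: "form d A" "form d B" "fps_nth (ev fps_const B \<xi>) 0 \<noteq> 0"
    "f = ev fps_const A \<xi> * inverse (ev fps_const B \<xi>)" by (rule branch_ringE)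
  from assms(2) obtain A' B' d' where 2: "form d' A'" "form d' B'" "fps_nth (ev fps_const B' \<xi>) 0 \<noteq> 0"
    "g = ev fps_const A' \<xi> * inverse (ev fps_const B' \<xi>)" by (rule branch_ringE)
  have "ev fps_const (A * A') \<xi> * inverse (ev fps_const (B * B') \<xi>) \<in> branch_ring \<xi>"
    using form_mult[OF 1(1) 2(1)] form_mult[OF 1(2) 2(2)] 1(3) 2(3)
    by (intro branch_ringI[of "d + d'"]) (simp_all add: fpsc.ev_homs)
  also have "ev fps_const (A * A') \<xi> * inverse (ev fps_const (B * B') \<xi>) = f * g"
    unfolding 1(4) 2(4) fpsc.ev_homs fps_inverse_mult by (simp add: mult_ac)
  finally show ?thesis .
qed

lemma branch_ring_diff:
  assumes "f \<in> branch_ring \<xi>" "g \<in> branch_ring \<xi>"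
  shows "f - g \<in> branch_ring \<xi>"
  using branch_ring_add[OF assms(1) branch_ring_mult[OF branch_ring_const[of "-1"] assms(2)]]
  by (simp flip: fps_const_neg)

lemma branch_ring_one: "1 \<in> branch_ring \<xi>"
  using branch_ring_const[of 1 \<xi>] by simp

lemma branch_ring_power: "f \<in> branch_ring \<xi> \<Longrightarrow> f ^ k \<in> branch_ring \<xi>"
  by (induction k) (auto intro: branch_ring_mult branch_ring_one)

lemma branch_ring_inverse:
  assumes "f \<in> branch_ring \<xi>" "fps_nth f 0 \<noteq> 0"
  shows "inverse f \<in> branch_ring \<xi>"
proof -
  from assms(1) obtain A B d where 1: "form d A" "form d B" "fps_nth (ev fps_const B \<xi>) 0 \<noteq> 0"
    "f = ev fps_const A \<xi> * inverse (ev fps_const B \<xi>)" by (rule branch_ringE)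
  then have "fps_nth (ev fps_const A \<xi>) 0 \<noteq> 0"
    using assms(2) by auto
  from branch_ringI[OF 1(2) 1(1) this] show ?thesis
    using 1(3) by (simp add: 1(4) fps_inverse_mult mult.commute)
qed

lemma branch_ring_form:
  assumes "\<xi> j = 1" "form d F"
  shows "ev fps_const F \<xi> \<in> branch_ring \<xi>"
  using branch_ringI[OF assms(2) form_power[OF form_var4[of j], of d, simplified], of \<xi>] assms(1)
  by (simp add: fpsc.ev_homs)

lemma branch_ring_coordinate: "\<xi> j = 1 \<Longrightarrow> \<xi> i \<in> branch_ring \<xi>"
  using branch_ring_form[of \<xi> j 1 "var4 i"] by simp

text \<open>
  That \<open>t\<close> generates the maximal ideal is demanded in the algebraic local ring: in its completion
  every series of order one does.
\<close>

definition branch_uniformizer :: "(4 \<Rightarrow> 'a::field fps) \<Rightarrow> 'a fps \<Rightarrow> bool" where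
  "branch_uniformizer \<xi> t \<longleftrightarrow> t \<in> branch_ring \<xi> \<and> subdegree t = 1 \<and>
    (\<forall>f\<in>branch_ring \<xi>. fps_nth f 0 = 0 \<longrightarrow> (\<exists>h\<in>branch_ring \<xi>. f = t * h))"

text \<open>
  The local ring is generated by the coordinates and by inverses of units, and the set of elements
  congruent to their constant term modulo \<open>t\<close> is closed under the same operations. So only the
  coordinates have to be inspected to see that \<open>t\<close> generates the maximal ideal.
\<close>

lemma uniformizer_from_coordinates:
  assumes j: "\<xi> j = 1" and t: "t \<in> branch_ring \<xi>" "subdegree t = 1"
    and coord: "\<And>i. \<exists>h\<in>branch_ring \<xi>. \<xi> i - fps_const (fps_nth (\<xi> i) 0) = t * h"
  shows "branch_uniformizer \<xi> t"
  unfolding branch_uniformizer_def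
proof (intro conjI ballI impI t)
  let ?O = "branch_ring \<xi>"
  fix f assume f: "f \<in> ?O" "fps_nth f 0 = 0"
  define Q where "Q = {f. \<exists>h\<in>?O. f - fps_const (fps_nth f 0) = t * h}"
  have QO: "f \<in> ?O" if "f \<in> Q" for f
  proof -
    from that obtain h where "h \<in> ?O" "f - fps_const (fps_nth f 0) = t * h" by (auto simp: Q_def)
    then have "f = t * h + fps_const (fps_nth f 0)" by (simp add: algebra_simps)
    then show ?thesis
      using branch_ring_add[OF branch_ring_mult[OF t(1) \<open>h \<in> ?O\<close>] branch_ring_const] by metis
  qed
  have Qc: "fps_const c \<in> Q" for c
    using branch_ring_const[of 0 \<xi>] by (auto simp: Q_def intro!: bexI[of _ 0])
  have Qa: "f + g \<in> Q" if fg: "f \<in> Q" "g \<in> Q" for f g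
  proof -
    from fg obtain h k where "h \<in> ?O" "f - fps_const (fps_nth f 0) = t * h"
      "k \<in> ?O" "g - fps_const (fps_nth g 0) = t * k" by (auto simp: Q_def)
    then show ?thesis
      using branch_ring_add[of h \<xi> k]
      by (auto simp: Q_def algebra_simps simp flip: fps_const_add intro!: bexI[of _ "h + k"])
  qed
  have Qm: "f * g \<in> Q" if fg: "f \<in> Q" "g \<in> Q" for f g
  proof -
    from fg obtain h k where hk: "h \<in> ?O" "f - fps_const (fps_nth f 0) = t * h"
      "k \<in> ?O" "g - fps_const (fps_nth g 0) = t * k" by (auto simp: Q_def)
    have "f * g - fps_const (fps_nth (f * g) 0) = t * (h * g + fps_const (fps_nth f 0) * k)"
    proof -
      have "fps_const (fps_nth (f * g) 0) = fps_const (fps_nth f 0) * fps_const (fps_nth g 0)"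
        by simp
      moreover have "f * g - c * d = (f - c) * g + c * (g - d)" for c d
        by (simp add: algebra_simps)
      ultimately show ?thesis by (simp only: hk(2,4)) (simp add: algebra_simps)
    qed
    moreover have "h * g + fps_const (fps_nth f 0) * k \<in> ?O"
      by (intro branch_ring_add branch_ring_mult branch_ring_const hk QO fg)
    ultimately show ?thesis unfolding Q_def by blast
  qed
  have Qp: "f ^ k \<in> Q" if "f \<in> Q" for f k
    by (induction k) (use that Qm Qc[of 1] in auto)
  have Qx: "\<xi> i \<in> Q" for i
    using coord[of i] by (simp add: Q_def)
  have Qmon: "monom4 \<xi> m \<in> Q" for m
  proof -
    have "(\<Prod>i\<in>A. \<xi> i ^ Poly_Mapping.lookup m i) \<in> Q" for A
      by (induction A rule: infinite_finite_induct) (use Qc[of 1] Qm Qp Qx in auto)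
    then show ?thesis by (simp add: monom4_def)
  qed
  have Qev: "ev fps_const F \<xi> \<in> Q" for F
  proof -
    have "(\<Sum>m\<in>A. fps_const (Poly_Mapping.lookup F m) * monom4 \<xi> m) \<in> Q" for A
      by (induction A rule: infinite_finite_induct) (use Qc[of 0] Qc Qa Qm Qmon in auto)
    then show ?thesis by (simp add: ev_def)
  qed
  from f(1) obtain A B d where 1: "fps_nth (ev fps_const B \<xi>) 0 \<noteq> 0"
    "f = ev fps_const A \<xi> * inverse (ev fps_const B \<xi>)" and AB: "form d A" "form d B"
    by (rule branch_ringE)
  have "fps_nth (ev fps_const A \<xi>) 0 = 0"
    using f(2) 1 by simp
  then obtain h where h: "h \<in> ?O" "ev fps_const A \<xi> = t * h"
    using Qev[of A] by (auto simp: Q_def)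
  have "inverse (ev fps_const B \<xi>) \<in> ?O"
    by (rule branch_ring_inverse[OF branch_ring_form[of \<xi>, OF j AB(2)] 1(1)])
  then have "h * inverse (ev fps_const B \<xi>) \<in> ?O"
    by (rule branch_ring_mult[OF h(1)])
  then show "\<exists>h\<in>?O. f = t * h" unfolding 1(2) h(2) by (auto simp: mult.assoc)
qed

text \<open>
  Dividing by \<open>t\<close> lowers the order by one and stays inside the algebraic local ring, so an element of
  order \<open>k\<close> is \<open>t\<^sup>k\<close> times a unit of that ring, not only of its completion.
\<close>

lemma branch_ring_factor:
  assumes t: "branch_uniformizer \<xi> t" and f: "f \<in> branch_ring \<xi>" "f \<noteq> 0"
  shows "\<exists>h\<in>branch_ring \<xi>. f = t ^ subdegree f * h \<and> fps_nth h 0 \<noteq> 0"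
  using f
proof (induction "subdegree f" arbitrary: f)
  case 0
  then show ?case by (metis mult_1 nth_subdegree_nonzero power_0)
next
  case (Suc k)
  then have "fps_nth f 0 = 0" by (metis nth_less_subdegree_zero zero_less_Suc)
  with Suc.prems t obtain g where g: "g \<in> branch_ring \<xi>" "f = t * g"
    unfolding branch_uniformizer_def by blast
  with Suc.prems have nz: "g \<noteq> 0" "t \<noteq> 0" by auto
  then have sub: "subdegree f = Suc (subdegree g)" using g t by (simp add: branch_uniformizer_def)
  then obtain h where "h \<in> branch_ring \<xi>" "g = t ^ subdegree g * h" "fps_nth h 0 \<noteq> 0"
    using Suc.hyps(1)[of g] Suc.hyps(2) g nz by auto
  then show ?case using sub g(2) by (auto simp: mult.assoc intro!: bexI[of _ h])
qed

section \<open>Function fields of curves with a uniformizing branch at every point\<close>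

text \<open>
  At a non-singular point \<open>P\<close> of a curve the completed local ring is \<open>K[[t]]\<close>, so homogeneous
  coordinates of the generic point can be written as power series in a local parameter. The locale
  asks for such coordinates \<open>br P\<close> at every point. Membership in the homogeneous ideal is then
  decided by evaluation at any single branch, which makes the function field a subfield of the
  Laurent series field at every point.
\<close>

locale branched_curve =
  fixes \<X> :: "'a::field point3 set" and br :: "'a point3 \<Rightarrow> 4 \<Rightarrow> 'a fps"
  assumes point_eq: "P \<in> \<X> \<Longrightarrow> P = proj_point (\<chi> i. fps_nth (br P i) 0)"
    and unit_coordinate: "P \<in> \<X> \<Longrightarrow> \<exists>j. br P j = 1"
    and vanishes_iff: "P \<in> \<X> \<Longrightarrow> form d F \<Longrightarrow>
      (\<forall>Q\<in>\<X>. vanishes_at F Q) \<longleftrightarrow> ev fps_const F (br P) = 0"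
    and uniformizer: "P \<in> \<X> \<Longrightarrow> \<exists>t. branch_uniformizer (br P) t"
begin

abbreviation at_branch :: "'a point3 \<Rightarrow> 'a poly4 \<Rightarrow> 'a fps" where
  "at_branch P F \<equiv> ev fps_const F (br P)"

definition quot_germ :: "'a point3 \<Rightarrow> 'a poly4 \<Rightarrow> 'a poly4 \<Rightarrow> 'a fls" where
  "quot_germ P F H = fps_to_fls (at_branch P F) / fps_to_fls (at_branch P H)"

text \<open>
  By \<open>quot_rel_iff\<close> below, all representatives of a function have the same quotient of expansions.
\<close>

definition germ :: "'a point3 \<Rightarrow> 'a ratfun \<Rightarrow> 'a fls" where
  "germ P f = (THE g. \<exists>(F, H)\<in>f. g = quot_germ P F H)"

abbreviation "KX \<equiv> function_field \<X>"

lemma vanishes_at_branch: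
  assumes "P \<in> \<X>" "form d F"
  shows "vanishes_at F P \<longleftrightarrow> fps_nth (at_branch P F) 0 = 0"
proof -
  have "vanishes_at F P \<longleftrightarrow> eval4 F (\<chi> i. fps_nth (br P i) 0) = 0"
    using vanishes_at_proj_point[OF assms(2)] point_eq[OF assms(1)] by metis
  also have "eval4 F (\<chi> i. fps_nth (br P i) 0) = fps_nth (at_branch P F) 0"
    by (simp add: eval4_eq_ev fpsc.hom_ev[OF scalar_hom_fps_nth_0])
  finally show ?thesis .
qed

lemma quotientsD:
  assumes "(F, H) \<in> quotients \<X>" "P \<in> \<X>"
  obtains d where "form d F" "form d H" "at_branch P H \<noteq> 0"
  using assms vanishes_iff unfolding quotients_def by blast

lemma quotientsI:
  assumes "form d F" "form d H" "at_branch P H \<noteq> 0" "P \<in> \<X>"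
  shows "(F, H) \<in> quotients \<X>"
  using assms vanishes_iff unfolding quotients_def by blast

lemma quotients_nonempty: "(F, H) \<in> quotients \<X> \<Longrightarrow> \<exists>P. P \<in> \<X>"
  unfolding quotients_def by blast

text \<open>
  The forms vanishing on the curve are those vanishing along one branch, so two quotients represent
  the same function iff their Laurent series at a single point agree.
\<close>

lemma quot_rel_iff:
  assumes "P \<in> \<X>"
  shows "((F, H), (F', H')) \<in> quot_rel \<X> \<longleftrightarrow>
    (F, H) \<in> quotients \<X> \<and> (F', H') \<in> quotients \<X> \<and> quot_germ P F H = quot_germ P F' H'"
proof (cases "(F, H) \<in> quotients \<X> \<and> (F', H') \<in> quotients \<X>")
  case True
  from True assms obtain d where d: "form d F" "form d H" "at_branch P H \<noteq> 0"
    by (meson quotientsD)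
  from True assms obtain d' where d': "form d' F'" "form d' H'" "at_branch P H' \<noteq> 0"
    by (meson quotientsD)
  have "form (d + d') (F * H' - F' * H)"
    using form_mult[OF d(1) d'(2)] form_mult[OF d'(1) d(2)]
    by (intro form_diff) (simp_all add: add.commute)
  then have "(\<forall>P\<in>\<X>. vanishes_at (F * H' - F' * H) P) \<longleftrightarrow>
      at_branch P F * at_branch P H' = at_branch P F' * at_branch P H"
    using vanishes_iff[OF assms] by (simp add: fpsc.ev_homs)
  also have "\<dots> \<longleftrightarrow> quot_germ P F H = quot_germ P F' H'"
    using d(3) d'(3)
    by (simp add: quot_germ_def frac_eq_eq flip: fls_times_fps_to_fls)
  finally show ?thesis using True by (simp add: quot_rel_def)
qed (auto simp: quot_rel_def)

lemma mem_ratfun_iff: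
  assumes "P \<in> \<X>" "(F, H) \<in> quotients \<X>"
  shows "(F', H') \<in> ratfun \<X> F H \<longleftrightarrow> (F', H') \<in> quotients \<X> \<and> quot_germ P F' H' = quot_germ P F H"
  unfolding ratfun_def using quot_rel_iff[OF assms(1)] assms(2) by auto

lemma ratfun_eq_iff:
  assumes "P \<in> \<X>" "(F, H) \<in> quotients \<X>" "(F', H') \<in> quotients \<X>"
  shows "ratfun \<X> F H = ratfun \<X> F' H' \<longleftrightarrow> quot_germ P F H = quot_germ P F' H'"
proof
  assume "ratfun \<X> F H = ratfun \<X> F' H'"
  then show "quot_germ P F H = quot_germ P F' H'"
    using mem_ratfun_iff[OF assms(1,2), of F H] mem_ratfun_iff[OF assms(1,3), of F H] assms(2) by simp
next
  assume "quot_germ P F H = quot_germ P F' H'"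
  then show "ratfun \<X> F H = ratfun \<X> F' H'"
    using mem_ratfun_iff[OF assms(1,2)] mem_ratfun_iff[OF assms(1,3)] by auto
qed

lemma germ_ratfun:
  assumes "P \<in> \<X>" "(F, H) \<in> quotients \<X>"
  shows "germ P (ratfun \<X> F H) = quot_germ P F H"
  unfolding germ_def
proof (rule the_equality)
  show "\<exists>(F', H')\<in>ratfun \<X> F H. quot_germ P F H = quot_germ P F' H'"
    using mem_ratfun_iff[OF assms, of F H] assms(2) by auto
qed (use mem_ratfun_iff[OF assms] in auto)

lemma ratfun_in_carrier: "(F, H) \<in> quotients \<X> \<Longrightarrow> ratfun \<X> F H \<in> carrier KX"
  by (auto simp: function_field_def ratfun_def intro: quotientI)

lemma carrierE:
  assumes "f \<in> carrier KX"
  obtains F H where "(F, H) \<in> quotients \<X>" "f = ratfun \<X> F H"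
  using assms by (auto simp: function_field_def ratfun_def elim!: quotientE)

lemma germ_inj:
  assumes "P \<in> \<X>" "f \<in> carrier KX" "g \<in> carrier KX" "germ P f = germ P g"
  shows "f = g"
  using assms ratfun_eq_iff germ_ratfun by (metis carrierE)

lemma quotients_mult:
  assumes "(F, H) \<in> quotients \<X>" "(F', H') \<in> quotients \<X>"
  shows "(F * F', H * H') \<in> quotients \<X>"
proof -
  obtain P where P: "P \<in> \<X>" using quotients_nonempty[OF assms(1)] by blast
  from assms(1) P obtain d where d: "form d F" "form d H" "at_branch P H \<noteq> 0" by (rule quotientsD)
  from assms(2) P obtain e where e: "form e F'" "form e H'" "at_branch P H' \<noteq> 0" by (rule quotientsD)
  show ?thesis
    using form_mult[OF d(1) e(1)] form_mult[OF d(2) e(2)] d(3) e(3) P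
    by (intro quotientsI[of "d + e" _ _ P]) (simp_all add: fpsc.ev_homs)
qed

lemma quotients_cross:
  assumes "(F, H) \<in> quotients \<X>" "(F', H') \<in> quotients \<X>"
  shows "(F * H' - F' * H, H * H') \<in> quotients \<X>"
proof -
  obtain P where P: "P \<in> \<X>" using quotients_nonempty[OF assms(1)] by blast
  from assms(1) P obtain d where d: "form d F" "form d H" "at_branch P H \<noteq> 0" by (rule quotientsD)
  from assms(2) P obtain e where e: "form e F'" "form e H'" "at_branch P H' \<noteq> 0" by (rule quotientsD)
  show ?thesis
    using form_mult[OF d(1) e(2)] form_mult[OF e(1) d(2)] form_mult[OF d(2) e(2)] d(3) e(3) P
    by (intro quotientsI[of "d + e" _ _ P] form_diff) (simp_all add: fpsc.ev_homs add.commute)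
qed

lemma quot_germ_mult:
  "quot_germ P (F * F') (H * H') = quot_germ P F H * quot_germ P F' H'"
  by (simp add: quot_germ_def fpsc.ev_homs fls_times_fps_to_fls)

lemma ratfun_mult:
  assumes "(F, H) \<in> quotients \<X>" "(F', H') \<in> quotients \<X>"
  shows "ratfun \<X> F H \<otimes>\<^bsub>KX\<^esub> ratfun \<X> F' H' = ratfun \<X> (F * F') (H * H')"
proof -
  obtain P where P: "P \<in> \<X>" using quotients_nonempty[OF assms(1)] by blast
  have eq: "ratfun \<X> (A * A') (B * B') = ratfun \<X> (F * F') (H * H')"
    if "(A, B) \<in> ratfun \<X> F H" "(A', B') \<in> ratfun \<X> F' H'" for A A' B B'
    using that mem_ratfun_iff[OF P assms(1)] mem_ratfun_iff[OF P assms(2)] assms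
    by (subst ratfun_eq_iff[OF P]) (auto simp: quot_germ_mult intro: quotients_mult)
  have "(F, H) \<in> ratfun \<X> F H" "(F', H') \<in> ratfun \<X> F' H'"
    using mem_ratfun_iff[OF P assms(1), of F H] mem_ratfun_iff[OF P assms(2), of F' H'] assms by auto
  then have "(\<Union>(A, B)\<in>ratfun \<X> F H. \<Union>(A', B')\<in>ratfun \<X> F' H'. ratfun \<X> (A * A') (B * B'))
      = ratfun \<X> (F * F') (H * H')"
    by (intro SUP_eq_const) (auto intro!: SUP_eq_const eq)
  then show ?thesis
    by (simp add: function_field_def)
qed

lemma
  assumes "f \<in> carrier KX" "g \<in> carrier KX"
  shows mult_in_carrier: "f \<otimes>\<^bsub>KX\<^esub> g \<in> carrier KX"
    and germ_mult: "P \<in> \<X> \<Longrightarrow> germ P (f \<otimes>\<^bsub>KX\<^esub> g) = germ P f * germ P g"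
proof -
  obtain F H where f: "(F, H) \<in> quotients \<X>" "f = ratfun \<X> F H" using assms(1) by (rule carrierE)
  obtain F' H' where g: "(F', H') \<in> quotients \<X>" "g = ratfun \<X> F' H'" using assms(2) by (rule carrierE)
  show "f \<otimes>\<^bsub>KX\<^esub> g \<in> carrier KX"
    using f g by (simp add: ratfun_mult ratfun_in_carrier quotients_mult)
  show "germ P (f \<otimes>\<^bsub>KX\<^esub> g) = germ P f * germ P g" if "P \<in> \<X>"
    using f g that by (simp add: ratfun_mult germ_ratfun quotients_mult quot_germ_mult)
qed

lemma zero_one_quotients:
  assumes "P \<in> \<X>"
  shows "(0, 1) \<in> quotients \<X>" "(1, 1) \<in> quotients \<X>"
  using assms by (auto intro!: quotientsI[of 0 _ _ P])

lemma zero_one_carrier: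
  assumes "P \<in> \<X>"
  shows "\<zero>\<^bsub>KX\<^esub> \<in> carrier KX" "\<one>\<^bsub>KX\<^esub> \<in> carrier KX"
  using zero_one_quotients[OF assms] ratfun_in_carrier[of 0 1] ratfun_in_carrier[of 1 1]
  by (simp_all add: function_field_def)

lemma germ_zero_one:
  assumes "P \<in> \<X>"
  shows "germ P \<zero>\<^bsub>KX\<^esub> = 0" "germ P \<one>\<^bsub>KX\<^esub> = 1"
  using zero_one_quotients[OF assms] assms
  by (simp_all add: function_field_def germ_ratfun quot_germ_def)

lemma germ_eq_0_iff:
  assumes "P \<in> \<X>" "f \<in> carrier KX"
  shows "germ P f = 0 \<longleftrightarrow> f = \<zero>\<^bsub>KX\<^esub>"
  using germ_inj[OF assms zero_one_carrier(1)[OF assms(1)]] germ_zero_one(1)[OF assms(1)] by auto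

lemma quot_inverse:
  assumes "(F, H) \<in> quotients \<X>" "P \<in> \<X>" "quot_germ P F H \<noteq> 0"
  shows "(H, F) \<in> quotients \<X>" "quot_germ P H F = inverse (quot_germ P F H)"
proof -
  from assms(1,2) obtain d where d: "form d F" "form d H" "at_branch P H \<noteq> 0" by (rule quotientsD)
  moreover have "at_branch P F \<noteq> 0" using assms(3) by (auto simp: quot_germ_def)
  ultimately show "(H, F) \<in> quotients \<X>" using assms(2) by (intro quotientsI[of d _ _ P])
qed (simp add: quot_germ_def)

lemma inv_in_carrier:
  assumes "P \<in> \<X>" "f \<in> carrier KX" "f \<noteq> \<zero>\<^bsub>KX\<^esub>"
  shows "inv\<^bsub>KX\<^esub> f \<in> carrier KX" "germ P (inv\<^bsub>KX\<^esub> f) = inverse (germ P f)"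
proof -
  obtain F H where f: "(F, H) \<in> quotients \<X>" "f = ratfun \<X> F H" using assms(2) by (rule carrierE)
  have nz: "quot_germ P F H \<noteq> 0"
    using assms f germ_eq_0_iff[OF assms(1,2)] germ_ratfun by simp
  note HF = quot_inverse[OF f(1) assms(1) nz]
  let ?g = "ratfun \<X> H F"
  have g: "?g \<in> carrier KX" "germ P ?g = inverse (germ P f)"
    using HF f assms(1) by (simp_all add: ratfun_in_carrier germ_ratfun)
  have nz': "germ P f \<noteq> 0" using assms germ_eq_0_iff by blast
  have 1: "f \<otimes>\<^bsub>KX\<^esub> ?g = \<one>\<^bsub>KX\<^esub>" "?g \<otimes>\<^bsub>KX\<^esub> f = \<one>\<^bsub>KX\<^esub>"
    by (rule germ_inj[OF assms(1)]; use assms g nz' in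
      \<open>simp add: germ_mult mult_in_carrier zero_one_carrier germ_zero_one\<close>)+
  have "inv\<^bsub>KX\<^esub> f = ?g"
    unfolding m_inv_def
  proof (rule the_equality)
    fix y assume y: "y \<in> carrier KX \<and> f \<otimes>\<^bsub>KX\<^esub> y = \<one>\<^bsub>KX\<^esub> \<and> y \<otimes>\<^bsub>KX\<^esub> f = \<one>\<^bsub>KX\<^esub>"
    then have "germ P f * germ P y = 1"
      using germ_mult[of f y P] germ_zero_one(2)[of P] assms by simp
    then have "germ P y = germ P ?g" using g(2) inverse_unique by metis
    then show "y = ?g" using germ_inj[OF assms(1)] y g by blast
  qed (use g 1 in simp)
  then show "inv\<^bsub>KX\<^esub> f \<in> carrier KX" "germ P (inv\<^bsub>KX\<^esub> f) = inverse (germ P f)"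
    using g by simp_all
qed

lemma nat_power_germ:
  assumes "P \<in> \<X>" "f \<in> carrier KX"
  shows "f [^]\<^bsub>KX\<^esub> (k::nat) \<in> carrier KX \<and> germ P (f [^]\<^bsub>KX\<^esub> k) = germ P f ^ k"
proof (induction k)
  case 0
  then show ?case using assms by (simp add: nat_pow_def zero_one_carrier germ_zero_one)
next
  case (Suc k)
  have "f [^]\<^bsub>KX\<^esub> Suc k = f [^]\<^bsub>KX\<^esub> k \<otimes>\<^bsub>KX\<^esub> f" by (simp add: nat_pow_def)
  then show ?case using Suc assms by (simp add: germ_mult mult_in_carrier mult.commute)
qed

lemma int_power_germ:
  assumes "P \<in> \<X>" "f \<in> carrier KX" "f \<noteq> \<zero>\<^bsub>KX\<^esub>"
  shows "f [^]\<^bsub>KX\<^esub> (k::int) \<in> carrier KX" "germ P (f [^]\<^bsub>KX\<^esub> k) = germ P f powi k"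
proof -
  have nz: "germ P f \<noteq> 0" using assms germ_eq_0_iff by blast
  have "f [^]\<^bsub>KX\<^esub> k \<in> carrier KX \<and> germ P (f [^]\<^bsub>KX\<^esub> k) = germ P f powi k"
  proof (cases "k < 0")
    case True
    have p: "f [^]\<^bsub>KX\<^esub> nat (- k) \<in> carrier KX" "germ P (f [^]\<^bsub>KX\<^esub> nat (- k)) = germ P f ^ nat (- k)"
      using nat_power_germ[OF assms(1,2)] by auto
    then have "f [^]\<^bsub>KX\<^esub> nat (- k) \<noteq> \<zero>\<^bsub>KX\<^esub>"
      using germ_eq_0_iff[OF assms(1) p(1)] nz by simp
    moreover have "f [^]\<^bsub>KX\<^esub> k = inv\<^bsub>KX\<^esub> (f [^]\<^bsub>KX\<^esub> nat (- k))"
      using True by (simp only: int_pow_def2 if_True)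
    moreover have "germ P f powi k = inverse (germ P f ^ nat (- k))"
      using True by (auto simp: power_int_def power_inverse)
    ultimately show ?thesis
      using inv_in_carrier[OF assms(1) p(1)] p(2) by simp
  next
    case False
    then have "f [^]\<^bsub>KX\<^esub> k = f [^]\<^bsub>KX\<^esub> nat k"
      using int_pow_int[of KX f "nat k"] by simp
    moreover have "germ P f powi k = germ P f ^ nat k"
      using False by (simp add: power_int_def)
    ultimately show ?thesis
      using nat_power_germ[OF assms(1,2), of "nat k"] by simp
  qed
  then show "f [^]\<^bsub>KX\<^esub> k \<in> carrier KX" "germ P (f [^]\<^bsub>KX\<^esub> k) = germ P f powi k" by auto
qed

text \<open>
  A denominator that does not vanish at \<open>P\<close> becomes invertible in \<open>K[[t]]\<close>, so that the germ of a
  regular function is a power series from the algebraic local ring, with the value of the function as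
  constant term.
\<close>

lemma regular_germ:
  assumes P: "P \<in> \<X>" and f: "f \<in> carrier KX" and reg: "regular_at P f"
  obtains g where "g \<in> branch_ring (br P)" "germ P f = fps_to_fls g" "value_at P f = fps_nth g 0"
proof -
  obtain A B where AB: "(A, B) \<in> quotients \<X>" "f = ratfun \<X> A B" using f by (rule carrierE)
  obtain F H where FH: "(F, H) \<in> f" "\<not> vanishes_at H P" using reg by (auto simp: regular_at_def)
  then have Q: "(F, H) \<in> quotients \<X>" "germ P f = quot_germ P F H"
    using mem_ratfun_iff[OF P AB(1)] germ_ratfun[OF P AB(1)] AB(2) by auto
  from Q(1) P obtain d where d: "form d F" "form d H" "at_branch P H \<noteq> 0" by (rule quotientsD)
  have H0: "fps_nth (at_branch P H) 0 \<noteq> 0" using vanishes_at_branch[OF P d(2)] FH(2) by simp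
  define g where "g = at_branch P F * inverse (at_branch P H)"
  have germ: "germ P f = fps_to_fls g"
    unfolding Q(2) quot_germ_def g_def by (rule fps_to_fls_divide[OF H0])
  have val: "eval4 F' v / eval4 H' v = fps_nth g 0"
    if F'H': "(F', H') \<in> f" and v: "v \<in> P" "eval4 H' v \<noteq> 0" for F' H' v
  proof -
    have Q': "(F', H') \<in> quotients \<X>" "quot_germ P F' H' = fps_to_fls g"
      using mem_ratfun_iff[OF P AB(1)] AB(2) F'H' germ germ_ratfun[OF P AB(1)] by auto
    from Q'(1) P obtain e where e: "form e F'" "form e H'" "at_branch P H' \<noteq> 0" by (rule quotientsD)
    let ?p = "\<chi> i. fps_nth (br P i) 0"
    have "v \<in> proj_point ?p" using v(1) point_eq[OF P] by metis
    then obtain a where a: "a \<noteq> 0" "v = a *s ?p" by (auto simp: proj_point_def)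
    have hom: "eval4 G v = a ^ e * fps_nth (at_branch P G) 0" if "form e G" for G
      using ev_homogeneous[OF scalar_hom_id that, of a "\<lambda>i. ?p $ i"]
      by (simp add: a(2) eval4_eq_ev fpsc.hom_ev[OF scalar_hom_fps_nth_0])
    have "fps_to_fls (at_branch P F') = fps_to_fls (g * at_branch P H')"
      using Q'(2) e(3) by (simp add: quot_germ_def divide_eq_eq fls_times_fps_to_fls)
    then have "fps_nth (at_branch P F') 0 = fps_nth g 0 * fps_nth (at_branch P H') 0"
      by simp
    then show ?thesis
      using v(2) a(1) unfolding hom[OF e(1)] hom[OF e(2)] by (simp add: field_simps)
  qed
  have "value_at P f = fps_nth g 0"
    unfolding value_at_def
  proof (rule the_equality)
    obtain v where v: "v \<in> P" "eval4 H v \<noteq> 0" using FH(2) by (auto simp: vanishes_at_def)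
    then show "\<exists>(F, H)\<in>f. \<exists>v\<in>P. eval4 H v \<noteq> 0 \<and> fps_nth g 0 = eval4 F v / eval4 H v"
      using FH(1) val[OF FH(1) v] by force
  qed (use val in auto)
  moreover have "g \<in> branch_ring (br P)"
    unfolding g_def using branch_ringI[OF d(1,2) H0] .
  ultimately show thesis using that germ by blast
qed

lemma branch_ring_germ:
  assumes P: "P \<in> \<X>" and g: "g \<in> branch_ring (br P)"
  obtains A B where "(A, B) \<in> quotients \<X>" "germ P (ratfun \<X> A B) = fps_to_fls g" "\<not> vanishes_at B P"
proof -
  from g obtain A B d where 1: "form d A" "form d B" "fps_nth (at_branch P B) 0 \<noteq> 0"
    "g = at_branch P A * inverse (at_branch P B)" by (rule branch_ringE)
  then have Q: "(A, B) \<in> quotients \<X>" using P by (intro quotientsI[of d _ _ P]) auto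
  show thesis
    using that[OF Q] germ_ratfun[OF P Q] vanishes_at_branch[OF P 1(2)] 1(3)
    by (simp add: quot_germ_def fps_to_fls_divide 1(4))
qed

lemma regular_if_germ_in_branch_ring:
  assumes P: "P \<in> \<X>" and f: "f \<in> carrier KX" and g: "g \<in> branch_ring (br P)" "germ P f = fps_to_fls g"
  shows "regular_at P f"
proof -
  obtain A B where AB: "(A, B) \<in> quotients \<X>" "germ P (ratfun \<X> A B) = fps_to_fls g" "\<not> vanishes_at B P"
    by (rule branch_ring_germ[OF P g(1)])
  then have "f = ratfun \<X> A B"
    using g(2) germ_inj[OF P f ratfun_in_carrier[OF AB(1)]] by simp
  then have "(A, B) \<in> f" using mem_ratfun_iff[OF P AB(1)] AB(1) by auto
  then show ?thesis using AB(3) unfolding regular_at_def by blast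
qed

text \<open>
  Numerator and denominator are powers of \<open>t\<close> times units of the algebraic local ring, and when the
  exponents differ by \<open>k \<ge> 0\<close> the quotient lies in that ring again.
\<close>

lemma germ_without_pole:
  assumes P: "P \<in> \<X>" and f: "f \<in> carrier KX" "f \<noteq> \<zero>\<^bsub>KX\<^esub>" and sub: "fls_subdegree (germ P f) \<ge> 0"
  shows "\<exists>g\<in>branch_ring (br P). germ P f = fps_to_fls g"
proof -
  obtain t where t: "t \<in> branch_ring (br P)" "subdegree t = 1"
      "\<And>f. f \<in> branch_ring (br P) \<Longrightarrow> fps_nth f 0 = 0 \<Longrightarrow> \<exists>h\<in>branch_ring (br P). f = t * h"
    and unif: "branch_uniformizer (br P) t"
    using uniformizer[OF P] unfolding branch_uniformizer_def by blast
  obtain j where j: "br P j = 1" using unit_coordinate[OF P] by blast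
  obtain F H where FH: "(F, H) \<in> quotients \<X>" "f = ratfun \<X> F H" using f(1) by (rule carrierE)
  from FH(1) P obtain d where d: "form d F" "form d H" "at_branch P H \<noteq> 0" by (rule quotientsD)
  have g: "germ P f = fps_to_fls (at_branch P F) / fps_to_fls (at_branch P H)"
    using FH germ_ratfun[OF P] by (simp add: quot_germ_def)
  then have nz: "at_branch P F \<noteq> 0" using germ_eq_0_iff[OF P f(1)] f(2) by auto
  obtain u where u: "u \<in> branch_ring (br P)" "at_branch P F = t ^ subdegree (at_branch P F) * u"
    using branch_ring_factor[OF unif branch_ring_form[of "br P", OF j d(1)] nz] by blast
  obtain w where w: "w \<in> branch_ring (br P)" "at_branch P H = t ^ subdegree (at_branch P H) * w"
    "fps_nth w 0 \<noteq> 0"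
    using branch_ring_factor[OF unif branch_ring_form[of "br P", OF j d(2)] d(3)] by blast
  have "fls_subdegree (germ P f) = int (subdegree (at_branch P F)) - int (subdegree (at_branch P H))"
    unfolding g using nz d(3) by (simp add: fls_divide_subdegree fls_subdegree_fls_to_fps)
  then obtain k where k: "subdegree (at_branch P F) = subdegree (at_branch P H) + k"
    using sub by (metis diff_ge_0_iff_ge nat_int_comparison(3) le_Suc_ex)
  define v where "v = t ^ k * u * inverse w"
  have "w * inverse w = 1" using w(3) by (simp add: inverse_mult_eq_1')
  then have "v * at_branch P H = at_branch P F"
    unfolding v_def by (subst w(2), subst u(2), unfold k power_add) (simp add: mult_ac)
  then have "fps_to_fls v * fps_to_fls (at_branch P H) = fps_to_fls (at_branch P F)"
    by (metis fls_times_fps_to_fls)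
  then have "germ P f = fps_to_fls v" using d(3) by (simp add: g divide_eq_eq)
  moreover have "v \<in> branch_ring (br P)"
    unfolding v_def by (intro branch_ring_mult branch_ring_power branch_ring_inverse t u w)
  ultimately show ?thesis by blast
qed

lemma regular_iff:
  assumes P: "P \<in> \<X>" and f: "f \<in> carrier KX"
  shows "regular_at P f \<longleftrightarrow> fls_subdegree (germ P f) \<ge> 0"
proof
  assume "regular_at P f"
  then show "fls_subdegree (germ P f) \<ge> 0"
    using regular_germ[OF P f] fls_subdegree_fls_to_fps_gt0 by metis
next
  assume sub: "fls_subdegree (germ P f) \<ge> 0"
  show "regular_at P f"
  proof (cases "f = \<zero>\<^bsub>KX\<^esub>")
    case True
    moreover have "0 \<in> branch_ring (br P)" using branch_ring_const[of 0] by simp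
    ultimately show ?thesis
      using germ_zero_one(1)[OF P] by (intro regular_if_germ_in_branch_ring[OF P f, of 0]) simp_all
  qed (use germ_without_pole[OF P f _ sub] regular_if_germ_in_branch_ring[OF P f] in blast)
qed

lemma value_at_germ:
  assumes P: "P \<in> \<X>" and f: "f \<in> carrier KX" and "fls_subdegree (germ P f) \<ge> 0"
  shows "value_at P f = fls_nth (germ P f) 0"
  using regular_germ[OF P f] regular_iff[OF P f] assms(3) by (metis fps_to_fls_nth nat_zero_as_int
      less_irrefl nat_int of_nat_0)

lemma maximal_ideal_iff:
  assumes P: "P \<in> \<X>" and f: "f \<in> carrier KX"
  shows "f \<in> maximal_ideal_at \<X> P \<longleftrightarrow> f = \<zero>\<^bsub>KX\<^esub> \<or> fls_subdegree (germ P f) \<ge> 1"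
proof (cases "fls_subdegree (germ P f) \<ge> 0 \<and> f \<noteq> \<zero>\<^bsub>KX\<^esub>")
  case True
  then have "germ P f \<noteq> 0" using germ_eq_0_iff[OF P f] by simp
  then have "fls_nth (germ P f) (fls_subdegree (germ P f)) \<noteq> 0" by simp
  then have "fls_nth (germ P f) 0 = 0 \<longleftrightarrow> fls_subdegree (germ P f) \<ge> 1"
    using True fls_eq0_below_subdegree[of 0 "germ P f"]
    by (metis int_one_le_iff_zero_less linorder_not_le order_antisym_conv)
  then show ?thesis
    using True value_at_germ[OF P f] regular_iff[OF P f] f
    by (simp add: maximal_ideal_at_def local_ring_def)
next
  case False
  then show ?thesis
    using value_at_germ[OF P f] regular_iff[OF P f] f germ_zero_one(1)[OF P]
    by (auto simp: maximal_ideal_at_def local_ring_def)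
qed

lemma local_parameter_exists:
  assumes P: "P \<in> \<X>"
  shows "\<exists>t. local_parameter \<X> P t \<and> fls_subdegree (germ P t) = 1"
proof -
  obtain t where t: "t \<in> branch_ring (br P)" "subdegree t = 1"
      "\<And>f. f \<in> branch_ring (br P) \<Longrightarrow> fps_nth f 0 = 0 \<Longrightarrow> \<exists>h\<in>branch_ring (br P). f = t * h"
    and unif: "branch_uniformizer (br P) t"
    using uniformizer[OF P] unfolding branch_uniformizer_def by blast
  have ex: "\<exists>f\<in>carrier KX. germ P f = fps_to_fls g" if "g \<in> branch_ring (br P)" for g
    using branch_ring_germ[OF P that] ratfun_in_carrier by metis
  obtain T where T: "T \<in> carrier KX" "germ P T = fps_to_fls t" using ex[OF t(1)] by blast
  have sub: "fls_subdegree (germ P T) = 1" by (simp add: T(2) fls_subdegree_fls_to_fps t(2))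
  have "local_parameter \<X> P T"
    unfolding local_parameter_def
  proof (intro conjI ballI)
    show "T \<in> maximal_ideal_at \<X> P" using sub maximal_ideal_iff[OF P T(1)] by simp
    fix g assume g: "g \<in> maximal_ideal_at \<X> P"
    then have gc: "g \<in> carrier KX" and "regular_at P g" "value_at P g = 0"
      by (auto simp: maximal_ideal_at_def local_ring_def)
    then obtain g' where g': "g' \<in> branch_ring (br P)" "germ P g = fps_to_fls g'" "fps_nth g' 0 = 0"
      by (metis regular_germ[OF P])
    then obtain h' where h': "h' \<in> branch_ring (br P)" "g' = t * h'" using t(3) by blast
    obtain h where h: "h \<in> carrier KX" "germ P h = fps_to_fls h'" using ex[OF h'(1)] by blast
    have "g = T \<otimes>\<^bsub>KX\<^esub> h"
      using g'(2) h h'(2) T P gc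
      by (intro germ_inj[OF P]) (simp_all add: germ_mult mult_in_carrier fls_times_fps_to_fls)
    moreover have "h \<in> local_ring \<X> P"
      using h regular_if_germ_in_branch_ring[OF P h(1) h'(1) h(2)] by (simp add: local_ring_def)
    ultimately show "\<exists>h\<in>local_ring \<X> P. g = T \<otimes>\<^bsub>KX\<^esub> h" by blast
  qed
  then show ?thesis using sub by blast
qed

lemma local_parameter_subdegree:
  assumes P: "P \<in> \<X>" and t: "local_parameter \<X> P t"
  shows "t \<in> carrier KX" "t \<noteq> \<zero>\<^bsub>KX\<^esub>" "fls_subdegree (germ P t) = 1"
proof -
  obtain s where s: "local_parameter \<X> P s" "fls_subdegree (germ P s) = 1"
    using local_parameter_exists[OF P] by blast
  show tc: "t \<in> carrier KX"
    using t by (auto simp: local_parameter_def maximal_ideal_at_def local_ring_def)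
  have "s \<in> maximal_ideal_at \<X> P" using s(1) by (simp add: local_parameter_def)
  then obtain h where h: "h \<in> local_ring \<X> P" "s = t \<otimes>\<^bsub>KX\<^esub> h"
    using t by (auto simp: local_parameter_def)
  then have hc: "h \<in> carrier KX" "fls_subdegree (germ P h) \<ge> 0"
    using regular_iff[OF P] by (auto simp: local_ring_def)
  have g: "germ P s = germ P t * germ P h" using h(2) tc hc P by (simp add: germ_mult)
  have "germ P s \<noteq> 0" using s(2) by auto
  then have nz: "germ P t \<noteq> 0" "germ P h \<noteq> 0" using g by auto
  then show tz: "t \<noteq> \<zero>\<^bsub>KX\<^esub>" using germ_zero_one(1)[OF P] by auto
  have "fls_subdegree (germ P t) \<ge> 1"
    using t maximal_ideal_iff[OF P tc] tz by (auto simp: local_parameter_def)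
  moreover have "fls_subdegree (germ P s) = fls_subdegree (germ P t) + fls_subdegree (germ P h)"
    using g nz by simp
  ultimately show "fls_subdegree (germ P t) = 1" using s(2) hc(2) by simp
qed

text \<open>
  A local parameter divides some germ of order one and vanishes at \<open>P\<close>, hence has order exactly one;
  comparing orders in \<open>f = t\<^sup>n u\<close> then determines \<open>n\<close>.
\<close>

theorem ord_at_eq_subdegree:
  assumes P: "P \<in> \<X>" and f: "f \<in> carrier KX" "f \<noteq> \<zero>\<^bsub>KX\<^esub>"
  shows "ord_at \<X> P f = fls_subdegree (germ P f)"
  unfolding ord_at_def
proof (rule the_equality)
  have nz: "germ P f \<noteq> 0" using germ_eq_0_iff[OF P f(1)] f(2) by simp
  obtain t where t: "local_parameter \<X> P t" using local_parameter_exists[OF P] by blast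
  note tp = local_parameter_subdegree[OF P t]
  have tnz: "germ P t \<noteq> 0" using germ_eq_0_iff[OF P tp(1)] tp(2) by simp
  let ?n = "fls_subdegree (germ P f)"
  define u where "u = f \<otimes>\<^bsub>KX\<^esub> (t [^]\<^bsub>KX\<^esub> (- ?n))"
  have uc: "u \<in> carrier KX"
    unfolding u_def using f(1) int_power_germ(1)[OF P tp(1,2)] by (rule mult_in_carrier)
  have ug: "germ P u = germ P f * germ P t powi (- ?n)"
    unfolding u_def using germ_mult[OF f(1) int_power_germ(1)[OF P tp(1,2)] P]
      int_power_germ(2)[OF P tp(1,2)] by simp
  have us: "fls_subdegree (germ P u) = 0" using ug nz tnz tp(3) by simp
  have unz: "germ P u \<noteq> 0" using ug nz tnz by simp
  have "u \<noteq> \<zero>\<^bsub>KX\<^esub>" using unz germ_zero_one(1)[OF P] by auto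
  then have "u \<notin> maximal_ideal_at \<X> P" using maximal_ideal_iff[OF P uc] us by simp
  moreover have ul: "u \<in> local_ring \<X> P" using uc regular_iff[OF P uc] us by (simp add: local_ring_def)
  ultimately have "value_at P u \<noteq> 0" by (simp add: maximal_ideal_at_def)
  moreover have "f = (t [^]\<^bsub>KX\<^esub> ?n) \<otimes>\<^bsub>KX\<^esub> u"
    using f(1) uc int_power_germ[OF P tp(1,2), of ?n] P ug tnz
    by (intro germ_inj[OF P]) (simp_all add: mult_in_carrier germ_mult power_int_minus)
  ultimately show "\<exists>t u. local_parameter \<X> P t \<and> u \<in> local_ring \<X> P \<and> value_at P u \<noteq> 0 \<and>
      f = (t [^]\<^bsub>KX\<^esub> ?n) \<otimes>\<^bsub>KX\<^esub> u"
    using t ul by blast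
next
  fix n :: int assume "\<exists>t u. local_parameter \<X> P t \<and> u \<in> local_ring \<X> P \<and> value_at P u \<noteq> 0 \<and>
      f = (t [^]\<^bsub>KX\<^esub> n) \<otimes>\<^bsub>KX\<^esub> u"
  then obtain t u where t: "local_parameter \<X> P t" and u: "u \<in> local_ring \<X> P" "value_at P u \<noteq> 0"
    and eq: "f = (t [^]\<^bsub>KX\<^esub> n) \<otimes>\<^bsub>KX\<^esub> u" by blast
  note tp = local_parameter_subdegree[OF P t]
  have tnz: "germ P t \<noteq> 0" using germ_eq_0_iff[OF P tp(1)] tp(2) by simp
  have uc: "u \<in> carrier KX" "fls_subdegree (germ P u) \<ge> 0"
    using u(1) regular_iff[OF P] by (auto simp: local_ring_def)
  have "u \<notin> maximal_ideal_at \<X> P" using u by (simp add: maximal_ideal_at_def)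
  then have us: "u \<noteq> \<zero>\<^bsub>KX\<^esub>" "fls_subdegree (germ P u) = 0"
    using maximal_ideal_iff[OF P uc(1)] uc(2) by auto
  then have "germ P u \<noteq> 0" using germ_eq_0_iff[OF P uc(1)] by simp
  then show "n = fls_subdegree (germ P f)"
    unfolding eq using germ_mult[OF int_power_germ(1)[OF P tp(1,2)] uc(1) P]
      int_power_germ(2)[OF P tp(1,2)] tnz tp(3) us(2) by simp
qed

end

section \<open>Principal divisors and the designed distance\<close>

text \<open>
  Bezout's theorem for the curve and a surface of degree \<open>d\<close>, with \<open>e\<close> the degree of the curve.
  Intersection multiplicities are orders along the branches.
\<close>

locale branched_curve_of_degree = branched_curve \<X> br
  for \<X> :: "'a::field point3 set" and br +
  fixes e :: nat
  assumes bezout: "P \<in> \<X> \<Longrightarrow> form d F \<Longrightarrow> ev fps_const F (br P) \<noteq> 0 \<Longrightarrow>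
    finite {Q\<in>\<X>. subdegree (ev fps_const F (br Q)) \<noteq> 0} \<and>
    (\<Sum>Q\<in>{Q\<in>\<X>. subdegree (ev fps_const F (br Q)) \<noteq> 0}. subdegree (ev fps_const F (br Q))) = d * e"
begin

lemma bezout_superset:
  assumes "P \<in> \<X>" "form d F" "at_branch P F \<noteq> 0" "finite S" "S \<subseteq> \<X>"
    "{Q\<in>\<X>. subdegree (at_branch Q F) \<noteq> 0} \<subseteq> S"
  shows "(\<Sum>Q\<in>S. int (subdegree (at_branch Q F))) = int (d * e)"
proof -
  have "(\<Sum>Q\<in>S. subdegree (at_branch Q F)) =
      (\<Sum>Q\<in>{Q\<in>\<X>. subdegree (at_branch Q F) \<noteq> 0}. subdegree (at_branch Q F))"
    by (rule sum.mono_neutral_right) (use assms in auto)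
  then show ?thesis
    using bezout[OF assms(1-3)] by (simp flip: of_nat_sum)
qed

text \<open>
  Numerator and denominator have the same degree, hence the same number of zeros on the curve. The
  sum is stated for all large finite sets of points to avoid fixing the support of the divisor.
\<close>

lemma principal_divisor:
  assumes "P \<in> \<X>" "f \<in> carrier KX" "f \<noteq> \<zero>\<^bsub>KX\<^esub>"
  shows "\<exists>S. finite S \<and> S \<subseteq> \<X> \<and> (\<forall>T. finite T \<longrightarrow> S \<subseteq> T \<longrightarrow> T \<subseteq> \<X> \<longrightarrow>
      (\<Sum>Q\<in>T. fls_subdegree (germ Q f)) = 0)"
proof -
  obtain F H where f: "(F, H) \<in> quotients \<X>" "f = ratfun \<X> F H" using assms(2) by (rule carrierE)
  from f(1) assms(1) obtain d where d: "form d F" "form d H" "at_branch P H \<noteq> 0" by (rule quotientsD)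
  have nz: "at_branch Q F \<noteq> 0" "at_branch Q H \<noteq> 0"
    and sub: "fls_subdegree (germ Q f) = int (subdegree (at_branch Q F)) - int (subdegree (at_branch Q H))"
    if "Q \<in> \<X>" for Q
  proof -
    have g: "germ Q f = fps_to_fls (at_branch Q F) / fps_to_fls (at_branch Q H)"
      using f germ_ratfun[OF that] by (simp add: quot_germ_def)
    have "germ Q f \<noteq> 0" using germ_eq_0_iff[OF that assms(2)] assms(3) by simp
    then show "at_branch Q F \<noteq> 0" "at_branch Q H \<noteq> 0" unfolding g by auto
    then show "fls_subdegree (germ Q f) = int (subdegree (at_branch Q F)) - int (subdegree (at_branch Q H))"
      unfolding g by (simp add: fls_divide_subdegree fls_subdegree_fls_to_fps)
  qed
  define S where "S = {Q\<in>\<X>. subdegree (at_branch Q F) \<noteq> 0} \<union> {Q\<in>\<X>. subdegree (at_branch Q H) \<noteq> 0}"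
  have S: "finite S" "S \<subseteq> \<X>"
    using bezout[OF assms(1) d(1) nz(1)[OF assms(1)]] bezout[OF assms(1) d(2) nz(2)[OF assms(1)]]
    by (auto simp: S_def)
  have "(\<Sum>Q\<in>T. fls_subdegree (germ Q f)) = 0" if T: "finite T" "S \<subseteq> T" "T \<subseteq> \<X>" for T
  proof -
    have "(\<Sum>Q\<in>T. fls_subdegree (germ Q f)) =
        (\<Sum>Q\<in>T. int (subdegree (at_branch Q F))) - (\<Sum>Q\<in>T. int (subdegree (at_branch Q H)))"
      unfolding sum_subtractf[symmetric] by (rule sum.cong) (use sub T(3) in auto)
    also have "\<dots> = int (d * e) - int (d * e)"
      using bezout_superset[OF assms(1) d(1) nz(1)[OF assms(1)] T(1,3)]
        bezout_superset[OF assms(1) d(2) nz(2)[OF assms(1)] T(1,3)] T(2) S_def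
      by simp
    finally show ?thesis by simp
  qed
  then show ?thesis using S by blast
qed

text \<open>
  On \<open>Z\<close> the divisor \<open>(f) + G\<close> has positive coefficients, elsewhere non-negative ones, and its
  degree is that of \<open>G\<close>.
\<close>

lemma card_zeros_le_degree:
  assumes P: "P \<in> \<X>" and f: "f \<in> carrier KX" "f \<noteq> \<zero>\<^bsub>KX\<^esub>"
    and G: "Poly_Mapping.keys G \<subseteq> \<X>"
      "\<And>Q. Q \<in> \<X> \<Longrightarrow> fls_subdegree (germ Q f) + Poly_Mapping.lookup G Q \<ge> 0"
    and Z: "finite Z" "Z \<subseteq> \<X>"
      "\<And>Q. Q \<in> Z \<Longrightarrow> Poly_Mapping.lookup G Q = 0 \<and> fls_subdegree (germ Q f) \<ge> 1"
  shows "int (card Z) \<le> div_degree G"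
proof -
  from principal_divisor[OF P f] obtain S where S: "finite S" "S \<subseteq> \<X>" "\<And>T. finite T \<Longrightarrow> S \<subseteq> T
      \<Longrightarrow> T \<subseteq> \<X> \<Longrightarrow> (\<Sum>Q\<in>T. fls_subdegree (germ Q f)) = 0" by blast
  let ?T = "S \<union> Poly_Mapping.keys G \<union> Z"
  have T: "finite ?T" "?T \<subseteq> \<X>" using S(1,2) G(1) Z(1,2) by auto
  have "int (card Z) = (\<Sum>Q\<in>Z. 1)" by simp
  also have "\<dots> \<le> (\<Sum>Q\<in>Z. fls_subdegree (germ Q f) + Poly_Mapping.lookup G Q)"
    by (rule sum_mono) (use Z(3) in force)
  also have "\<dots> \<le> (\<Sum>Q\<in>?T. fls_subdegree (germ Q f) + Poly_Mapping.lookup G Q)"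
    by (rule sum_mono2) (use T G(2) in auto)
  also have "\<dots> = (\<Sum>Q\<in>?T. Poly_Mapping.lookup G Q)"
    using S(3)[of ?T] T by (simp add: sum.distrib Un_assoc)
  also have "\<dots> = div_degree G"
    unfolding div_degree_def by (rule sum.mono_neutral_right) (use T in \<open>auto simp: in_keys_iff\<close>)
  finally show ?thesis .
qed

end

text \<open>
  Two distinct words come from functions whose difference is a non-zero function with poles bounded
  by \<open>G\<close>; it vanishes at every point where the words agree.
\<close>

theorem functional_code_distance_ge:
  fixes \<X> :: "'k::field alg_closure point3 set"
  assumes "branched_curve_of_degree \<X> br e"
    and G: "Poly_Mapping.keys G \<subseteq> \<X>"
    and Ps: "distinct Ps" "set Ps \<subseteq> \<X> - Poly_Mapping.keys G"
    and u: "u \<in> functional_code \<X> Ps G" and w: "w \<in> functional_code \<X> Ps G" and "u \<noteq> w"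
  shows "int (hamming_distance u w) \<ge> int (length Ps) - div_degree G"
proof -
  interpret branched_curve_of_degree \<X> br e by fact
  obtain f g where f: "f \<in> riemann_roch_space \<X> G" "map to_ac u = map (\<lambda>P. value_at P f) Ps"
    and g: "g \<in> riemann_roch_space \<X> G" "map to_ac w = map (\<lambda>P. value_at P g) Ps"
    using u w by (auto simp: functional_code_def)
  have len: "length u = length Ps" "length w = length Ps"
    using f(2) g(2) by (metis length_map)+
  have nth: "to_ac (u ! i) = value_at (Ps ! i) f" "to_ac (w ! i) = value_at (Ps ! i) g"
    if "i < length Ps" for i
    using f(2) g(2) len that by (metis nth_map)+
  obtain i where i: "i < length Ps" "u ! i \<noteq> w ! i"
    using \<open>u \<noteq> w\<close> len by (metis nth_equalityI)
  define P0 where "P0 = Ps ! i"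
  have P0: "P0 \<in> \<X>" using nth_mem[OF i(1)] Ps(2) by (auto simp: P0_def)
  have RR: "h \<in> carrier KX" "Q \<in> \<X> \<Longrightarrow> k < - Poly_Mapping.lookup G Q \<Longrightarrow> fls_nth (germ Q h) k = 0"
    if h: "h \<in> riemann_roch_space \<X> G" for h Q k
  proof -
    show hc: "h \<in> carrier KX"
      using h zero_one_carrier(1)[OF P0] ratfun_in_carrier
      by (auto simp: riemann_roch_space_def rational_functions_def)
    show "fls_nth (germ Q h) k = 0" if Q: "Q \<in> \<X>" "k < - Poly_Mapping.lookup G Q"
    proof (cases "h = \<zero>\<^bsub>KX\<^esub>")
      case True
      then show ?thesis by (simp add: germ_zero_one(1)[OF Q(1)])
    next
      case False
      then have "ord_at \<X> Q h + Poly_Mapping.lookup G Q \<ge> 0"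
        using h Q(1) by (auto simp: riemann_roch_space_def)
      then show ?thesis
        using ord_at_eq_subdegree[OF Q(1) hc False] Q(2) by simp
    qed
  qed
  obtain A B where AB: "(A, B) \<in> quotients \<X>" "f = ratfun \<X> A B" using RR(1)[OF f(1)] by (rule carrierE)
  obtain A' B' where AB': "(A', B') \<in> quotients \<X>" "g = ratfun \<X> A' B'" using RR(1)[OF g(1)] by (rule carrierE)
  define r where "r = ratfun \<X> (A * B' - A' * B) (B * B')"
  have rc: "r \<in> carrier KX" unfolding r_def by (rule ratfun_in_carrier[OF quotients_cross[OF AB(1) AB'(1)]])
  have rg: "germ Q r = germ Q f - germ Q g" if Q: "Q \<in> \<X>" for Q
  proof -
    from AB(1) Q have "at_branch Q B \<noteq> 0" by (rule quotientsD)
    moreover from AB'(1) Q have "at_branch Q B' \<noteq> 0" by (rule quotientsD)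
    ultimately show ?thesis
      using germ_ratfun[OF Q quotients_cross[OF AB(1) AB'(1)]] germ_ratfun[OF Q AB(1)] germ_ratfun[OF Q AB'(1)]
      by (simp add: r_def AB(2) AB'(2) quot_germ_def fpsc.ev_homs fls_times_fps_to_fls diff_frac_eq)
  qed
  have val: "value_at Q h = fls_nth (germ Q h) 0" if "Q \<in> set Ps" "h \<in> riemann_roch_space \<X> G" for Q h
  proof -
    have Q: "Q \<in> \<X>" "Poly_Mapping.lookup G Q = 0" using that(1) Ps(2) by (auto simp: in_keys_iff)
    have "fls_subdegree (germ Q h) \<ge> 0"
      by (rule fls_subdegree_ge0I) (use RR(2)[OF that(2) Q(1)] Q(2) in simp)
    then show ?thesis using value_at_germ[OF Q(1) RR(1)[OF that(2)]] by simp
  qed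
  have "fls_nth (germ P0 r) 0 \<noteq> 0"
    using i nth[OF i(1)] val[of P0] f(1) g(1) rg[OF P0]
    by (auto simp: P0_def) (metis to_ac_eq_iff)
  then have rnz: "r \<noteq> \<zero>\<^bsub>KX\<^esub>" using germ_zero_one(1)[OF P0] by auto
  define I where "I = {i. i < length Ps \<and> u ! i = w ! i}"
  define Z where "Z = (\<lambda>i. Ps ! i) ` I"
  have "int (card Z) \<le> div_degree G"
  proof (rule card_zeros_le_degree[OF P0 rc rnz G])
    fix Q assume Q: "Q \<in> \<X>"
    have "germ Q r \<noteq> 0" using germ_eq_0_iff[OF Q rc] rnz by simp
    then have "- Poly_Mapping.lookup G Q \<le> fls_subdegree (germ Q r)"
      by (rule fls_subdegree_geI) (use RR(2)[OF f(1) Q] RR(2)[OF g(1) Q] rg[OF Q] in simp)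
    then show "fls_subdegree (germ Q r) + Poly_Mapping.lookup G Q \<ge> 0" by simp
  next
    fix Q assume "Q \<in> Z"
    then obtain i where i: "i < length Ps" "u ! i = w ! i" "Q = Ps ! i" by (auto simp: Z_def I_def)
    then have "Q \<in> set Ps" by simp
    then have Q: "Q \<in> \<X>" "Q \<in> set Ps" and G0: "Poly_Mapping.lookup G Q = 0"
      using Ps(2) by (auto simp: in_keys_iff)
    have "fls_nth (germ Q f) 0 = fls_nth (germ Q g) 0"
      using nth[OF i(1)] i(2,3) val[OF Q(2) f(1)] val[OF Q(2) g(1)] by simp
    then have z: "fls_nth (germ Q r) 0 = 0" using rg[OF Q(1)] by simp
    have "germ Q r \<noteq> 0" using germ_eq_0_iff[OF Q(1) rc] rnz by simp
    then have "1 \<le> fls_subdegree (germ Q r)"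
    proof (rule fls_subdegree_geI)
      fix k :: int assume "k < 1"
      then consider "k = 0" | "k < 0" by linarith
      then show "fls_nth (germ Q r) k = 0"
        using z RR(2)[OF f(1) Q(1)] RR(2)[OF g(1) Q(1)] rg[OF Q(1)] G0 by cases simp_all
    qed
    then show "Poly_Mapping.lookup G Q = 0 \<and> fls_subdegree (germ Q r) \<ge> 1" using G0 by simp
  qed (use Ps(2) nth_mem in \<open>fastforce simp: Z_def I_def\<close>)+
  moreover have "card Z = card I"
    unfolding Z_def using Ps(1) by (intro card_image) (auto simp: inj_on_def I_def nth_eq_iff_index_eq)
  moreover have "hamming_distance u w + card I = length Ps"
  proof -
    have "{i. i < length u \<and> u ! i \<noteq> w ! i} \<union> I = {..<length Ps}"
      using len by (auto simp: I_def)
    moreover have "{i. i < length u \<and> u ! i \<noteq> w ! i} \<inter> I = {}" by (auto simp: I_def)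
    ultimately show ?thesis
      unfolding hamming_distance_def
      by (metis card_Un_disjoint card_lessThan finite_Un finite_lessThan)
  qed
  ultimately show ?thesis by linarith
qed

section \<open>Polynomials over an algebraically closed field\<close>

definition pev :: "('a::comm_ring_1 \<Rightarrow> 'b::comm_ring_1) \<Rightarrow> 'a poly \<Rightarrow> 'b \<Rightarrow> 'b" where
  "pev h p x = poly (map_poly h p) x"

lemma pev_id [simp]: "pev (\<lambda>a. a) p x = poly p x"
  by (simp add: pev_def map_poly_id')

context scalar_hom
begin

lemma pev_0 [simp]: "pev h 0 x = 0"
  by (simp add: pev_def)

lemma pev_pCons [simp]: "pev h (pCons c p) x = h c + x * pev h p x"
  by (simp add: pev_def map_poly_pCons hom_zero)

lemma pev_add: "pev h (p + r) x = pev h p x + pev h r x"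
proof (induction p arbitrary: r)
  case (pCons c p)
  show ?case
  proof (cases r)
    case (pCons d s)
    then show ?thesis using pCons.IH[of s] by (simp add: hom_add algebra_simps)
  qed
qed simp

lemma pev_smult: "pev h (smult c p) x = h c * pev h p x"
  by (induction p) (simp_all add: hom_mult algebra_simps)

lemma pev_mult: "pev h (p * r) x = pev h p x * pev h r x"
  by (induction p) (simp_all add: pev_add pev_smult hom_zero algebra_simps)

lemma scalar_hom_pev: "scalar_hom (\<lambda>p. pev h p x)"
  by unfold_locales (simp_all add: pev_add pev_mult one_pCons hom_one)

lemma hom_pev:
  assumes "scalar_hom \<phi>"
  shows "\<phi> (pev h p x) = pev (\<lambda>a. \<phi> (h a)) p (\<phi> x)"
proof -
  interpret \<phi>: scalar_hom \<phi> by fact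
  interpret \<phi>h: scalar_hom "\<lambda>a. \<phi> (h a)"
    by unfold_locales (simp_all add: homs \<phi>.homs)
  show ?thesis by (induction p) (simp_all add: \<phi>.homs)
qed

end

lemma sum_order_eq_degree:
  fixes p :: "'a::alg_closed_field poly"
  assumes "p \<noteq> 0"
  shows "(\<Sum>x | poly p x = 0. order x p) = degree p"
proof -
  obtain A where A: "size A = degree p" "p = smult (lead_coeff p) (\<Prod>x\<in>#A. [:-x, 1:])"
    using alg_closed_imp_factorization[OF assms] by blast
  have nz: "(\<Prod>x\<in>#B. [:-x, 1:]) \<noteq> 0" for B :: "'a multiset" by auto
  have "proots (\<Prod>x\<in>#B. [:-x, 1:]) = B" for B :: "'a multiset"
  proof (induction B)
    case (add x B)
    then show ?case using nz[of B] by (simp add: proots_mult del: mult_pCons_left)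
  qed simp
  then have "proots p = A"
    using A(2) assms by (metis leading_coeff_0_iff proots_smult)
  then have "degree p = size (proots p)" using A(1) by simp
  also have "\<dots> = (\<Sum>x | poly p x = 0. order x p)"
    using assms by (simp add: size_multiset_overloaded_eq)
  finally show ?thesis by simp
qed

lemma card_roots_separable:
  fixes p :: "'a::alg_closed_field poly"
  assumes "p \<noteq> 0" and sep: "\<And>x. poly p x = 0 \<Longrightarrow> poly (pderiv p) x \<noteq> 0"
  shows "card {x. poly p x = 0} = degree p"
proof -
  have "order x p = 1" if x: "poly p x = 0" for x
  proof -
    have "\<not> [:-x, 1:] ^ 2 dvd p"
    proof
      assume "[:-x, 1:] ^ 2 dvd p"
      then obtain r where "p = [:-x, 1:] ^ 2 * r" by (rule dvdE)
      then have p: "p = [:-x, 1:] * ([:-x, 1:] * r)"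
        by (simp only: power2_eq_square mult.assoc)
      have "poly (pderiv (l * (l * r))) x = 0" if "poly l x = 0" for l
        by (simp add: pderiv_mult that)
      from this[of "[:-x, 1:]"] have "poly (pderiv p) x = 0"
        unfolding p by simp
      with sep[OF x] show False by simp
    qed
    then have "order x p < 2" using assms(1) by (metis leI order_divides)
    moreover have "order x p \<noteq> 0" using x assms(1) order_root by metis
    ultimately show ?thesis by simp
  qed
  then have "(\<Sum>x | poly p x = 0. order x p) = (\<Sum>x | poly p x = 0. 1)"
    by (intro sum.cong) auto
  then show ?thesis using sum_order_eq_degree[OF assms(1)] by simp
qed

lemma infinite_alg_closed: "infinite (UNIV :: 'a::alg_closed_field set)"
proof
  assume fin: "finite (UNIV :: 'a set)"
  define p where "p = (\<Prod>a\<in>(UNIV::'a set). [:-a, 1:])"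
  have "degree p = card (UNIV :: 'a set)"
    unfolding p_def by (subst degree_prod_eq_sum_degree) (auto simp: fin)
  then have d: "degree p > 0" using fin by (simp add: card_gt_0_iff)
  then have "degree (p + 1) > 0" by (simp add: degree_add_eq_left)
  then obtain x where x: "poly (p + 1) x = 0" using alg_closed_imp_poly_has_root by blast
  have "poly p x = 0" unfolding p_def using fin by (auto simp: poly_prod prod_zero_iff)
  then show False using x by simp
qed

lemma poly_eq_0_if_all_roots:
  fixes p :: "'a::alg_closed_field poly"
  assumes "\<And>x. poly p x = 0"
  shows "p = 0"
  using poly_roots_finite[of p] infinite_alg_closed assms by auto

lemma coefficients_vanish:
  fixes b :: "nat \<Rightarrow> 'a::field"
  assumes "finite S" "card S \<ge> N" "\<And>x. x \<in> S \<Longrightarrow> (\<Sum>i<N. b i * x ^ i) = 0" "i < N"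
  shows "b i = 0"
proof -
  define p where "p = (\<Sum>i<N. monom (b i) i)"
  have c: "coeff p k = (if k < N then b k else 0)" for k
  proof -
    have "coeff p k = (\<Sum>i<N. if i = k then b k else 0)"
      unfolding p_def coeff_sum by (rule sum.cong) auto
    then show ?thesis by simp
  qed
  have "p = 0"
  proof (rule ccontr)
    assume nz: "p \<noteq> 0"
    have "degree p < N"
      using assms(4) c by (metis leading_coeff_0_iff nz)
    moreover have "S \<subseteq> {x. poly p x = 0}"
      using assms(3) by (auto simp: p_def poly_sum poly_monom)
    then have "card S \<le> degree p"
      using card_poly_roots_bound[OF nz] card_mono[OF poly_roots_finite[OF nz]] by (meson le_trans)
    ultimately show False using assms(2) by simp
  qed
  then show ?thesis using c[of i] assms(4) by simp
qed

text \<open>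
  Writing a polynomial in \<open>a + t\<close> is Taylor expansion at \<open>a\<close>, and the order in \<open>t\<close> is the multiplicity
  of the root.
\<close>

lemma subdegree_pev_shift:
  fixes p :: "'a::field poly"
  assumes "p \<noteq> 0"
  shows "pev fps_const p (fps_const a + fps_X) \<noteq> 0"
    and "subdegree (pev fps_const p (fps_const a + fps_X)) = order a p"
proof -
  interpret E: scalar_hom "\<lambda>p. pev fps_const p (fps_const a + fps_X)"
    by (rule fpsc.scalar_hom_pev)
  obtain r where r: "p = [:- a, 1:] ^ order a p * r" "\<not> [:- a, 1:] dvd r"
    using order_decomp[OF assms] by blast
  have "fps_nth (pev fps_const r (fps_const a + fps_X)) 0 = poly r a"
    using fpsc.hom_pev[OF scalar_hom_fps_nth_0, of r "fps_const a + fps_X"] by simp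
  also have "\<dots> \<noteq> 0" using r(2) by (simp add: poly_eq_0_iff_dvd)
  finally have r0: "fps_nth (pev fps_const r (fps_const a + fps_X)) 0 \<noteq> 0" .
  then have rnz: "pev fps_const r (fps_const a + fps_X) \<noteq> 0" by auto
  have "pev fps_const [:- a, 1:] (fps_const a + fps_X) = fps_X"
    by (simp flip: fps_const_neg)
  then have eq: "pev fps_const p (fps_const a + fps_X)
      = fps_X ^ order a p * pev fps_const r (fps_const a + fps_X)"
    by (subst r(1)) (simp only: E.homs)
  show "pev fps_const p (fps_const a + fps_X) \<noteq> 0" unfolding eq using rnz by simp
  show "subdegree (pev fps_const p (fps_const a + fps_X)) = order a p"
    unfolding eq using rnz r0 by simp
qed

section \<open>Sums of Laurent series with distinct orders\<close>

lemma fls_subdegree_sum_distinct: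
  fixes f :: "'i \<Rightarrow> 'a::field fls"
  assumes "finite A" "A \<noteq> {}" "\<And>i. i \<in> A \<Longrightarrow> f i \<noteq> 0" "inj_on (\<lambda>i. fls_subdegree (f i)) A"
  shows "(\<Sum>i\<in>A. f i) \<noteq> 0 \<and> fls_subdegree (\<Sum>i\<in>A. f i) = Min ((\<lambda>i. fls_subdegree (f i)) ` A)"
  using assms
proof (induction A rule: finite_ne_induct)
  case (insert x A)
  let ?s = "\<Sum>i\<in>A. f i" and ?d = "\<lambda>i. fls_subdegree (f i)"
  have IH: "?s \<noteq> 0" "fls_subdegree ?s = Min (?d ` A)" using insert by auto
  have x: "f x \<noteq> 0" using insert.prems by simp
  have "fls_subdegree ?s \<in> ?d ` A" unfolding IH(2) using insert.hyps by (intro Min_in) auto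
  then have ne: "?d x \<noteq> fls_subdegree ?s" using insert.prems(2) insert.hyps(3) by (auto simp: inj_on_def)
  have eq: "(\<Sum>i\<in>insert x A. f i) = f x + ?s" using insert.hyps by simp
  have m: "Min (?d ` insert x A) = min (?d x) (fls_subdegree ?s)"
    using insert.hyps IH(2) by (simp add: Min_insert)
  have sub: "fls_subdegree (f x + ?s) = min (?d x) (fls_subdegree ?s)"
  proof (cases "?d x < fls_subdegree ?s")
    case True
    then show ?thesis using fls_subdegree_add_eq1[OF x True] by simp
  next
    case False
    then have "fls_subdegree ?s < ?d x" using ne by simp
    then show ?thesis using fls_subdegree_add_eq2[OF IH(1)] by simp
  qed
  have "f x + ?s \<noteq> 0"
    using ne by (metis add_eq_0_iff fls_uminus_subdegree)
  then show ?case unfolding eq m using sub by blast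
qed auto

lemma pev_fls_at_pole:
  fixes z :: "'a::field fls"
  assumes z: "fls_subdegree z < 0" and "p \<noteq> 0"
  shows "pev fls_const p z \<noteq> 0 \<and> fls_subdegree (pev fls_const p z) = int (degree p) * fls_subdegree z"
  using assms(2)
proof (induction p)
  case (pCons c p)
  interpret c: scalar_hom "fls_const :: 'a \<Rightarrow> 'a fls" by (rule scalar_hom_fls_const)
  show ?case
  proof (cases "p = 0")
    case True
    then show ?thesis using pCons by simp
  next
    case False
    note IH = pCons.IH[OF False]
    let ?v = "z * pev fls_const p z"
    have znz: "z \<noteq> 0" using z by auto
    have nz: "?v \<noteq> 0" using IH znz by simp
    have "fls_subdegree ?v = fls_subdegree z + int (degree p) * fls_subdegree z"
      using IH znz by simp
    then have v: "fls_subdegree ?v = int (degree (pCons c p)) * fls_subdegree z"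
      using False by (simp add: algebra_simps)
    then have "fls_subdegree ?v < 0" using z False by (simp add: mult_less_0_iff)
    then have lt: "fls_subdegree ?v < fls_subdegree (fls_const c)" by simp
    have "fls_subdegree (fls_const c + ?v) = fls_subdegree ?v"
      by (rule fls_subdegree_add_eq2[OF nz lt])
    moreover from this have "fls_const c + ?v \<noteq> 0" using \<open>fls_subdegree ?v < 0\<close> by auto
    ultimately show ?thesis using v by simp
  qed
qed simp

section \<open>Solutions of the curve equations and their translations\<close>

text \<open>
  The equations are read in arbitrary commutative rings, since points, power series and Laurent series
  all occur as solutions.
\<close>

definition gk_sol :: "nat \<Rightarrow> 'b::comm_ring_1 \<Rightarrow> 'b \<Rightarrow> 'b \<Rightarrow> bool" where
  "gk_sol q x y z \<longleftrightarrow> y ^ (q + 1) = x ^ q + x \<and> z ^ (q^2 - q + 1) = y ^ (q^2) - y"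

definition pt4 :: "'b \<Rightarrow> 'b \<Rightarrow> 'b \<Rightarrow> 'b \<Rightarrow> 4 \<Rightarrow> 'b" where
  "pt4 x y z t = (\<lambda>i. if i = 1 then x else if i = 2 then y else if i = 3 then z else t)"

lemma pt4_simps [simp]: "pt4 x y z t 1 = x" "pt4 x y z t 2 = y" "pt4 x y z t 3 = z" "pt4 x y z t 4 = t"
  by (simp_all add: pt4_def)

lemma pt4_map: "(\<lambda>i. \<phi> (pt4 x y z t i)) = pt4 (\<phi> x) (\<phi> y) (\<phi> z) (\<phi> t)"
  by (auto simp: pt4_def)

text \<open>
  The type argument fixes the field, on which the condition on \<open>q\<close> depends only through its
  characteristic.
\<close>

locale gk_field =
  fixes q :: nat and Kt :: "'a::alg_closed_field itself"
  assumes char_prime: "prime CHAR('a)" and q_char_power: "\<exists>e>0. q = CHAR('a) ^ e"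
begin

lemma q_ge_2: "q \<ge> 2"
proof -
  obtain e where e: "e > 0" "q = CHAR('a) ^ e" using q_char_power by blast
  have "CHAR('a) ^ 1 \<le> CHAR('a) ^ e"
    using e(1) prime_gt_0_nat[OF char_prime] by (intro power_increasing) auto
  then show ?thesis using prime_ge_2_nat[OF char_prime] e(2) by simp
qed

lemma q2_gt_1: "1 < q^2"
  using q_ge_2 by (intro one_less_power) auto

lemma q_pos [simp]: "q > 0" "q \<noteq> 0"
  using q_ge_2 by auto

lemma of_nat_q: "of_nat q = (0 :: 'a)"
  using q_char_power by (auto simp: of_nat_eq_0_iff_char_dvd)

lemma frob_add:
  assumes "CHAR('b::comm_ring_1) = CHAR('a)"
  shows "((x::'b) + y) ^ q = x ^ q + y ^ q"
  using q_char_power char_prime assms by (auto intro!: freshmans_dream')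

lemma frob_diff:
  assumes "CHAR('b::comm_ring_1) = CHAR('a)"
  shows "((x::'b) - y) ^ q = x ^ q - y ^ q"
  using frob_add[OF assms, of "x - y" y] by (simp add: eq_diff_eq)

lemma frob2_add:
  assumes "CHAR('b::comm_ring_1) = CHAR('a)"
  shows "((x::'b) + y) ^ (q^2) = x ^ (q^2) + y ^ (q^2)"
  by (simp add: power2_eq_square power_mult frob_add[OF assms])

lemma frob2_diff:
  assumes "CHAR('b::comm_ring_1) = CHAR('a)"
  shows "((x::'b) - y) ^ (q^2) = x ^ (q^2) - y ^ (q^2)"
  by (simp add: power2_eq_square power_mult frob_diff[OF assms])

text \<open>
  The parameters \<open>(b, g)\<close> of the automorphisms \<open>(x, y, z) \<mapsto> (x + b\<^sup>q y + g, y + b, z)\<close> of the curve.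
  They fix the function \<open>z\<close> and the point at infinity.
\<close>

definition gk_group :: "('a \<times> 'a) set" where
  "gk_group = {(b, g). b ^ (q^2) = b \<and> g ^ q + g = b ^ (q + 1)}"

lemma gk_sol_translate:
  fixes h :: "'a \<Rightarrow> 'b::comm_ring_1"
  assumes "scalar_hom h" "CHAR('b) = CHAR('a)" and bg: "(b, g) \<in> gk_group" and sol: "gk_sol q x y z"
  shows "gk_sol q (x + h (b ^ q) * y + h g) (y + h b) z"
proof -
  interpret h: scalar_hom h by fact
  have b: "h b ^ (q^2) = h b" and g: "h g ^ q + h g = h b ^ (q + 1)"
    using bg by (auto simp: gk_group_def simp flip: h.homs)
  have b': "(h b ^ q) ^ q = h b"
    using b by (simp add: power2_eq_square power_mult)
  have y: "y * y ^ q = x ^ q + x" and z: "z ^ (q^2 - q + 1) = y ^ (q^2) - y"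
    using sol by (auto simp: gk_sol_def)
  have "(y + h b) ^ (q + 1) = (y + h b) * (y ^ q + h b ^ q)"
    by (simp add: frob_add[OF assms(2)])
  also have "\<dots> = y * y ^ q + y * h b ^ q + h b * y ^ q + h b ^ (q + 1)"
    by (simp add: algebra_simps)
  also have "\<dots> = (x ^ q + h b * y ^ q + h g ^ q) + (x + h b ^ q * y + h g)"
    unfolding y g[symmetric] by (simp add: algebra_simps)
  also have "x ^ q + h b * y ^ q + h g ^ q = (x + h (b ^ q) * y + h g) ^ q"
    by (simp add: frob_add[OF assms(2)] power_mult_distrib h.homs b')
  finally have "(y + h b) ^ (q + 1) = (x + h (b ^ q) * y + h g) ^ q + (x + h (b ^ q) * y + h g)"
    by (simp add: h.homs)
  moreover have "(y + h b) ^ (q^2) - (y + h b) = y ^ (q^2) - y"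
    by (simp add: frob2_add[OF assms(2)] b)
  ultimately show ?thesis
    unfolding gk_sol_def using z by metis
qed

definition gk_fibre :: "'a \<Rightarrow> ('a \<times> 'a) set" where
  "gk_fibre a = {(x, y). gk_sol q x y a}"

lemma card_root_q2: "card {y::'a. y ^ (q^2) - y = c} = q^2"
proof -
  define p where "p = monom 1 (q^2) + [:- c, -1:]"
  note q2 = q2_gt_1
  have deg: "degree p = q^2"
    unfolding p_def using q2 by (subst degree_add_eq_left) (auto simp: degree_monom_eq)
  have "pderiv p = [:- 1:]"
    by (simp add: p_def pderiv_add pderiv_monom pderiv_pCons of_nat_q power2_eq_square)
  then have "card {x. poly p x = 0} = degree p"
    using deg q2 by (intro card_roots_separable) auto
  moreover have "{x. poly p x = 0} = {y. y ^ (q^2) - y = c}"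
    by (auto simp: p_def poly_monom algebra_simps)
  ultimately show ?thesis using deg by simp
qed

lemma card_root_q: "card {x::'a. x ^ q + x = c} = q"
proof -
  define p where "p = monom 1 q + [:- c, 1:]"
  have deg: "degree p = q"
    unfolding p_def using q_ge_2 by (subst degree_add_eq_left) (auto simp: degree_monom_eq)
  have "pderiv p = [:1:]"
    by (simp add: p_def pderiv_add pderiv_monom pderiv_pCons of_nat_q)
  then have "card {x. poly p x = 0} = degree p"
    using deg q_ge_2 by (intro card_roots_separable) auto
  moreover have "{x. poly p x = 0} = {y. y ^ q + y = c}"
    by (auto simp: p_def poly_monom algebra_simps eq_neg_iff_add_eq_0)
  ultimately show ?thesis using deg by simp
qed

lemma finite_root_q2: "finite {y::'a. y ^ (q^2) - y = c}"
  using card_root_q2[of c] by (intro card_ge_0_finite) simp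

lemma finite_root_q: "finite {x::'a. x ^ q + x = c}"
  using card_root_q[of c] by (intro card_ge_0_finite) simp

lemma gk_fibre_card: "finite (gk_fibre a)" "card (gk_fibre a) = q ^ 3"
proof -
  let ?Y = "{y::'a. y ^ (q^2) - y = a ^ (q^2 - q + 1)}"
  let ?S = "SIGMA y:?Y. {x. x ^ q + x = y ^ (q + 1)}"
  have S: "gk_fibre a = prod.swap ` ?S"
    by (force simp: gk_fibre_def gk_sol_def)
  have fin: "finite ?S" using finite_root_q2 finite_root_q by (intro finite_SigmaI) auto
  then show "finite (gk_fibre a)" unfolding S by simp
  have "card ?S = q^2 * q"
    using finite_root_q2 finite_root_q by (subst card_SigmaI) (auto simp: card_root_q card_root_q2)
  then show "card (gk_fibre a) = q ^ 3"
    unfolding S by (subst card_image) (auto simp: power2_eq_square power3_eq_cube)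
qed

text \<open>
  The group acts simply transitively on every fibre of \<open>z\<close>: the second equation forces the difference
  \<open>b\<close> of two values of \<open>y\<close> to be fixed by the Frobenius map of exponent \<open>q\<^sup>2\<close>, and then the first
  equation is exactly the condition on \<open>g\<close>.
\<close>

lemma gk_group_fibre:
  assumes "(x0, y0) \<in> gk_fibre a"
  shows "bij_betw (\<lambda>(b, g). (x0 + b ^ q * y0 + g, y0 + b)) gk_group (gk_fibre a)"
proof (rule bij_betwI')
  fix u v assume "u \<in> gk_group" "v \<in> gk_group"
  then show "((\<lambda>(b, g). (x0 + b ^ q * y0 + g, y0 + b)) u = (\<lambda>(b, g). (x0 + b ^ q * y0 + g, y0 + b)) v) = (u = v)"
    by (cases u; cases v) auto
next
  fix u assume "u \<in> gk_group"
  then show "(\<lambda>(b, g). (x0 + b ^ q * y0 + g, y0 + b)) u \<in> gk_fibre a"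
    using gk_sol_translate[OF scalar_hom_id, of "fst u" "snd u" x0 y0 a] assms
    by (cases u) (simp add: gk_fibre_def)
next
  fix v assume "v \<in> gk_fibre a"
  then obtain x y where v: "v = (x, y)" "gk_sol q x y a" by (auto simp: gk_fibre_def)
  have 0: "gk_sol q x0 y0 a" using assms by (simp add: gk_fibre_def)
  define b where "b = y - y0"
  define g where "g = x - x0 - b ^ q * y0"
  have "y ^ (q^2) - y = y0 ^ (q^2) - y0" using v(2) 0 by (simp add: gk_sol_def)
  then have b: "b ^ (q^2) = b" by (simp add: b_def frob2_diff) (simp add: algebra_simps)
  then have b': "(b ^ q) ^ q = b" by (simp add: power2_eq_square power_mult)
  have e1: "y * y ^ q = x ^ q + x" and e2: "y0 * y0 ^ q = x0 ^ q + x0"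
    using v(2) 0 by (auto simp: gk_sol_def)
  have bq: "b ^ q = y ^ q - y0 ^ q" by (simp add: b_def frob_diff)
  have "g ^ q + g = x ^ q - x0 ^ q - b * y0 ^ q + (x - x0 - b ^ q * y0)"
    by (simp add: g_def frob_diff power_mult_distrib b')
  also have "\<dots> = y * y ^ q - y0 * y0 ^ q - b * y0 ^ q - b ^ q * y0"
    unfolding e1 e2 by (simp add: algebra_simps)
  also have "\<dots> = b ^ (q + 1)"
    unfolding power_add power_one_right bq unfolding b_def by (simp add: algebra_simps)
  finally have "(b, g) \<in> gk_group" using b by (simp add: gk_group_def)
  then show "\<exists>u\<in>gk_group. v = (\<lambda>(b, g). (x0 + b ^ q * y0 + g, y0 + b)) u"
    by (intro bexI[of _ "(b, g)"]) (auto simp: v(1) g_def b_def)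
qed

lemma gk_group_card: "finite gk_group" "card gk_group = q ^ 3"
proof -
  have "(0, 0) \<in> gk_fibre 0" by (simp add: gk_fibre_def gk_sol_def)
  note bij = gk_group_fibre[OF this]
  show "finite gk_group" "card gk_group = q ^ 3"
    using gk_fibre_card[of 0] bij_betw_finite[OF bij] bij_betw_same_card[OF bij] by simp_all
qed

section \<open>Normal forms modulo the ideal of the curve\<close>

abbreviation (input) eqn_xy :: "'a poly4" where
  "eqn_xy \<equiv> var4 2 ^ (q + 1) - var4 1 ^ q - var4 1"

abbreviation (input) eqn_yz :: "'a poly4" where
  "eqn_yz \<equiv> var4 3 ^ (q^2 - q + 1) - var4 2 ^ (q^2) + var4 2"

text \<open>
  Congruence modulo the ideal generated by the two affine equations and \<open>T - 1\<close>. Because the ideal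
  membership is explicit, one congruence can be evaluated in every commutative \<open>K\<close>-algebra.
\<close>

definition gk_cong :: "'a poly4 \<Rightarrow> 'a poly4 \<Rightarrow> bool" where
  "gk_cong F G \<longleftrightarrow> (\<exists>A B D. F - G = A * eqn_xy + B * eqn_yz + D * (var4 4 - 1))"

lemma gk_congI: "F - G = A * eqn_xy + B * eqn_yz + D * (var4 4 - 1) \<Longrightarrow> gk_cong F G"
  unfolding gk_cong_def by blast

lemma gk_cong_refl: "gk_cong F F"
  by (rule gk_congI[of _ _ 0 0 0]) simp

lemma gk_cong_add:
  assumes "gk_cong F G" "gk_cong F' G'"
  shows "gk_cong (F + F') (G + G')"
proof -
  from assms obtain A B D A' B' D' where
    "F - G = A * eqn_xy + B * eqn_yz + D * (var4 4 - 1)"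
    "F' - G' = A' * eqn_xy + B' * eqn_yz + D' * (var4 4 - 1)"
    unfolding gk_cong_def by blast
  moreover have "(F + F') - (G + G') = (F - G) + (F' - G')" by simp
  ultimately show ?thesis
    by (intro gk_congI[of _ _ "A + A'" "B + B'" "D + D'"]) (simp only: distrib_right add_ac)
qed

lemma gk_cong_trans: "gk_cong F G \<Longrightarrow> gk_cong G H \<Longrightarrow> gk_cong F H"
  using gk_cong_add[of F G G H] by (auto simp: gk_cong_def)

lemma gk_cong_mult_left:
  assumes "gk_cong F G"
  shows "gk_cong (M * F) (M * G)"
proof -
  from assms obtain A B D where
    "F - G = A * eqn_xy + B * eqn_yz + D * (var4 4 - 1)"
    unfolding gk_cong_def by blast
  moreover have "M * F - M * G = M * (F - G)" by (simp add: algebra_simps)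
  ultimately show ?thesis
    by (intro gk_congI[of _ _ "M * A" "M * B" "M * D"]) (simp only: distrib_left mult.assoc)
qed

lemma gk_cong_ev:
  fixes h :: "'a \<Rightarrow> 'b::comm_ring_1"
  assumes "scalar_hom h" "gk_cong F G" "gk_sol q x y z"
  shows "ev h F (pt4 x y z 1) = ev h G (pt4 x y z 1)"
proof -
  interpret h: scalar_hom h by fact
  obtain A B D where "F - G = A * eqn_xy + B * eqn_yz + D * (var4 4 - 1)"
    using assms(2) unfolding gk_cong_def by blast
  then have "ev h (F - G) (pt4 x y z 1) = ev h A (pt4 x y z 1) * (y ^ (q + 1) - x ^ q - x)
     + ev h B (pt4 x y z 1) * (z ^ (q^2 - q + 1) - y ^ (q^2) + y) + ev h D (pt4 x y z 1) * (1 - 1)"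
    by (simp only: h.ev_homs h.ev_var4 h.ev_one pt4_simps)
  also have "\<dots> = 0" using assms(3) by (simp add: gk_sol_def)
  finally show ?thesis by (simp add: h.ev_homs)
qed

definition nf_term :: "'a poly \<Rightarrow> nat \<Rightarrow> nat \<Rightarrow> 'a poly4" where
  "nf_term p i j = pev const4 p (var4 3) * var4 1 ^ i * var4 2 ^ j"

text \<open>
  The monomials \<open>x\<^sup>i y\<^sup>j\<close> with \<open>i < q\<close> and \<open>j < q\<^sup>2\<close> are a basis of the affine coordinate ring over \<open>K[z]\<close>;
  this is the general element in that basis.
\<close>

definition nf :: "(nat \<Rightarrow> nat \<Rightarrow> 'a poly) \<Rightarrow> 'a poly4" where
  "nf a = (\<Sum>i<q. \<Sum>j<q^2. nf_term (a i j) i j)"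

interpretation const4: scalar_hom "const4 :: 'a \<Rightarrow> 'a poly4"
  by (rule scalar_hom_const4)

lemma nf_term_add: "nf_term p i j + nf_term r i j = nf_term (p + r) i j"
  by (simp add: nf_term_def const4.pev_add algebra_simps)

lemma reducible_add:
  assumes "\<exists>a. gk_cong F (nf a)" "\<exists>a. gk_cong G (nf a)"
  shows "\<exists>a. gk_cong (F + G) (nf a)"
proof -
  from assms obtain a b where "gk_cong F (nf a)" "gk_cong G (nf b)" by blast
  then have "gk_cong (F + G) (nf a + nf b)" by (rule gk_cong_add)
  also have "nf a + nf b = nf (\<lambda>i j. a i j + b i j)"
    by (simp add: nf_def nf_term_add flip: sum.distrib)
  finally show ?thesis by blast
qed

lemma reducible_term_small:
  assumes "i < q" "j < q^2"
  shows "\<exists>a. gk_cong (nf_term p i j) (nf a)"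
proof -
  define a where "a = (\<lambda>i' j'. if i' = i \<and> j' = j then p else 0)"
  have "nf a = (\<Sum>i'<q. if i' = i then (\<Sum>j'<q^2. if j' = j then nf_term p i j else 0) else 0)"
    unfolding nf_def
  proof (rule sum.cong[OF refl])
    fix i'
    show "(\<Sum>j<q^2. nf_term (a i' j) i' j) =
        (if i' = i then \<Sum>j'<q^2. if j' = j then nf_term p i j else 0 else 0)"
    proof (cases "i' = i")
      case True
      have "(\<Sum>j<q^2. nf_term (a i j) i j) = (\<Sum>j'<q^2. if j' = j then nf_term p i j else 0)"
        by (rule sum.cong) (auto simp: a_def nf_term_def)
      then show ?thesis using True by simp
    next
      case False
      then show ?thesis by (simp add: a_def nf_term_def)
    qed
  qed
  also have "\<dots> = nf_term p i j" using assms by simp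
  finally show ?thesis using gk_cong_refl by metis
qed

text \<open>
  The second equation replaces \<open>y\<close> to the power \<open>q\<^sup>2\<close> by \<open>y + z\<^sup>n\<close> and leaves the exponent of \<open>x\<close> alone.
\<close>

lemma reducible_term_low_x:
  assumes "i < q"
  shows "\<exists>a. gk_cong (nf_term p i j) (nf a)"
proof (induction j arbitrary: p rule: less_induct)
  case (less j)
  show ?case
  proof (cases "j < q^2")
    case True
    then show ?thesis using reducible_term_small[OF assms] by blast
  next
    case False
    define k where "k = j - q^2"
    have j: "j = k + q^2" using False by (simp add: k_def)
    let ?r = "p * monom 1 (q^2 - q + 1)"
    have mon: "pev const4 (monom 1 m) x = x ^ m" for m :: nat and x :: "'a poly4"
      by (induction m) (simp_all add: monom_0 monom_Suc const4.hom_one const4.hom_zero)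
    have "gk_cong (nf_term p i j) (nf_term p i (k + 1) + nf_term ?r i k)"
    proof (rule gk_congI[of _ _ 0 "- (pev const4 p (var4 3) * var4 1 ^ i * var4 2 ^ k)" 0])
      show "nf_term p i j - (nf_term p i (k + 1) + nf_term ?r i k) =
          0 * eqn_xy
        + - (pev const4 p (var4 3) * var4 1 ^ i * var4 2 ^ k) * eqn_yz
        + 0 * (var4 4 - 1)"
      proof -
        have "P * A * (b * bq) - (P * A * (b * y) + P * zn * A * b) = - (P * A * b) * (zn - bq + y)"
          for P A b bq y zn :: "'a poly4" by (simp add: algebra_simps)
        then show ?thesis
          unfolding nf_term_def j const4.pev_mult mon power_add[of "var4 2" k] power_one_right
          by (simp only: mult_zero_left add_0_right add_0_left)
      qed
    qed
    moreover have "\<exists>a. gk_cong (nf_term p i (k + 1)) (nf a)" "\<exists>a. gk_cong (nf_term ?r i k) (nf a)"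
      using less[of "k + 1" p] less[of k ?r] q2_gt_1 j by auto
    ultimately show ?thesis using reducible_add gk_cong_trans by meson
  qed
qed

text \<open>
  The first equation lowers the exponent of \<open>x\<close> and may raise that of \<open>y\<close>; so the induction on the
  former has to treat all of the latter at once.
\<close>

lemma reducible_term: "\<exists>a. gk_cong (nf_term p i j) (nf a)"
proof (induction i arbitrary: j p rule: less_induct)
  case (less i)
  show ?case
  proof (cases "i < q")
    case True
    then show ?thesis using reducible_term_low_x by blast
  next
    case False
    define k where "k = i - q"
    have i: "i = k + q" using False by (simp add: k_def)
    have "gk_cong (nf_term p i j) (nf_term p k (j + (q + 1)) + nf_term (- p) (k + 1) j)"
    proof (rule gk_congI[of _ _ "- (pev const4 p (var4 3) * var4 1 ^ k * var4 2 ^ j)" 0 0])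
      have um: "pev const4 (- p) x = - pev const4 p x" for x :: "'a poly4"
        using const4.pev_smult[of "-1" p x] by (simp add: const4.homs)
      show "nf_term p i j - (nf_term p k (j + (q + 1)) + nf_term (- p) (k + 1) j) =
          - (pev const4 p (var4 3) * var4 1 ^ k * var4 2 ^ j) * eqn_xy
        + 0 * eqn_yz + 0 * (var4 4 - 1)"
      proof -
        have "P * (a * aq) * b - (P * a * (b * y) + - P * (a * x) * b) = - (P * a * b) * (y - aq - x)"
          for P a aq b x y :: "'a poly4" by (simp add: algebra_simps)
        then show ?thesis
          unfolding nf_term_def i um power_add[of "var4 1" k] power_add[of "var4 2" j "q + 1"] power_one_right
          by (simp only: mult_zero_left add_0_right)
      qed
    qed
    moreover have "\<exists>a. gk_cong (nf_term p k (j + (q + 1))) (nf a)" "\<exists>a. gk_cong (nf_term (- p) (k + 1) j) (nf a)"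
      using less[of k] less[of "k + 1"] q_ge_2 i by auto
    ultimately show ?thesis using reducible_add gk_cong_trans by meson
  qed
qed

theorem normal_form_exists: "\<exists>a. gk_cong F (nf a)"
proof -
  have T: "gk_cong (var4 4 ^ k) 1" for k
  proof (induction k)
    case (Suc k)
    have "gk_cong (var4 4 * var4 4 ^ k) (var4 4 * 1)" by (rule gk_cong_mult_left[OF Suc])
    moreover have "gk_cong (var4 4) 1" by (rule gk_congI[of _ _ 0 0 1]) simp
    ultimately show ?case using gk_cong_trans by simp
  qed (simp add: gk_cong_refl)
  have mon: "pev const4 (monom c m) x = const4 c * x ^ m" for c m and x :: "'a poly4"
    by (induction m) (simp_all add: monom_0 monom_Suc const4.hom_zero mult_ac)
  have "\<exists>a. gk_cong (const4 c * monom4 var4 m) (nf a)" for c m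
  proof -
    let ?l = "Poly_Mapping.lookup m"
    have "monom4 var4 m = var4 1 ^ ?l 1 * (var4 2 ^ ?l 2 * (var4 3 ^ ?l 3 * var4 4 ^ ?l 4) :: 'a poly4)"
      unfolding monom4_def UNIV_4 by simp
    then have "const4 c * monom4 var4 m = nf_term (monom c (?l 3)) (?l 1) (?l 2) * var4 4 ^ ?l 4"
      unfolding nf_term_def mon by (simp only: mult_ac)
    moreover have "gk_cong (nf_term (monom c (?l 3)) (?l 1) (?l 2) * var4 4 ^ ?l 4)
        (nf_term (monom c (?l 3)) (?l 1) (?l 2) * 1)"
      by (rule gk_cong_mult_left[OF T])
    ultimately show ?thesis using reducible_term gk_cong_trans by (metis mult_1_right)
  qed
  moreover have "\<exists>a. gk_cong 0 (nf a)"
    by (intro exI[of _ "\<lambda>i j. 0"]) (simp add: nf_def nf_term_def gk_cong_refl)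
  ultimately have "\<exists>a. gk_cong (\<Sum>m\<in>A. const4 (Poly_Mapping.lookup F m) * monom4 var4 m) (nf a)" for A
    by (induction A rule: infinite_finite_induct) (auto intro: reducible_add)
  then obtain a where "gk_cong (\<Sum>m\<in>Poly_Mapping.keys F. const4 (Poly_Mapping.lookup F m) * monom4 var4 m) (nf a)"
    by blast
  then show ?thesis using ev_const4_var4[of F] by (auto simp: ev_def)
qed

lemma ev_nf:
  fixes h :: "'a \<Rightarrow> 'b::comm_ring_1"
  assumes "scalar_hom h"
  shows "ev h (nf a) (pt4 x y z t) = (\<Sum>i<q. \<Sum>j<q^2. pev h (a i j) z * x ^ i * y ^ j)"
proof -
  interpret h: scalar_hom h by fact
  from const4.hom_pev[OF h.scalar_hom_ev] show ?thesis
    by (simp add: nf_def nf_term_def h.ev_homs)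
qed

text \<open>
  On a fibre there are \<open>q^2\<close> values of \<open>y\<close> and, for each of them, \<open>q\<close> values of \<open>x\<close>; that is
  more than the degrees in a normal form allow unless it is constant there.
\<close>

lemma normal_form_constant_on_fibre:
  assumes const: "\<And>x y. gk_sol q x y z \<Longrightarrow> ev (\<lambda>a. a) (nf a) (pt4 x y z 1) = c"
    and ij: "i < q" "j < q^2"
  shows "poly (a i j) z = (if i = 0 \<and> j = 0 then c else 0)"
proof -
  let ?Y = "{y::'a. y ^ (q^2) - y = z ^ (q^2 - q + 1)}"
  have q2: "0 < q^2" by simp
  have X: "(\<Sum>j<q^2. poly (a i j) z * y ^ j) - (if i = 0 then c else 0) = 0"
    if y: "y \<in> ?Y" and i: "i < q" for i y
  proof (rule coefficients_vanish[OF finite_root_q[of "y ^ (q + 1)"] _ _ i,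
        where b = "\<lambda>i. (\<Sum>j<q^2. poly (a i j) z * y ^ j) - (if i = 0 then c else 0)"])
    fix x assume "x \<in> {x. x ^ q + x = y ^ (q + 1)}"
    then have "gk_sol q x y z" using y by (auto simp: gk_sol_def)
    from const[OF this] have "(\<Sum>i<q. \<Sum>j<q^2. poly (a i j) z * x ^ i * y ^ j) = c"
      by (simp add: ev_nf[OF scalar_hom_id])
    moreover have "(\<Sum>i<q. (if i = 0 then c else 0) * x ^ i) = c"
    proof -
      have "(\<Sum>i<q. (if i = 0 then c else 0) * x ^ i) = (\<Sum>i<q. if i = 0 then c else 0)"
        by (rule sum.cong) auto
      then show ?thesis by simp
    qed
    moreover have "(\<Sum>i<q. \<Sum>j<q^2. poly (a i j) z * x ^ i * y ^ j)
        = (\<Sum>i<q. (\<Sum>j<q^2. poly (a i j) z * y ^ j) * x ^ i)"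
      by (simp add: sum_distrib_left mult_ac)
    ultimately show "(\<Sum>i<q. ((\<Sum>j<q^2. poly (a i j) z * y ^ j) - (if i = 0 then c else 0)) * x ^ i) = 0"
      by (simp only: left_diff_distrib sum_subtractf) simp
  qed (simp add: card_root_q)
  have "poly (a i j) z - (if j = 0 then (if i = 0 then c else 0) else 0) = 0"
  proof (rule coefficients_vanish[OF finite_root_q2 _ _ ij(2),
        where b = "\<lambda>j. poly (a i j) z - (if j = 0 then (if i = 0 then c else 0) else 0)"])
    fix y assume "y \<in> ?Y"
    from X[OF this ij(1)]
    have "(\<Sum>j<q^2. poly (a i j) z * y ^ j) = (if i = 0 then c else 0)" by simp
    moreover have "(\<Sum>j<q^2. (if j = 0 then (if i = 0 then c else 0) else 0) * y ^ j) = (if i = 0 then c else 0)"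
    proof -
      have "(\<Sum>j<q^2. (if j = 0 then (if i = 0 then c else 0) else 0) * y ^ j)
          = (\<Sum>j<q^2. if j = 0 then (if i = 0 then c else 0) else 0)"
        by (rule sum.cong) auto
      then show ?thesis using q2 by simp
    qed
    ultimately show "(\<Sum>j<q^2. (poly (a i j) z - (if j = 0 then (if i = 0 then c else 0) else 0)) * y ^ j) = 0"
      by (simp add: left_diff_distrib sum_subtractf)
  qed (simp add: card_root_q2)
  then show ?thesis by (auto split: if_splits)
qed

end

context gk_field
begin

section \<open>Pole orders at infinity\<close>

text \<open>
  Generic points over the Laurent series field with the pole orders that \<open>x\<close>, \<open>y\<close> and \<open>z\<close> have at the
  point at infinity. A predicate is needed because translations produce further such points.
\<close>

definition pole_sol :: "'a fls \<Rightarrow> 'a fls \<Rightarrow> 'a fls \<Rightarrow> bool" where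
  "pole_sol x y z \<longleftrightarrow> gk_sol q x y z \<and> fls_subdegree x = - int (q ^ 3 + 1) \<and>
     fls_subdegree y = - int (q * (q^2 - q + 1)) \<and> fls_subdegree z = - int (q ^ 3)"

text \<open>
  Modulo \<open>q\<close> the weight determines \<open>i\<close>; then, as \<open>q\<^sup>2 - q + 1\<close> is prime to \<open>q\<close>, it determines \<open>j\<close>
  modulo \<open>q\<^sup>2\<close>.
\<close>

lemma weights_distinct:
  fixes i j k i' j' k' :: nat
  assumes "i < q" "i' < q" "j < q^2" "j' < q^2"
    and eq: "q ^ 3 * k + (q ^ 3 + 1) * i + q * (q^2 - q + 1) * j
      = q ^ 3 * k' + (q ^ 3 + 1) * i' + q * (q^2 - q + 1) * j'"
  shows "i = i' \<and> j = j'"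
proof -
  have e: "i + q * (q^2 * k + q^2 * i + (q^2 - q + 1) * j) = i' + q * (q^2 * k' + q^2 * i' + (q^2 - q + 1) * j')"
    using eq by (simp add: power3_eq_cube power2_eq_square algebra_simps)
  then have "(i + q * (q^2 * k + q^2 * i + (q^2 - q + 1) * j)) mod q
      = (i' + q * (q^2 * k' + q^2 * i' + (q^2 - q + 1) * j')) mod q" by simp
  then have i: "i = i'" using assms(1,2) by simp
  have "q^2 * k + q^2 * i + (q^2 - q + 1) * j = q^2 * k' + q^2 * i + (q^2 - q + 1) * j'"
    using e q_pos by (simp only: i add_left_cancel mult_cancel1) simp
  then have e2: "q^2 * (k + i) + (q^2 - q + 1) * j = q^2 * (k' + i) + (q^2 - q + 1) * j'"
    by (simp only: distrib_left)
  have "[(q^2 - q + 1) * j = (q^2 - q + 1) * j'] (mod q^2)"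
    using e2 unfolding cong_def by (metis mod_mult_self4)
  moreover have "coprime (q^2 - q + 1) (q^2)"
  proof -
    have "q^2 - q + 1 = q * (q - 1) + 1"
      by (simp add: power2_eq_square algebra_simps)
    moreover have "coprime (q * (q - 1) + 1) q"
    proof -
      have "gcd q ((q - 1) * q + 1) = gcd q 1" by (rule gcd_add_mult)
      also have "gcd q 1 = 1" by (rule gcd_1_nat)
      finally have "coprime q ((q - 1) * q + 1)" by (simp only: coprime_iff_gcd_eq_1)
      then show ?thesis by (metis coprime_commute mult.commute)
    qed
    ultimately show ?thesis by simp
  qed
  ultimately have "[j = j'] (mod q^2)"
    by (simp only: cong_mult_lcancel_nat)
  then have "j = j'" using assms(3,4) unfolding cong_def by (metis mod_less)
  with i show ?thesis by simp
qed

text \<open>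
  The terms of a normal form have pairwise different pole orders, so they cannot cancel, and the pole
  order of the sum is their maximum; this number does not depend on the chosen generic point.
\<close>

lemma nf_at_pole:
  assumes "i0 < q" "j0 < q^2" "a i0 j0 \<noteq> 0"
  shows "\<exists>s. \<forall>x y z. pole_sol x y z \<longrightarrow> ev fls_const (nf a) (pt4 x y z 1) \<noteq> 0 \<and>
    fls_subdegree (ev fls_const (nf a) (pt4 x y z 1)) = s"
proof -
  define A where "A = {(i, j). i < q \<and> j < q^2 \<and> a i j \<noteq> 0}"
  define w where "w = (\<lambda>(i, j). - int (q ^ 3 * degree (a i j) + (q ^ 3 + 1) * i + q * (q^2 - q + 1) * j))"
  have Asub: "A \<subseteq> {..<q} \<times> {..<q^2}" by (auto simp: A_def)
  then have A: "finite A" "A \<noteq> {}"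
    using assms by (auto intro: finite_subset simp: A_def)
  have inj: "inj_on w A"
  proof (rule inj_onI)
    fix u v assume "u \<in> A" "v \<in> A" "w u = w v"
    then show "u = v"
      using weights_distinct by (cases u; cases v) (auto simp: A_def w_def simp del: of_nat_add of_nat_mult of_nat_power)
  qed
  have "ev fls_const (nf a) (pt4 x y z 1) \<noteq> 0 \<and>
    fls_subdegree (ev fls_const (nf a) (pt4 x y z 1)) = Min (w ` A)" if pole: "pole_sol x y z" for x y z
  proof -
    interpret c: scalar_hom "fls_const :: 'a \<Rightarrow> 'a fls" by (rule scalar_hom_fls_const)
    define t where "t = (\<lambda>(i, j). pev fls_const (a i j) z * x ^ i * y ^ j)"
    have sub: "fls_subdegree x = - int (q ^ 3 + 1)" "fls_subdegree y = - int (q * (q^2 - q + 1))"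
      "fls_subdegree z = - int (q ^ 3)" using pole by (auto simp: pole_sol_def)
    have "fls_subdegree x < 0" "fls_subdegree y < 0" "fls_subdegree z < 0"
      unfolding sub by (simp_all del: of_nat_add of_nat_mult of_nat_power)
    then have nz: "x \<noteq> 0" "y \<noteq> 0" and z: "fls_subdegree z < 0" by auto
    have t: "t u \<noteq> 0 \<and> fls_subdegree (t u) = w u" if "u \<in> A" for u
    proof -
      obtain i j where u: "u = (i, j)" "a i j \<noteq> 0" using \<open>u \<in> A\<close> by (auto simp: A_def)
      have p: "pev fls_const (a i j) z \<noteq> 0"
        "fls_subdegree (pev fls_const (a i j) z) = int (degree (a i j)) * fls_subdegree z"
        using pev_fls_at_pole[OF z u(2)] by auto
      have "t u \<noteq> 0" using p(1) nz by (simp add: t_def u(1))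
      moreover have "fls_subdegree (t u) = w u"
        using p nz by (simp add: t_def u(1) w_def fls_subdegree_pow sub) (simp add: algebra_simps)
      ultimately show ?thesis by blast
    qed
    have "ev fls_const (nf a) (pt4 x y z 1) = (\<Sum>u\<in>{..<q} \<times> {..<q^2}. t u)"
      by (simp add: ev_nf[OF scalar_hom_fls_const] t_def sum.cartesian_product)
    also have "\<dots> = (\<Sum>u\<in>A. t u)"
      by (rule sum.mono_neutral_right) (use Asub in \<open>auto simp: A_def t_def\<close>)
    finally have eq: "ev fls_const (nf a) (pt4 x y z 1) = (\<Sum>u\<in>A. t u)" .
    have "inj_on (\<lambda>u. fls_subdegree (t u)) A"
      using inj t by (simp add: inj_on_def)
    from fls_subdegree_sum_distinct[OF A _ this] t
    show ?thesis unfolding eq by (simp cong: image_cong)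
  qed
  then show ?thesis by blast
qed

lemma pole_sol_translate:
  assumes "pole_sol x y z" "(b, g) \<in> gk_group"
  shows "pole_sol (x + fls_const (b ^ q) * y + fls_const g) (y + fls_const b) z"
proof -
  let ?n = "q^2 - q + 1"
  have sub: "fls_subdegree x = - int (q ^ 3 + 1)" "fls_subdegree y = - int (q * ?n)"
    using assms(1) by (auto simp: pole_sol_def)
  have n: "0 < q * ?n" by simp
  have "q * ?n < q ^ 3 + 1"
  proof -
    have "q \<le> q^2" using q_ge_2 by (simp add: power2_eq_square)
    then have "q^2 - q + 1 \<le> q^2" using q_pos(1) by linarith
    then have "q * ?n \<le> q * q^2" by (rule mult_left_mono) simp
    then show ?thesis by (simp add: power3_eq_cube power2_eq_square)
  qed
  then have lt: "fls_subdegree x < fls_subdegree y" "fls_subdegree y < 0"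
    unfolding sub using n by linarith+
  have nz: "x \<noteq> 0" "y \<noteq> 0" using lt by auto
  have y: "fls_subdegree (y + fls_const b) = fls_subdegree y"
    by (rule fls_subdegree_add_eq1[OF nz(2)]) (use lt in simp)
  have x1: "fls_subdegree (x + fls_const (b ^ q) * y) = fls_subdegree x"
  proof (cases "b = 0")
    case True
    then show ?thesis by (simp add: power_0_left)
  next
    case False
    show ?thesis by (rule fls_subdegree_add_eq1[OF nz(1)]) (use lt nz False in simp)
  qed
  have "x + fls_const (b ^ q) * y \<noteq> 0" using x1 lt by auto
  then have x: "fls_subdegree (x + fls_const (b ^ q) * y + fls_const g) = fls_subdegree x"
    using x1 lt by (subst fls_subdegree_add_eq1) auto
  have "gk_sol q (x + fls_const (b ^ q) * y + fls_const g) (y + fls_const b) z"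
    by (rule gk_sol_translate[OF scalar_hom_fls_const _ assms(2)]) (use assms(1) in \<open>auto simp: pole_sol_def\<close>)
  then show ?thesis
    using assms(1) x y by (simp add: pole_sol_def)
qed

lemma fls_subdegree_prod_idom:
  fixes f :: "'i \<Rightarrow> 'b::idom fls"
  assumes "\<And>x. x \<in> A \<Longrightarrow> f x \<noteq> 0"
  shows "fls_subdegree (\<Prod>x\<in>A. f x) = (\<Sum>x\<in>A. fls_subdegree (f x))"
  using assms by (induction A rule: infinite_finite_induct) auto

section \<open>The norm to the field of rational functions in \<open>z\<close>\<close>

definition gk_norm :: "'a poly4 \<Rightarrow> 'a poly4" where
  "gk_norm F = (\<Prod>(b, g)\<in>gk_group. ev const4 F
     (pt4 (var4 1 + const4 (b ^ q) * var4 2 + const4 g) (var4 2 + const4 b) (var4 3) 1))"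

lemma ev_gk_norm:
  fixes h :: "'a \<Rightarrow> 'b::comm_ring_1"
  assumes "scalar_hom h"
  shows "ev h (gk_norm F) (pt4 x y z t) =
    (\<Prod>(b, g)\<in>gk_group. ev h F (pt4 (x + h (b ^ q) * y + h g) (y + h b) z 1))"
proof -
  interpret h: scalar_hom h by fact
  note hom = h.scalar_hom_ev[of "pt4 x y z t"]
  have subst: "ev h (ev const4 F (pt4 A B D E)) (pt4 x y z t) = ev h F (pt4 (ev h A (pt4 x y z t))
      (ev h B (pt4 x y z t)) (ev h D (pt4 x y z t)) (ev h E (pt4 x y z t)))" for A B D E
  proof -
    have "(\<lambda>i. ev h (pt4 A B D E i) (pt4 x y z t)) = pt4 (ev h A (pt4 x y z t))
      (ev h B (pt4 x y z t)) (ev h D (pt4 x y z t)) (ev h E (pt4 x y z t))"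
      by (auto simp: pt4_def)
    then show ?thesis by (simp add: scalar_hom.hom_ev[OF scalar_hom_const4 hom])
  qed
  show ?thesis
    unfolding gk_norm_def h.ev_homs
    by (intro prod.cong refl) (auto simp: subst h.ev_homs)
qed

lemma norm_at_solution:
  fixes h :: "'a \<Rightarrow> 'b::comm_ring_1"
  assumes "scalar_hom h" "gk_cong (gk_norm F) (nf_term N 0 0)" "gk_sol q x y z"
  shows "pev h N z = (\<Prod>(b, g)\<in>gk_group. ev h F (pt4 (x + h (b ^ q) * y + h g) (y + h b) z 1))"
proof -
  interpret h: scalar_hom h by fact
  note hom = h.scalar_hom_ev[of "pt4 x y z 1"]
  have "pev h N z = ev h (nf_term N 0 0) (pt4 x y z 1)"
    using scalar_hom.hom_pev[OF scalar_hom_const4 hom, of N "var4 3"] by (simp add: nf_term_def)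
  then show ?thesis
    using gk_cong_ev[OF assms] by (simp add: ev_gk_norm[OF assms(1)])
qed

text \<open>
  The value of the norm at a point is the product of the values of \<open>F\<close> over the whole fibre, hence
  constant on fibres; a normal form with this property involves \<open>z\<close> only.
\<close>

lemma gk_norm_poly:
  obtains N where "gk_cong (gk_norm F) (nf_term N 0 0)"
    "\<And>x y z. gk_sol q x y z \<Longrightarrow> poly N z = (\<Prod>(x', y')\<in>gk_fibre z. ev (\<lambda>a. a) F (pt4 x' y' z 1))"
proof -
  obtain a where a: "gk_cong (gk_norm F) (nf a)" using normal_form_exists by blast
  have val: "ev (\<lambda>a. a) (nf a) (pt4 x y z 1) = (\<Prod>(x', y')\<in>gk_fibre z. ev (\<lambda>a. a) F (pt4 x' y' z 1))"
    if sol: "gk_sol q x y z" for x y z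
  proof -
    have "ev (\<lambda>a. a) (nf a) (pt4 x y z 1) = ev (\<lambda>a. a) (gk_norm F) (pt4 x y z 1)"
      using gk_cong_ev[OF scalar_hom_id a sol] by simp
    also have "\<dots> = (\<Prod>u\<in>gk_group. (\<lambda>(x', y'). ev (\<lambda>a. a) F (pt4 x' y' z 1))
        ((\<lambda>(b, g). (x + b ^ q * y + g, y + b)) u))"
      unfolding ev_gk_norm[OF scalar_hom_id] by (intro prod.cong refl) auto
    also have "\<dots> = (\<Prod>u\<in>gk_fibre z. (\<lambda>(x', y'). ev (\<lambda>a. a) F (pt4 x' y' z 1)) u)"
      by (rule prod.reindex_bij_betw[OF gk_group_fibre]) (use sol in \<open>simp add: gk_fibre_def\<close>)
    finally show ?thesis .
  qed
  have coeff: "poly (a i j) z = (if i = 0 \<and> j = 0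
      then \<Prod>(x', y')\<in>gk_fibre z. ev (\<lambda>a. a) F (pt4 x' y' z 1) else 0)" if "i < q" "j < q^2" for i j z
    by (rule normal_form_constant_on_fibre[OF _ that]) (rule val)
  have z: "a i j = 0" if "i < q" "j < q^2" "(i, j) \<noteq> (0, 0)" for i j
    by (rule poly_eq_0_if_all_roots) (use coeff[OF that(1,2)] that(3) in auto)
  have "nf a = (\<Sum>i<q. \<Sum>j<q^2. if i = 0 \<and> j = 0 then nf_term (a 0 0) 0 0 else 0)"
    unfolding nf_def by (intro sum.cong refl) (auto simp: z nf_term_def pev_def)
  also have "\<dots> = (\<Sum>i<q. if i = 0 then nf_term (a 0 0) 0 0 else 0)"
    by (intro sum.cong refl) auto
  also have "\<dots> = nf_term (a 0 0) 0 0" by simp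
  finally have "gk_cong (gk_norm F) (nf_term (a 0 0) 0 0)" using a by simp
  then show thesis
    using that coeff[of 0 0] by simp
qed

text \<open>
  Unless the normal form of \<open>F\<close> is zero, the conjugates of \<open>F\<close> all have the same pole order at
  infinity, because translations do not change the pole orders of \<open>x\<close> and \<open>y\<close>. There are \<open>q\<^sup>3\<close>
  conjugates and \<open>z\<close> has pole order \<open>q\<^sup>3\<close>, so that common pole order is the degree of the norm.
\<close>

theorem vanishing_or_norm:
  assumes pole: "pole_sol xi yi zi"
  shows "gk_cong F 0 \<or> (\<exists>N. N \<noteq> 0 \<and> gk_cong (gk_norm F) (nf_term N 0 0) \<and>
    ev fls_const F (pt4 xi yi zi 1) \<noteq> 0 \<and>
    fls_subdegree (ev fls_const F (pt4 xi yi zi 1)) = - int (degree N))"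
proof -
  interpret c: scalar_hom "fls_const :: 'a \<Rightarrow> 'a fls" by (rule scalar_hom_fls_const)
  obtain a where a: "gk_cong F (nf a)" using normal_form_exists by blast
  show ?thesis
  proof (cases "\<exists>i<q. \<exists>j<q^2. a i j \<noteq> 0")
    case False
    then have "nf a = 0" by (auto simp: nf_def nf_term_def pev_def intro!: sum.neutral)
    then show ?thesis using a by simp
  next
    case True
    then obtain s where "\<And>x y z. pole_sol x y z \<Longrightarrow> ev fls_const (nf a) (pt4 x y z 1) \<noteq> 0 \<and>
        fls_subdegree (ev fls_const (nf a) (pt4 x y z 1)) = s"
      using nf_at_pole by meson
    then have s: "ev fls_const F (pt4 x y z 1) \<noteq> 0" "fls_subdegree (ev fls_const F (pt4 x y z 1)) = s"
      if "pole_sol x y z" for x y z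
      using gk_cong_ev[OF scalar_hom_fls_const a, of x y z] that by (auto simp: pole_sol_def)
    obtain N where N: "gk_cong (gk_norm F) (nf_term N 0 0)" by (rule gk_norm_poly)
    have soli: "gk_sol q xi yi zi" and zi: "fls_subdegree zi = - int (q ^ 3)"
      using pole by (auto simp: pole_sol_def)
    have eq: "pev fls_const N zi = (\<Prod>u\<in>gk_group. case u of (b, g) \<Rightarrow>
        ev fls_const F (pt4 (xi + fls_const (b ^ q) * yi + fls_const g) (yi + fls_const b) zi 1))"
      by (rule norm_at_solution[OF scalar_hom_fls_const N soli])
    have conj: "(case u of (b, g) \<Rightarrow>
        ev fls_const F (pt4 (xi + fls_const (b ^ q) * yi + fls_const g) (yi + fls_const b) zi 1)) \<noteq> 0"
      "fls_subdegree (case u of (b, g) \<Rightarrow>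
        ev fls_const F (pt4 (xi + fls_const (b ^ q) * yi + fls_const g) (yi + fls_const b) zi 1)) = s"
      if "u \<in> gk_group" for u
      using s[OF pole_sol_translate[OF pole, of "fst u" "snd u"]] that by (auto split: prod.split)
    have nz: "pev fls_const N zi \<noteq> 0"
      unfolding eq using conj(1) gk_group_card(1) by (simp add: prod_zero_iff)
    then have Nnz: "N \<noteq> 0" by auto
    have "fls_subdegree (pev fls_const N zi) = (\<Sum>u\<in>gk_group. s)"
      unfolding eq using conj by (simp add: fls_subdegree_prod_idom cong: sum.cong)
    then have "fls_subdegree (pev fls_const N zi) = int (q ^ 3) * s"
      by (simp add: gk_group_card(2))
    moreover have "fls_subdegree (pev fls_const N zi) = int (degree N) * - int (q ^ 3)"
      using pev_fls_at_pole[of zi N] Nnz zi by simp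
    ultimately have "int (q ^ 3) * (s + int (degree N)) = 0" by (simp add: algebra_simps)
    then have "s = - int (degree N)" by simp
    then show ?thesis using N Nnz s[OF pole] by blast
  qed
qed

end

section \<open>Power series solutions\<close>

text \<open>
  The implicit function theorem for an equation \<open>\<phi>(e) = d\<close>: compose the compositional inverse of \<open>\<phi>\<close>
  with \<open>d\<close>.
\<close>

lemma fps_solve:
  fixes \<phi> d :: "'a::field fps"
  assumes "fps_nth \<phi> 0 = 0" "fps_nth \<phi> 1 \<noteq> 0" "fps_nth d 0 = 0"
  shows "\<exists>e. fps_nth e 0 = 0 \<and> fps_compose \<phi> e = d"
proof -
  define e where "e = fps_compose (fps_inv \<phi>) d"
  have i0: "fps_nth (fps_inv \<phi>) 0 = 0" by (simp add: fps_inv_def)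
  have "fps_compose \<phi> e = fps_compose (fps_compose \<phi> (fps_inv \<phi>)) d"
    unfolding e_def by (rule fps_compose_assoc[OF assms(3) i0])
  also have "\<dots> = d" using assms by (simp add: fps_inv_right)
  finally show ?thesis using i0 by (intro exI[of _ e]) (simp add: e_def)
qed

context gk_field
begin

text \<open>
  In \<open>y = y\<^sub>0 + e\<close> the second equation becomes additive in \<open>e\<close> with linear coefficient \<open>-1\<close>, and similarly
  for \<open>x\<close>; so the curve is parametrised by \<open>z - a\<close> near every point above \<open>a\<close>.
\<close>

lemma affine_branch_exists:
  fixes x0 y0 a :: 'a
  assumes "gk_sol q x0 y0 a"
  shows "\<exists>x y. gk_sol q x y (fps_const a + fps_X) \<and> fps_nth x 0 = x0 \<and> fps_nth y 0 = y0"
proof -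
  let ?z = "fps_const a + fps_X :: 'a fps" and ?n = "q^2 - q + 1"
  have y0: "a ^ ?n = y0 ^ (q^2) - y0" and x0: "y0 ^ (q + 1) = x0 ^ q + x0"
    using assms by (simp_all add: gk_sol_def)
  have char: "CHAR('a fps) = CHAR('a)" by simp
  have q1: "q > 1" "q^2 > 1" using q_ge_2 q2_gt_1 by auto
  obtain e :: "'a fps" where e: "fps_nth e 0 = 0" "fps_compose (fps_X ^ (q^2) - fps_X) e = ?z ^ ?n - fps_const (a ^ ?n)"
    using fps_solve[of "fps_X ^ (q^2) - fps_X" "?z ^ ?n - fps_const (a ^ ?n)"] q1
    by (auto simp: fps_X_power_nth fps_nth_power_0)
  have "fps_compose (fps_X ^ (q^2) - fps_X) e = e ^ (q^2) - e"
    using e(1) by (simp add: fps_compose_sub_distrib fps_compose_power[symmetric])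
  with e(2) have e2: "e ^ (q^2) - e = ?z ^ ?n - fps_const (a ^ ?n)" by simp
  define y where "y = fps_const y0 + e"
  have "y ^ (q^2) - y = fps_const (y0 ^ (q^2) - y0) + (e ^ (q^2) - e)"
    unfolding y_def frob2_add[OF char] fps_const_power fps_const_sub[symmetric] by (simp add: algebra_simps)
  then have y: "?z ^ ?n = y ^ (q^2) - y" unfolding e2 y0[symmetric] by simp
  have y00: "fps_nth y 0 = y0" using e(1) by (simp add: y_def)
  obtain f :: "'a fps" where f: "fps_nth f 0 = 0" "fps_compose (fps_X ^ q + fps_X) f = y ^ (q + 1) - fps_const (y0 ^ (q + 1))"
    using fps_solve[of "fps_X ^ q + fps_X" "y ^ (q + 1) - fps_const (y0 ^ (q + 1))"] q1 y00
    by (auto simp: fps_X_power_nth fps_nth_power_0)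
  have "fps_compose (fps_X ^ q + fps_X) f = f ^ q + f"
    using f(1) by (simp add: fps_compose_add_distrib fps_compose_power[symmetric])
  with f(2) have f2: "f ^ q + f = y ^ (q + 1) - fps_const (y0 ^ (q + 1))" by simp
  define x where "x = fps_const x0 + f"
  have "x ^ q + x = fps_const (x0 ^ q + x0) + (f ^ q + f)"
    unfolding x_def frob_add[OF char] fps_const_power fps_const_add[symmetric] by (simp add: algebra_simps)
  then have "y ^ (q + 1) = x ^ q + x" unfolding f2 x0[symmetric] by simp
  then have "gk_sol q x y ?z" using y by (simp add: gk_sol_def)
  moreover have "fps_nth x 0 = x0" using f(1) by (simp add: x_def)
  ultimately show ?thesis using y00 by blast
qed

lemma frobenius_fixed_fps:
  fixes d :: "'a fps"
  assumes "d ^ k = d \<or> d ^ k = - d" "k > 1" "fps_nth d 0 = 0"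
  shows "d = 0"
proof (rule ccontr)
  assume "d \<noteq> 0"
  have "subdegree (d ^ k) = subdegree d" using assms(1) by (metis subdegree_uminus)
  then have "k * subdegree d = subdegree d" by simp
  then have "subdegree d = 0" using assms(2) by simp
  then show False using \<open>d \<noteq> 0\<close> assms(3) by (simp add: subdegree_eq_0_iff)
qed

text \<open>
  By additivity the difference of two solutions is fixed up to sign by a power of the Frobenius map,
  which multiplies orders; a series without constant term can only be zero then.
\<close>

lemma affine_branch_unique:
  fixes x y x' y' z :: "'a fps"
  assumes "gk_sol q x y z" "gk_sol q x' y' z" "fps_nth x 0 = fps_nth x' 0" "fps_nth y 0 = fps_nth y' 0"
  shows "x = x'" "y = y'"
proof -
  have char: "CHAR('a fps) = CHAR('a)" by simp
  have "y ^ (q^2) - y = y' ^ (q^2) - y'" using assms(1,2) by (simp add: gk_sol_def)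
  then have "(y - y') ^ (q^2) = y - y'"
    unfolding frob2_diff[OF char] by (simp add: algebra_simps)
  then have "y - y' = 0" using assms(4) q2_gt_1 by (intro frobenius_fixed_fps[of _ "q^2"]) auto
  then show y: "y = y'" by simp
  have "x ^ q + x = x' ^ q + x'" using assms(1,2) unfolding gk_sol_def y by metis
  then have "(x - x') ^ q = - (x - x')"
    unfolding frob_diff[OF char] by (simp add: algebra_simps)
  then have "x - x' = 0" using assms(3) q_ge_2 by (intro frobenius_fixed_fps[of _ q]) auto
  then show "x = x'" by simp
qed

text \<open>
  Homogeneous coordinates \<open>(1 : v : t : u)\<close> of a generic point near infinity, with \<open>t = z/x\<close> as
  parameter, \<open>v = y/x\<close> and \<open>u = 1/x\<close>.
\<close>

definition infinity_branch :: "'a fps \<Rightarrow> 'a fps \<Rightarrow> bool" where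
  "infinity_branch v u \<longleftrightarrow> fps_nth v 0 = 0 \<and> fps_nth u 0 = 0 \<and> v ^ (q + 1) = u ^ q + u \<and>
     v * ((1 + u ^ (q - 1)) ^ (q - 1) - u ^ (q * (q - 1))) = fps_X ^ (q^2 - q + 1)"

text \<open>
  The first equation gives \<open>u\<close> as a series \<open>U\<close> in \<open>v\<close>; inserting it into the second leaves a series of
  order one in \<open>v\<close> that has to equal \<open>t\<^sup>n\<close>.
\<close>

lemma infinity_branch_exists: "\<exists>v u. infinity_branch v u"
proof -
  let ?n = "q^2 - q + 1"
  have q1: "q > 1" "q - 1 > 0" using q_ge_2 by auto
  obtain U :: "'a fps" where U: "fps_nth U 0 = 0" "fps_compose (fps_X ^ q + fps_X) U = fps_X ^ (q + 1)"
    using fps_solve[of "fps_X ^ q + fps_X" "fps_X ^ (q + 1)"] q1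
    by (auto simp: fps_X_power_nth)
  have "fps_compose (fps_X ^ q + fps_X) U = U ^ q + U"
    using U(1) by (simp add: fps_compose_add_distrib fps_compose_power[symmetric])
  with U(2) have U2: "U ^ q + U = fps_X ^ (q + 1)" by simp
  let ?E = "(1 + U ^ (q - 1)) ^ (q - 1) - U ^ (q * (q - 1))"
  have E0: "fps_nth ?E 0 = 1" using U(1) q1 by (simp add: fps_nth_power_0 power_0_left)
  have "fps_nth (fps_X * ?E) 1 = 1" using E0 by (simp only: fps_X_mult_nth) simp
  then obtain v :: "'a fps" where v: "fps_nth v 0 = 0" "fps_compose (fps_X * ?E) v = fps_X ^ ?n"
    using fps_solve[of "fps_X * ?E" "fps_X ^ ?n"] by (auto simp: fps_X_power_nth)
  define u where "u = fps_compose U v"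
  have p: "fps_compose (f ^ k) v = fps_compose f v ^ k" for f :: "'a fps" and k
    by (rule fps_compose_power[OF v(1), symmetric])
  have "fps_compose (fps_X * ?E) v = v * ((1 + u ^ (q - 1)) ^ (q - 1) - u ^ (q * (q - 1)))"
    using v(1) by (simp add: fps_compose_mult_distrib fps_compose_sub_distrib fps_compose_add_distrib p u_def)
  moreover have "fps_compose (U ^ q + U) v = u ^ q + u"
    by (simp add: fps_compose_add_distrib p u_def)
  moreover have "fps_compose (fps_X ^ (q + 1)) v = v ^ (q + 1)" using v(1) by (simp only: p fps_X_fps_compose_startby0)
  moreover have "fps_nth u 0 = 0" using U(1) by (simp add: u_def)
  ultimately show ?thesis using v U2 unfolding infinity_branch_def by metis
qed

lemma q_times_n: "(q + 1) * (q^2 - q + 1) = q ^ 3 + 1"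
proof -
  obtain r where "q = Suc r" using q_pos(1) gr0_implies_Suc by blast
  then show ?thesis by (simp add: power2_eq_square power3_eq_cube algebra_simps)
qed

lemma infinity_branch_subdegree:
  assumes "infinity_branch v u"
  shows "v \<noteq> 0" "u \<noteq> 0" "subdegree v = q^2 - q + 1" "subdegree u = q ^ 3 + 1"
proof -
  have q1: "q > 1" "q - 1 > 0" using q_ge_2 by auto
  let ?E = "(1 + u ^ (q - 1)) ^ (q - 1) - u ^ (q * (q - 1))"
  have 0: "fps_nth v 0 = 0" "fps_nth u 0 = 0" "v ^ (q + 1) = u ^ q + u" "v * ?E = fps_X ^ (q^2 - q + 1)"
    using assms by (simp_all add: infinity_branch_def)
  have E0: "fps_nth ?E 0 = 1" using 0(2) q1 by (simp add: fps_nth_power_0 power_0_left)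
  have "subdegree ?E = 0" by (rule subdegree_eq_0) (simp only: E0 one_neq_zero not_False_eq_True)
  moreover have "?E \<noteq> 0" using E0 by (metis fps_zero_nth zero_neq_one)
  moreover show v: "v \<noteq> 0" using 0(4) by auto
  ultimately have "subdegree v = subdegree (v * ?E)" by simp
  then show sv: "subdegree v = q^2 - q + 1" unfolding 0(4) by (simp add: fps_X_power_subdegree)
  have vu: "u * (1 + u ^ (q - 1)) = v ^ (q + 1)"
    unfolding 0(3) using q1 by (simp add: distrib_left flip: power_Suc)
  have "fps_nth (1 + u ^ (q - 1)) 0 = 1" using 0(2) q1 by (simp add: fps_nth_power_0 power_0_left)
  then have F: "subdegree (1 + u ^ (q - 1)) = 0" "1 + u ^ (q - 1) \<noteq> 0"
    by (metis subdegree_eq_0 zero_neq_one) (metis \<open>fps_nth (1 + u ^ (q - 1)) 0 = 1\<close> fps_zero_nth zero_neq_one)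
  moreover show u: "u \<noteq> 0" using 0(3) v q1 by (auto simp: power_0_left)
  ultimately have "subdegree u = subdegree (u * (1 + u ^ (q - 1)))" by simp
  then show "subdegree u = q ^ 3 + 1"
    unfolding vu subdegree_power sv q_times_n .
qed

text \<open>
  The second equation may be replaced by \<open>z\<^sup>n = y ((x\<^sup>q + x)\<^bsup>q-1\<^esup> - 1)\<close>, because the power of \<open>y\<close> with
  exponent \<open>q\<^sup>2 = 1 + (q + 1)(q - 1)\<close> equals \<open>y (x\<^sup>q + x)\<^bsup>q-1\<^esup>\<close>. In this shape both sides have degree \<open>n\<close>, so
  homogenising introduces no factor that vanishes at infinity.
\<close>

lemma gk_sol_alt:
  fixes x y z :: "'b::comm_ring_1"
  shows "gk_sol q x y z \<longleftrightarrow> y ^ (q + 1) = x ^ q + x \<and>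
    z ^ (q^2 - q + 1) = y * ((x ^ q + x) ^ (q - 1) - 1)"
proof -
  obtain r where r: "q = Suc r" using q_pos(1) gr0_implies_Suc by blast
  have "1 + (q + 1) * (q - 1) = q^2" by (simp add: r power2_eq_square algebra_simps)
  then have "y ^ (q^2) = y * (y ^ (q + 1)) ^ (q - 1)"
    by (metis power_add power_mult power_one_right)
  then have "y ^ (q + 1) = x ^ q + x \<Longrightarrow> y ^ (q^2) - y = y * ((x ^ q + x) ^ (q - 1) - 1)"
    by (simp only: right_diff_distrib mult_1_right)
  then show ?thesis unfolding gk_sol_def by metis
qed

lemma pole_sol_infinity_branch:
  assumes "infinity_branch v u"
  shows "pole_sol (1 / fps_to_fls u) (fps_to_fls v / fps_to_fls u) (fls_X / fps_to_fls u)"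
proof -
  let ?u = "fps_to_fls u" and ?v = "fps_to_fls v" and ?n = "q^2 - q + 1"
  note s = infinity_branch_subdegree[OF assms]
  have nz: "?u \<noteq> 0" "?v \<noteq> 0" using s(1,2) by simp_all
  have "fps_to_fls (v ^ (q + 1)) = fps_to_fls (u ^ q + u)"
    "fps_to_fls (v * ((1 + u ^ (q - 1)) ^ (q - 1) - u ^ (q * (q - 1)))) = fps_to_fls (fps_X ^ ?n)"
    using assms unfolding infinity_branch_def by metis+
  then have e: "?v ^ (q + 1) = ?u ^ q + ?u"
    "?v * ((1 + ?u ^ (q - 1)) ^ (q - 1) - ?u ^ (q * (q - 1))) = fls_X ^ ?n"
    by (simp_all only: fps_to_fls_power fps_to_fls_plus fps_to_fls_minus fls_times_fps_to_fls
        fps_to_fls_eq_1_iff fps_one_to_fls fps_X_to_fls)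
  have 1: "(?v / ?u) ^ (q + 1) = (1 / ?u) ^ q + 1 / ?u"
    unfolding power_divide e(1) using nz by (simp add: field_simps)
  obtain r where r: "q = Suc r" using q_pos(1) gr0_implies_Suc by blast
  have n: "?n = Suc (q * (q - 1))" by (simp add: r power2_eq_square algebra_simps)
  have "?u ^ q * ((1 / ?u) ^ q + 1 / ?u) = 1 + ?u ^ (q - 1)"
    using nz by (simp add: r field_simps)
  then have "(1 + ?u ^ (q - 1)) ^ (q - 1) = ?u ^ (q * (q - 1)) * ((1 / ?u) ^ q + 1 / ?u) ^ (q - 1)"
    by (metis power_mult power_mult_distrib)
  then have "fls_X ^ ?n = ?v * (?u ^ (q * (q - 1)) * (((1 / ?u) ^ q + 1 / ?u) ^ (q - 1) - 1))"
    unfolding e(2)[symmetric] by (simp add: algebra_simps)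
  then have "fls_X ^ ?n / ?u ^ ?n = ?v / ?u * (((1 / ?u) ^ q + 1 / ?u) ^ (q - 1) - 1)"
    unfolding n power_Suc using nz by simp
  then have 2: "(fls_X / ?u) ^ ?n = ?v / ?u * (((1 / ?u) ^ q + 1 / ?u) ^ (q - 1) - 1)"
    unfolding power_divide .
  have "gk_sol q (1 / ?u) (?v / ?u) (fls_X / ?u)"
    unfolding gk_sol_alt using 1 2 by blast
  moreover have "int ?n - int (q ^ 3 + 1) = - int (q * ?n)"
    unfolding q_times_n[symmetric] distrib_right of_nat_add mult_1 by simp
  ultimately show ?thesis
    using nz s(3,4) by (simp add: pole_sol_def fls_divide_subdegree fls_subdegree_fls_to_fps)
qed

end

lemma branch_ring_cancel_unit:
  assumes "f * e = t * h" "e \<in> branch_ring \<xi>" "fps_nth e 0 \<noteq> 0" "h \<in> branch_ring \<xi>"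
  shows "\<exists>h\<in>branch_ring \<xi>. f = t * h"
proof -
  have "e * inverse e = 1" using assms(3) by (simp add: inverse_mult_eq_1')
  then have "f = t * (h * inverse e)" using assms(1) by (metis mult.assoc mult.right_neutral)
  then show ?thesis using branch_ring_mult[OF assms(4) branch_ring_inverse[OF assms(2,3)]] by blast
qed

lemma branch_ring_power_diff:
  assumes "f - c = t * h" "f \<in> branch_ring \<xi>" "c \<in> branch_ring \<xi>" "h \<in> branch_ring \<xi>"
  shows "\<exists>h\<in>branch_ring \<xi>. f ^ k - c ^ k = t * h"
proof (induction k)
  case 0
  then show ?case using branch_ring_const[of 0 \<xi>] by (intro bexI[of _ 0]) auto
next
  case (Suc k)
  then obtain g where g: "g \<in> branch_ring \<xi>" "f ^ k - c ^ k = t * g" by blast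
  have "f ^ Suc k - c ^ Suc k = f * (f ^ k - c ^ k) + (f - c) * c ^ k"
    by (simp add: algebra_simps)
  also have "\<dots> = t * (f * g + h * c ^ k)" unfolding g(2) assms(1) by (simp add: algebra_simps)
  finally show ?case
    using assms g by (intro bexI[of _ "f * g + h * c ^ k"] branch_ring_add branch_ring_mult branch_ring_power) auto
qed

lemma vector_pt4: "(\<lambda>i. (vector [x, y, z, t] :: 'a::zero ^ 4) $ i) = pt4 x y z t"
proof
  fix i :: 4
  have "i = 1 \<or> i = 2 \<or> i = 3 \<or> i = 4" by (rule exhaust_4)
  then show "(vector [x, y, z, t] :: 'a ^ 4) $ i = pt4 x y z t i"
    by (auto simp: vector_def)
qed

lemma vector4_nth [simp]:
  fixes x y z t :: "'a::zero"
  shows "(vector [x, y, z, t] :: 'a ^ 4) $ 1 = x" "(vector [x, y, z, t] :: 'a ^ 4) $ 2 = y"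
  "(vector [x, y, z, t] :: 'a ^ 4) $ 3 = z" "(vector [x, y, z, t] :: 'a ^ 4) $ 4 = t"
  using fun_cong[OF vector_pt4[of x y z t]] by simp_all

definition affine_point :: "'a::field \<Rightarrow> 'a \<Rightarrow> 'a \<Rightarrow> 'a point3" where
  "affine_point x y z = proj_point (vector [x, y, z, 1])"

lemma affine_point_eq_iff [simp]:
  "affine_point x y z = affine_point x' y' z' \<longleftrightarrow> x = x' \<and> y = y' \<and> z = z'"
proof
  assume "affine_point x y z = affine_point x' y' z'"
  then have "vector [x, y, z, 1] \<in> proj_point (vector [x', y', z', 1])"
    using proj_point_self unfolding affine_point_def by metis
  then obtain a where a: "vector [x, y, z, 1] = a *s (vector [x', y', z', 1] :: 'a ^ 4)"
    by (auto simp: proj_point_def)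
  have c: "(vector [x, y, z, 1] :: 'a ^ 4) $ i = a * (vector [x', y', z', 1] :: 'a ^ 4) $ i" for i
    unfolding a by simp
  show "x = x' \<and> y = y' \<and> z = z'"
    using c[of 1] c[of 2] c[of 3] c[of 4] by simp
qed simp

lemma affine_point_neq_infinity [simp]: "affine_point x y z \<noteq> P_infinity"
proof
  assume "affine_point x y z = P_infinity"
  then have "vector [x, y, z, 1] \<in> proj_point (vector [1, 0, 0, 0] :: 'a ^ 4)"
    using proj_point_self unfolding affine_point_def P_infinity_def by metis
  then obtain a where a: "vector [x, y, z, 1] = a *s (vector [1, 0, 0, 0] :: 'a ^ 4)"
    by (auto simp: proj_point_def)
  have "(vector [x, y, z, 1] :: 'a ^ 4) $ 4 = 0" unfolding a by simp
  then show False by simp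
qed

lemma affine_point_in_PG3: "affine_point x y z \<in> PG3"
proof -
  have "(vector [x, y, z, 1] :: 'a ^ 4) $ 4 \<noteq> 0" by simp
  then have "(vector [x, y, z, 1] :: 'a ^ 4) \<noteq> 0" by (metis zero_index)
  then show ?thesis by (auto simp: affine_point_def PG3_def)
qed

lemma P_infinity_in_PG3: "P_infinity \<in> PG3"
proof -
  have "(vector [1, 0, 0, 0] :: 'a ^ 4) $ 1 \<noteq> 0" by simp
  then have "(vector [1, 0, 0, 0] :: 'a ^ 4) \<noteq> 0" by (metis zero_index)
  then show ?thesis by (auto simp: P_infinity_def PG3_def)
qed

lemma vanishes_at_affine_point:
  "form d F \<Longrightarrow> vanishes_at F (affine_point x y z) \<longleftrightarrow> ev (\<lambda>a. a) F (pt4 x y z 1) = 0"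
  by (simp add: affine_point_def vanishes_at_proj_point eval4_eq_ev vector_pt4)

lemma vanishes_at_infinity:
  "form d F \<Longrightarrow> vanishes_at F P_infinity \<longleftrightarrow> ev (\<lambda>a. a) F (pt4 1 0 0 0) = 0"
  by (simp add: P_infinity_def vanishes_at_proj_point eval4_eq_ev vector_pt4)

context gk_field
begin

section \<open>The points of the curve and its branches\<close>

lemma affine_point_in_curve: "gk_sol q x y z \<Longrightarrow> affine_point x y z \<in> GK_curve q"
  unfolding GK_curve_def projective_closure_def
  using affine_point_in_PG3[of x y z] by (force simp: gk_sol_def affine_point_def)

lemma vanishes_on_curve_iff:
  assumes "form d F"
  shows "(\<forall>Q\<in>GK_curve q. vanishes_at F Q) \<longleftrightarrow>
    (\<forall>x y z::'a. gk_sol q x y z \<longrightarrow> ev (\<lambda>a. a) F (pt4 x y z 1) = 0)"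
proof
  assume "\<forall>Q\<in>GK_curve q. vanishes_at F Q"
  then show "\<forall>x y z::'a. gk_sol q x y z \<longrightarrow> ev (\<lambda>a. a) F (pt4 x y z 1) = 0"
    using affine_point_in_curve vanishes_at_affine_point[OF assms] by blast
next
  assume *: "\<forall>x y z::'a. gk_sol q x y z \<longrightarrow> ev (\<lambda>a. a) F (pt4 x y z 1) = 0"
  have "vanishes_at F (proj_point (vector [x, y, z, 1]))"
    if "y ^ (q + 1) = x ^ q + x" "z ^ (q^2 - q + 1) = y ^ (q^2) - y" for x y z :: 'a
    using * that vanishes_at_affine_point[OF assms, of x y z]
    by (simp add: gk_sol_def affine_point_def)
  then show "\<forall>Q\<in>GK_curve q. vanishes_at F Q"
    unfolding GK_curve_def projective_closure_def using assms by blast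
qed

lemma pole_sol_exists: "\<exists>x y z. pole_sol x y z"
  using infinity_branch_exists pole_sol_infinity_branch by blast

text \<open>
  A polynomial outside the ideal has a non-zero norm, and the norm would be zero at a point whose
  \<open>z\<close>-coordinate is not one of its roots.
\<close>

lemma vanishes_on_solutions_iff:
  "(\<forall>x y z::'a. gk_sol q x y z \<longrightarrow> ev (\<lambda>a. a) F (pt4 x y z 1) = 0) \<longleftrightarrow> gk_cong F 0"
proof
  assume "gk_cong F 0"
  then show "\<forall>x y z::'a. gk_sol q x y z \<longrightarrow> ev (\<lambda>a. a) F (pt4 x y z 1) = 0"
    using gk_cong_ev[OF scalar_hom_id, of F 0] by (simp add: scalar_hom.ev_zero[OF scalar_hom_id])
next
  assume *: "\<forall>x y z::'a. gk_sol q x y z \<longrightarrow> ev (\<lambda>a. a) F (pt4 x y z 1) = 0"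
  show "gk_cong F 0"
  proof (rule ccontr)
    assume "\<not> gk_cong F 0"
    then obtain N where N: "N \<noteq> 0" "gk_cong (gk_norm F) (nf_term N 0 0)"
      using pole_sol_exists vanishing_or_norm by blast
    obtain z where z: "poly N z \<noteq> 0" using poly_eq_0_if_all_roots N(1) by blast
    have "gk_fibre z \<noteq> {}" using gk_fibre_card[of z] q_pos by (metis card.empty power_not_zero)
    then obtain x y where sol: "gk_sol q x y z" by (auto simp: gk_fibre_def)
    have "poly N z = 0"
      unfolding pev_id[symmetric] norm_at_solution[OF scalar_hom_id N(2) sol]
    proof (rule prod_zero[OF gk_group_card(1)], rule bexI)
      show "(0, 0) \<in> gk_group" by (simp add: gk_group_def)
    qed (use * sol in \<open>simp add: power_0_left\<close>)
    then show False using z by simp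
  qed
qed

lemma gk_cong_0_ev: "scalar_hom h \<Longrightarrow> gk_sol q x y z \<Longrightarrow> gk_cong F 0 \<Longrightarrow> ev h F (pt4 x y z 1) = 0"
  using gk_cong_ev[of h F 0 x y z] by (simp add: scalar_hom.ev_zero)

text \<open>
  The curve is irreducible: vanishing along one branch makes the norm zero, hence forces membership
  in the ideal.
\<close>

lemma affine_branch_vanish_iff:
  assumes "gk_sol q x y (fps_const a + fps_X)"
  shows "ev fps_const F (pt4 x y (fps_const a + fps_X) 1) = 0 \<longleftrightarrow> gk_cong F 0"
proof
  assume z: "ev fps_const F (pt4 x y (fps_const a + fps_X) 1) = 0"
  show "gk_cong F 0"
  proof (rule ccontr)
    assume "\<not> gk_cong F 0"
    then obtain N where N: "N \<noteq> 0" "gk_cong (gk_norm F) (nf_term N 0 0)"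
      using pole_sol_exists vanishing_or_norm by blast
    have "pev fps_const N (fps_const a + fps_X) = 0"
      unfolding norm_at_solution[OF scalar_hom_fps_const N(2) assms]
    proof (rule prod_zero[OF gk_group_card(1)], rule bexI)
      show "(0, 0) \<in> gk_group" by (simp add: gk_group_def)
    qed (use z in \<open>simp add: power_0_left\<close>)
    then show False using subdegree_pev_shift(1)[OF N(1)] by blast
  qed
qed (use gk_cong_0_ev[OF scalar_hom_fps_const assms] in blast)

text \<open>
  The coordinates \<open>(1 : v : t : u)\<close> are \<open>u\<close> times the affine ones.
\<close>

lemma infinity_branch_dehomogenise:
  assumes "infinity_branch v u" "form d F"
  shows "fps_to_fls (ev fps_const F (pt4 1 v fps_X u)) = fps_to_fls u ^ d *
    ev fls_const F (pt4 (1 / fps_to_fls u) (fps_to_fls v / fps_to_fls u) (fls_X / fps_to_fls u) 1)"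
proof -
  let ?u = "fps_to_fls u"
  have u: "?u \<noteq> 0" using infinity_branch_subdegree(2)[OF assms(1)] by simp
  have "fps_to_fls (ev fps_const F (pt4 1 v fps_X u)) = ev fls_const F (pt4 1 (fps_to_fls v) fls_X ?u)"
    by (simp add: fpsc.hom_ev[OF scalar_hom_fps_to_fls] pt4_map fps_const_to_fls fps_X_to_fls)
  also have "pt4 1 (fps_to_fls v) fls_X ?u = (\<lambda>i. ?u * pt4 (1 / ?u) (fps_to_fls v / ?u) (fls_X / ?u) 1 i)"
    using u by (auto simp: pt4_def)
  also have "ev fls_const F \<dots> = ?u ^ d * ev fls_const F (pt4 (1 / ?u) (fps_to_fls v / ?u) (fls_X / ?u) 1)"
    by (rule ev_homogeneous[OF scalar_hom_fls_const assms(2)])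
  finally show ?thesis .
qed

lemma infinity_branch_vanish_iff:
  assumes "infinity_branch v u" "form d F"
  shows "ev fps_const F (pt4 1 v fps_X u) = 0 \<longleftrightarrow> gk_cong F 0"
proof -
  have u: "fps_to_fls u \<noteq> 0" using infinity_branch_subdegree(2)[OF assms(1)] by simp
  note pole = pole_sol_infinity_branch[OF assms(1)]
  have "ev fps_const F (pt4 1 v fps_X u) = 0 \<longleftrightarrow>
    ev fls_const F (pt4 (1 / fps_to_fls u) (fps_to_fls v / fps_to_fls u) (fls_X / fps_to_fls u) 1) = 0"
    using infinity_branch_dehomogenise[OF assms] u by (metis fps_to_fls_eq_0_iff mult_eq_0_iff power_not_zero)
  also have "\<dots> \<longleftrightarrow> gk_cong F 0"
    using vanishing_or_norm[OF pole, of F] gk_cong_0_ev[OF scalar_hom_fls_const] pole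
    unfolding pole_sol_def by blast
  finally show ?thesis .
qed

text \<open>
  The two affine equations become forms that also cut out the correct points at infinity: with
  \<open>T = 0\<close> they give \<open>Y = 0\<close> and then \<open>Z = 0\<close>.
\<close>

lemma curve_points:
  "GK_curve q = insert P_infinity {affine_point x y z | x y z :: 'a. gk_sol q x y z}"
proof (intro equalityI subsetI)
  fix P :: "'a point3" assume P: "P \<in> GK_curve q"
  let ?R1 = "var4 2 ^ (q + 1) - (var4 1 ^ q * var4 4 + var4 1 * var4 4 ^ q) :: 'a poly4"
  let ?R2 = "var4 3 ^ (q^2 - q + 1) - var4 2 * ((var4 1 ^ q + var4 1 * var4 4 ^ (q - 1)) ^ (q - 1) - var4 4 ^ (q * (q - 1))) :: 'a poly4"
  obtain r where r: "q = Suc r" using q_pos(1) gr0_implies_Suc by blast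
  have V: "form k (var4 i ^ k :: 'a poly4)" for k i using form_power[OF form_var4, of k i] by simp
  have f1: "form (q + 1) ?R1"
    using V[of "q + 1" 2] form_mult[OF V[of q 1] form_var4[of 4]] form_mult[OF form_var4[of 1] V[of q 4]]
    by (intro form_diff form_add) simp_all
  have "form q (var4 1 * var4 4 ^ (q - 1) :: 'a poly4)"
    using form_mult[OF form_var4[of 1] V[of "q - 1" 4]] by (simp add: r)
  then have "form ((q - 1) * q) ((var4 1 ^ q + var4 1 * var4 4 ^ (q - 1)) ^ (q - 1) :: 'a poly4)"
    using V[of q 1] by (intro form_power form_add)
  then have "form (q * (q - 1)) ((var4 1 ^ q + var4 1 * var4 4 ^ (q - 1)) ^ (q - 1) - var4 4 ^ (q * (q - 1)) :: 'a poly4)"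
    using V[of "q * (q - 1)" 4] by (intro form_diff) (simp_all add: mult.commute)
  from form_mult[OF form_var4[of 2] this]
  have "form (1 + q * (q - 1)) (var4 2 * ((var4 1 ^ q + var4 1 * var4 4 ^ (q - 1)) ^ (q - 1) - var4 4 ^ (q * (q - 1))) :: 'a poly4)"
    by simp
  moreover have "1 + q * (q - 1) = q^2 - q + 1" by (simp add: r power2_eq_square)
  ultimately have f2: "form (q^2 - q + 1) ?R2"
    using V[of "q^2 - q + 1" 3] by (intro form_diff) simp_all
  interpret i: scalar_hom "\<lambda>a::'a. a" by (rule scalar_hom_id)
  have e1: "ev (\<lambda>a. a) ?R1 v = v 2 ^ (q + 1) - (v 1 ^ q * v 4 + v 1 * v 4 ^ q)"
    and e2: "ev (\<lambda>a. a) ?R2 v = v 3 ^ (q^2 - q + 1) -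
      v 2 * ((v 1 ^ q + v 1 * v 4 ^ (q - 1)) ^ (q - 1) - v 4 ^ (q * (q - 1)))" for v
    by (simp_all only: i.ev_homs i.ev_var4)
  have "\<forall>x y z::'a. gk_sol q x y z \<longrightarrow> ev (\<lambda>a. a) ?R1 (pt4 x y z 1) = 0"
    "\<forall>x y z::'a. gk_sol q x y z \<longrightarrow> ev (\<lambda>a. a) ?R2 (pt4 x y z 1) = 0"
    unfolding e1 e2 gk_sol_alt by simp_all
  then have van: "vanishes_at ?R1 P" "vanishes_at ?R2 P"
    using vanishes_on_curve_iff[OF f1] vanishes_on_curve_iff[OF f2] P by blast+
  have "P \<in> PG3" using P by (simp add: GK_curve_def projective_closure_def)
  then obtain v where v: "v \<noteq> 0" "P = proj_point v" by (auto simp: PG3_def)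
  show "P \<in> insert P_infinity {affine_point x y z | x y z :: 'a. gk_sol q x y z}"
  proof (cases "v $ 4 = 0")
    case False
    define w where "w = inverse (v $ 4) *s v"
    have w: "w = vector [w $ 1, w $ 2, w $ 3, 1]"
      using False by (simp add: vec_eq_iff forall_4 w_def)
    have "P = proj_point w" unfolding v(2) w_def using False by (simp add: proj_point_scale)
    then have Pa: "P = affine_point (w $ 1) (w $ 2) (w $ 3)"
      unfolding affine_point_def using w by simp
    have "gk_sol q (w $ 1) (w $ 2) (w $ 3)"
      using van unfolding Pa vanishes_at_affine_point[OF f1] vanishes_at_affine_point[OF f2] e1 e2 gk_sol_alt
      by simp
    then show ?thesis using Pa by blast
  next
    case True
    have ev: "ev (\<lambda>a. a) ?R1 (\<lambda>i. v $ i) = 0" "ev (\<lambda>a. a) ?R2 (\<lambda>i. v $ i) = 0"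
      using van v(2) vanishes_at_proj_point[OF f1] vanishes_at_proj_point[OF f2] by (auto simp: eval4_eq_ev)
    have v2: "v $ 2 = 0" using ev(1) True unfolding e1 by (simp add: power_0_left)
    have v3: "v $ 3 = 0" using ev(2) True v2 unfolding e2 by auto
    have v1: "v $ 1 \<noteq> 0" using v(1) v2 v3 True by (auto simp: vec_eq_iff forall_4)
    have "v = (v $ 1) *s vector [1, 0, 0, 0]"
      using True v2 v3 by (simp add: vec_eq_iff forall_4)
    then have "P = P_infinity" unfolding v(2) P_infinity_def using v1 by (metis proj_point_scale)
    then show ?thesis by simp
  qed
next
  fix P :: "'a point3" assume "P \<in> insert P_infinity {affine_point x y z | x y z :: 'a. gk_sol q x y z}"
  then consider "P = P_infinity" | x y z where "P = affine_point x y z" "gk_sol q x y z" by blast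
  then show "P \<in> GK_curve q"
  proof cases
    case 1
    obtain v u where inf: "infinity_branch v u" using infinity_branch_exists by blast
    have "vanishes_at F P_infinity"
      if F: "form d F" "\<forall>Q\<in>{proj_point (vector [x, y, z, 1]) | x y z :: 'a.
        y ^ (q + 1) = x ^ q + x \<and> z ^ (q^2 - q + 1) = y ^ (q^2) - y}. vanishes_at F Q" for F d
    proof -
      have "ev (\<lambda>a. a) F (pt4 x y z 1) = 0" if "gk_sol q x y z" for x y z :: 'a
        using F(2) that vanishes_at_affine_point[OF F(1), of x y z]
        unfolding gk_sol_def affine_point_def by blast
      then have "gk_cong F 0" using vanishes_on_solutions_iff by blast
      then have "ev fps_const F (pt4 1 v fps_X u) = 0"
        using infinity_branch_vanish_iff[OF inf F(1)] by simp
      moreover have "fps_nth (ev fps_const F (pt4 1 v fps_X u)) 0 = ev (\<lambda>a. a) F (pt4 1 0 0 0)"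
      proof -
        have "(\<lambda>i. fps_nth (pt4 1 v fps_X u i) 0) = pt4 1 0 0 0"
          using inf by (auto simp: pt4_def infinity_branch_def)
        then show ?thesis by (simp add: fpsc.hom_ev[OF scalar_hom_fps_nth_0])
      qed
      ultimately show ?thesis using vanishes_at_infinity[OF F(1)] by simp
    qed
    then show ?thesis
      unfolding 1 GK_curve_def projective_closure_def using P_infinity_in_PG3 by blast
  qed (use affine_point_in_curve in blast)
qed

definition is_branch :: "'a point3 \<Rightarrow> (4 \<Rightarrow> 'a fps) \<Rightarrow> bool" where
  "is_branch P \<xi> \<longleftrightarrow>
     (\<exists>v u. infinity_branch v u \<and> P = P_infinity \<and> \<xi> = pt4 1 v fps_X u) \<or>
     (\<exists>x y a. gk_sol q x y (fps_const a + fps_X) \<and> P = affine_point (fps_nth x 0) (fps_nth y 0) a \<and>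
        \<xi> = pt4 x y (fps_const a + fps_X) 1)"

text \<open>
  At an affine point the branch with parameter \<open>z - a\<close> is unique. At infinity the choice is immaterial:
  only the equations satisfied by \<open>v\<close> and \<open>u\<close> are ever used.
\<close>

definition gk_branch :: "'a point3 \<Rightarrow> 4 \<Rightarrow> 'a fps" where
  "gk_branch P = (SOME \<xi>. is_branch P \<xi>)"

lemma is_branch_gk_branch:
  assumes "P \<in> GK_curve q"
  shows "is_branch P (gk_branch P)"
proof -
  have "\<exists>\<xi>. is_branch P \<xi>"
    using assms infinity_branch_exists affine_branch_exists
    unfolding curve_points is_branch_def by blast
  then show ?thesis unfolding gk_branch_def by (rule someI_ex)
qed

lemma gk_branch_infinity: "\<exists>v u. infinity_branch v u \<and> gk_branch P_infinity = pt4 1 v fps_X u"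
  using is_branch_gk_branch[of P_infinity] affine_point_neq_infinity
  unfolding is_branch_def curve_points by (metis insertI1)

lemma gk_branch_affine:
  assumes "gk_sol q x y (fps_const a + fps_X)"
  shows "gk_branch (affine_point (fps_nth x 0) (fps_nth y 0) a) = pt4 x y (fps_const a + fps_X) 1"
proof -
  let ?P = "affine_point (fps_nth x 0) (fps_nth y 0) a"
  have "is_branch ?P (gk_branch ?P)"
    unfolding gk_branch_def using assms by (intro someI_ex[of "is_branch ?P"]) (auto simp: is_branch_def)
  then obtain x' y' a' where x': "gk_sol q x' y' (fps_const a' + fps_X)"
      "?P = affine_point (fps_nth x' 0) (fps_nth y' 0) a'"
      "gk_branch ?P = pt4 x' y' (fps_const a' + fps_X) 1"
    unfolding is_branch_def using affine_point_neq_infinity by blast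
  then have a: "a' = a" "fps_nth x 0 = fps_nth x' 0" "fps_nth y 0 = fps_nth y' 0" by auto
  from affine_branch_unique[OF assms x'(1)[unfolded a(1)] a(2,3)] show ?thesis
    using x'(3) a(1) by simp
qed

end

context gk_field
begin

section \<open>Local parameters\<close>

text \<open>
  The curve equations express \<open>z\<^sup>n - a\<^sup>n\<close> as \<open>y - y\<^sub>0\<close> times a unit, and a multiple of \<open>y - y\<^sub>0\<close> as \<open>x - x\<^sub>0\<close>
  times a unit, of the algebraic local ring. So all coordinates are constant modulo \<open>z - a\<close>.
\<close>

lemma affine_uniformizer:
  fixes a :: 'a
  assumes sol: "gk_sol q x y (fps_const a + fps_X)"
  defines "\<xi> \<equiv> pt4 x y (fps_const a + fps_X) 1"
  shows "branch_uniformizer \<xi> fps_X"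
proof -
  let ?O = "branch_ring \<xi>" and ?z = "fps_const a + fps_X :: 'a fps" and ?n = "q^2 - q + 1"
  define x0 where "x0 = fps_nth x 0"
  define y0 where "y0 = fps_nth y 0"
  have char: "CHAR('a fps) = CHAR('a)" by simp
  have j: "\<xi> 4 = 1" by (simp add: \<xi>_def)
  have O: "x \<in> ?O" "y \<in> ?O" "?z \<in> ?O"
    using branch_ring_coordinate[of \<xi>, OF j, of 1] branch_ring_coordinate[of \<xi>, OF j, of 2]
      branch_ring_coordinate[of \<xi>, OF j, of 3] by (simp_all add: \<xi>_def)
  have c: "fps_const b \<in> ?O" for b by (rule branch_ring_const)
  have t: "fps_X \<in> ?O" using branch_ring_diff[OF O(3) c[of a]] by simp
  have e: "?z ^ ?n = y ^ (q^2) - y" "y ^ (q + 1) = x ^ q + x"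
    using sol by (simp_all add: gk_sol_def)
  have "fps_nth (?z ^ ?n) 0 = fps_nth (y ^ (q^2) - y) 0" unfolding e(1) ..
  then have ca: "fps_const a ^ ?n = fps_const y0 ^ (q^2) - fps_const y0"
    by (simp add: fps_nth_power_0 y0_def fps_const_power del: power_Suc)
  have "fps_nth (y ^ (q + 1)) 0 = fps_nth (x ^ q + x) 0" unfolding e(2) ..
  then have cx: "fps_const y0 ^ (q + 1) = fps_const x0 ^ q + fps_const x0"
    by (simp add: fps_nth_power_0 y0_def x0_def fps_const_power del: power_Suc)
  have y: "\<exists>h\<in>?O. y - fps_const y0 = fps_X * h"
  proof -
    let ?d = "y - fps_const y0"
    have "?z - fps_const a = fps_X * 1" by simp
    then obtain h where h: "h \<in> ?O" "?z ^ ?n - fps_const a ^ ?n = fps_X * h"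
      using branch_ring_power_diff[OF _ O(3) c branch_ring_one] by metis
    have "?d * (?d ^ (q^2 - 1) - 1) = ?d ^ (q^2) - ?d"
      using q2_gt_1 by (simp add: right_diff_distrib flip: power_Suc)
    also have "\<dots> = ?z ^ ?n - fps_const a ^ ?n"
      unfolding frob2_diff[OF char] ca e(1) by (simp add: algebra_simps)
    finally have eq: "?d * (?d ^ (q^2 - 1) - 1) = fps_X * h" unfolding h(2) .
    show ?thesis
    proof (rule branch_ring_cancel_unit[OF eq _ _ h(1)])
      show "?d ^ (q^2 - 1) - 1 \<in> ?O"
        by (intro branch_ring_diff branch_ring_power branch_ring_one O c)
      show "fps_nth (?d ^ (q^2 - 1) - 1) 0 \<noteq> 0"
        using q2_gt_1 by (simp add: fps_nth_power_0 y0_def power_0_left)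
    qed
  qed
  have x: "\<exists>h\<in>?O. x - fps_const x0 = fps_X * h"
  proof -
    let ?d = "x - fps_const x0"
    obtain h where h: "h \<in> ?O" "y ^ (q + 1) - fps_const y0 ^ (q + 1) = fps_X * h"
      using y branch_ring_power_diff[OF _ O(2) c] by metis
    have "?d * (?d ^ (q - 1) + 1) = ?d ^ q + ?d"
      by (simp add: distrib_left flip: power_Suc)
    also have "\<dots> = y ^ (q + 1) - fps_const y0 ^ (q + 1)"
      unfolding frob_diff[OF char] cx e(2) by (simp add: algebra_simps)
    finally have eq: "?d * (?d ^ (q - 1) + 1) = fps_X * h" unfolding h(2) .
    show ?thesis
    proof (rule branch_ring_cancel_unit[OF eq _ _ h(1)])
      show "?d ^ (q - 1) + 1 \<in> ?O"
        by (intro branch_ring_add branch_ring_diff branch_ring_power branch_ring_one O c)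
      show "fps_nth (?d ^ (q - 1) + 1) 0 \<noteq> 0"
        using q_ge_2 by (simp add: fps_nth_power_0 x0_def power_0_left)
    qed
  qed
  have coord: "\<exists>h\<in>?O. \<xi> i - fps_const (fps_nth (\<xi> i) 0) = fps_X * h" for i
  proof -
    consider "i = 1" | "i = 2" | "i = 3" | "i = 4" using exhaust_4 by blast
    then show ?thesis
    proof cases
      case 3
      then show ?thesis using c[of 1] by (intro bexI[of _ 1]) (auto simp: \<xi>_def)
    next
      case 4
      then show ?thesis using c[of 0] by (intro bexI[of _ 0]) (auto simp: \<xi>_def)
    qed (use x y in \<open>simp_all add: \<xi>_def x0_def y0_def\<close>)
  qed
  show ?thesis by (rule uniformizer_from_coordinates[of \<xi>, OF j t subdegree_fps_X coord])
qed

text \<open>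
  Up to units, \<open>v\<close> is a power of \<open>t\<close> and \<open>u\<close> is a power of \<open>v\<close>.
\<close>

lemma infinity_uniformizer:
  fixes v u :: "'a fps"
  assumes inf: "infinity_branch v u"
  defines "\<xi> \<equiv> pt4 1 v fps_X u"
  shows "branch_uniformizer \<xi> fps_X"
proof -
  let ?O = "branch_ring \<xi>" and ?n = "q^2 - q + 1"
  have j: "\<xi> 1 = 1" by (simp add: \<xi>_def)
  have O: "v \<in> ?O" "fps_X \<in> ?O" "u \<in> ?O"
    using branch_ring_coordinate[of \<xi>, OF j, of 2] branch_ring_coordinate[of \<xi>, OF j, of 3]
      branch_ring_coordinate[of \<xi>, OF j, of 4] by (simp_all add: \<xi>_def)
  have q1: "q > 1" "q - 1 > 0" using q_ge_2 by auto
  let ?E = "(1 + u ^ (q - 1)) ^ (q - 1) - u ^ (q * (q - 1))"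
  have 0: "fps_nth v 0 = 0" "fps_nth u 0 = 0" "v ^ (q + 1) = u ^ q + u" "v * ?E = fps_X ^ ?n"
    using inf by (simp_all add: infinity_branch_def)
  have v: "\<exists>h\<in>?O. v = fps_X * h"
  proof (rule branch_ring_cancel_unit)
    show "v * ?E = fps_X * fps_X ^ (q^2 - q)" unfolding 0(4) by simp
    show "?E \<in> ?O"
      by (intro branch_ring_diff branch_ring_add branch_ring_power branch_ring_one O)
    have "fps_nth ?E 0 = 1" using 0(2) q1 by (simp add: fps_nth_power_0 power_0_left)
    then show "fps_nth ?E 0 \<noteq> 0" by (simp only: one_neq_zero not_False_eq_True)
  qed (intro branch_ring_power O)
  then obtain h where h: "h \<in> ?O" "v = fps_X * h" by blast
  have u: "\<exists>h\<in>?O. u = fps_X * h"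
  proof (rule branch_ring_cancel_unit)
    have "u * (1 + u ^ (q - 1)) = v * v ^ q"
      using 0(3) q1 by (simp add: distrib_left add.commute flip: power_Suc)
    then show "u * (1 + u ^ (q - 1)) = fps_X * (h * v ^ q)"
      unfolding h(2) by (simp only: mult.assoc)
    show "1 + u ^ (q - 1) \<in> ?O"
      by (intro branch_ring_add branch_ring_power branch_ring_one O)
    show "fps_nth (1 + u ^ (q - 1)) 0 \<noteq> 0" using 0(2) q1 by (simp add: fps_nth_power_0 power_0_left)
  qed (intro branch_ring_mult branch_ring_power O h)
  have coord: "\<exists>h\<in>?O. \<xi> i - fps_const (fps_nth (\<xi> i) 0) = fps_X * h" for i
  proof -
    consider "i = 1" | "i = 2" | "i = 3" | "i = 4" using exhaust_4 by blast
    then show ?thesis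
    proof cases
      case 1
      then show ?thesis using branch_ring_const[of 0 \<xi>] by (intro bexI[of _ 0]) (auto simp: \<xi>_def)
    next
      case 3
      then show ?thesis using branch_ring_const[of 1 \<xi>] by (intro bexI[of _ 1]) (auto simp: \<xi>_def)
    qed (use u v 0 in \<open>simp_all add: \<xi>_def\<close>)
  qed
  show ?thesis by (rule uniformizer_from_coordinates[of \<xi>, OF j O(2) subdegree_fps_X coord])
qed

section \<open>The intersection number with a surface\<close>

text \<open>
  Along the branch at one point of the fibre the norm is the product of the conjugates of \<open>F\<close>. By
  uniqueness of branches these are the expansions of \<open>F\<close> at all points of the fibre.
\<close>

lemma fibre_order_sum:
  assumes N: "N \<noteq> 0" "gk_cong (gk_norm F) (nf_term N 0 0)"
  shows "(\<Sum>(x, y)\<in>gk_fibre a. subdegree (ev fps_const F (gk_branch (affine_point x y a)))) = order a N"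
proof -
  let ?z = "fps_const a + fps_X :: 'a fps"
  have "gk_fibre a \<noteq> {}" using gk_fibre_card[of a] q_pos by (metis card.empty power_not_zero)
  then obtain x0 y0 where f0: "(x0, y0) \<in> gk_fibre a" by auto
  then have "gk_sol q x0 y0 a" by (simp add: gk_fibre_def)
  from affine_branch_exists[OF this]
  obtain x y where xy: "gk_sol q x y ?z" "fps_nth x 0 = x0" "fps_nth y 0 = y0" by blast
  let ?s = "\<lambda>(b, g). ev fps_const F (pt4 (x + fps_const (b ^ q) * y + fps_const g) (y + fps_const b) ?z 1)"
  have prod: "pev fps_const N ?z = (\<Prod>u\<in>gk_group. ?s u)"
    by (rule norm_at_solution[OF scalar_hom_fps_const N(2) xy(1)])
  have nz: "pev fps_const N ?z \<noteq> 0" and ord: "subdegree (pev fps_const N ?z) = order a N"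
    using subdegree_pev_shift[OF N(1)] by auto
  have snz: "?s u \<noteq> 0" if "u \<in> gk_group" for u
    using nz that gk_group_card(1) unfolding prod by (auto simp: prod_zero_iff)
  have br: "ev fps_const F (gk_branch (affine_point (x0 + b ^ q * y0 + g) (y0 + b) a)) = ?s (b, g)"
    if bg: "(b, g) \<in> gk_group" for b g
    using gk_branch_affine[OF gk_sol_translate[OF scalar_hom_fps_const _ bg xy(1)]] xy(2,3) by simp
  have "order a N = (\<Sum>u\<in>gk_group. subdegree (?s u))"
    unfolding ord[symmetric] prod by (rule subdegree_prod) (use snz in blast)
  also have "\<dots> = (\<Sum>u\<in>gk_group. (\<lambda>(x, y). subdegree (ev fps_const F (gk_branch (affine_point x y a))))
      ((\<lambda>(b, g). (x0 + b ^ q * y0 + g, y0 + b)) u))"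
    by (intro sum.cong refl) (auto simp: br)
  also have "\<dots> = (\<Sum>(x, y)\<in>gk_fibre a. subdegree (ev fps_const F (gk_branch (affine_point x y a))))"
    by (rule sum.reindex_bij_betw[OF gk_group_fibre[OF f0]])
  finally show ?thesis by simp
qed

lemma infinity_subdegree:
  assumes "infinity_branch v u" "form d F" "\<not> gk_cong F 0"
    and N: "fls_subdegree (ev fls_const F (pt4 (1 / fps_to_fls u) (fps_to_fls v / fps_to_fls u)
      (fls_X / fps_to_fls u) 1)) = - int (degree N)"
  shows "subdegree (ev fps_const F (pt4 1 v fps_X u)) + degree N = d * (q ^ 3 + 1)"
proof -
  have u: "fps_to_fls u \<noteq> 0" using infinity_branch_subdegree(2)[OF assms(1)] by simp
  have "fps_to_fls (ev fps_const F (pt4 1 v fps_X u)) \<noteq> 0"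
    using infinity_branch_vanish_iff[OF assms(1,2)] assms(3) by simp
  then have "int (subdegree (ev fps_const F (pt4 1 v fps_X u))) = int d * int (subdegree u) - int (degree N)"
    using infinity_branch_dehomogenise[OF assms(1,2)] N u
    by (simp add: fls_subdegree_pow fls_subdegree_fls_to_fps flip: fls_subdegree_fls_to_fps)
  then have "int (subdegree (ev fps_const F (pt4 1 v fps_X u)) + degree N) = int (d * (q ^ 3 + 1))"
    unfolding infinity_branch_subdegree(4)[OF assms(1)] by (simp add: algebra_simps)
  then show ?thesis by (simp only: of_nat_eq_iff)
qed

text \<open>
  The affine intersection number is the number of roots of the norm, that is, its degree, which is
  also the pole order of the dehomogenised \<open>F\<close> at infinity. Homogenising multiplies by the \<open>d\<close>-th power
  of \<open>u\<close>, of order \<open>d (q\<^sup>3 + 1)\<close>.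
\<close>

theorem gk_bezout:
  assumes "form d F" "\<not> gk_cong F 0"
  defines "s \<equiv> \<lambda>Q. subdegree (ev fps_const F (gk_branch Q))"
  shows "finite {Q\<in>GK_curve q. s Q \<noteq> 0}" "(\<Sum>Q\<in>{Q\<in>GK_curve q. s Q \<noteq> 0}. s Q) = d * (q ^ 3 + 1)"
proof -
  obtain v u where inf: "infinity_branch v u" "gk_branch P_infinity = pt4 1 v fps_X u"
    using gk_branch_infinity by blast
  obtain N where N: "N \<noteq> 0" "gk_cong (gk_norm F) (nf_term N 0 0)"
    "fls_subdegree (ev fls_const F (pt4 (1 / fps_to_fls u) (fps_to_fls v / fps_to_fls u)
      (fls_X / fps_to_fls u) 1)) = - int (degree N)"
    using vanishing_or_norm[OF pole_sol_infinity_branch[OF inf(1)], of F] assms(2) by blast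
  define R where "R = {a. poly N a = 0}"
  define A where "A = (\<Union>a\<in>R. (\<lambda>(x, y). affine_point x y a) ` gk_fibre a)"
  have R: "finite R" unfolding R_def by (rule poly_roots_finite[OF N(1)])
  have finA: "finite A" unfolding A_def using R gk_fibre_card(1) by blast
  have zero: "s (affine_point x y a) = 0" if "gk_sol q x y a" "a \<notin> R" for x y a
  proof -
    have "order a N = 0" using that(2) N(1) by (simp add: R_def order_root)
    then have "(\<Sum>(x, y)\<in>gk_fibre a. s (affine_point x y a)) = 0"
      using fibre_order_sum[OF N(1,2), of a] by (simp add: s_def)
    then show ?thesis
      using that(1) gk_fibre_card(1)[of a] by (force simp: gk_fibre_def)
  qed
  have AX: "insert P_infinity A \<subseteq> GK_curve q" unfolding curve_points A_def gk_fibre_def by auto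
  have sub: "{Q\<in>GK_curve q. s Q \<noteq> 0} \<subseteq> insert P_infinity A"
  proof
    fix Q assume "Q \<in> {Q\<in>GK_curve q. s Q \<noteq> 0}"
    then consider "Q = P_infinity" | x y a where "Q = affine_point x y a" "gk_sol q x y a" "s Q \<noteq> 0"
      unfolding curve_points by blast
    then show "Q \<in> insert P_infinity A"
    proof cases
      case 2
      then have "a \<in> R" using zero[of x y a] by auto
      then show ?thesis using 2 by (force simp: A_def gk_fibre_def)
    qed simp
  qed
  then show "finite {Q\<in>GK_curve q. s Q \<noteq> 0}" by (rule finite_subset) (use finA in simp)
  have "(\<Sum>Q\<in>A. s Q) = (\<Sum>a\<in>R. \<Sum>Q\<in>(\<lambda>(x, y). affine_point x y a) ` gk_fibre a. s Q)"
    unfolding A_def using R gk_fibre_card(1) by (subst sum.UNION_disjoint) auto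
  also have "\<dots> = (\<Sum>a\<in>R. \<Sum>(x, y)\<in>gk_fibre a. s (affine_point x y a))"
    by (intro sum.cong refl, subst sum.reindex) (auto simp: inj_on_def case_prod_unfold o_def)
  also have "\<dots> = (\<Sum>a\<in>R. order a N)"
    using fibre_order_sum[OF N(1,2)] by (simp add: s_def)
  also have "\<dots> = degree N" unfolding R_def by (rule sum_order_eq_degree[OF N(1)])
  finally have "(\<Sum>Q\<in>insert P_infinity A. s Q) = s P_infinity + degree N"
    using finA by (subst sum.insert) (auto simp: A_def affine_point_neq_infinity[symmetric])
  also have "\<dots> = d * (q ^ 3 + 1)"
    unfolding s_def inf(2) by (rule infinity_subdegree[OF inf(1) assms(1,2) N(3)])
  finally have "(\<Sum>Q\<in>insert P_infinity A. s Q) = d * (q ^ 3 + 1)" .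
  moreover have "(\<Sum>Q\<in>{Q\<in>GK_curve q. s Q \<noteq> 0}. s Q) = (\<Sum>Q\<in>insert P_infinity A. s Q)"
  proof (rule sum.mono_neutral_left[OF _ sub])
    show "finite (insert P_infinity A)" using finA by simp
    show "\<forall>Q\<in>insert P_infinity A - {Q\<in>GK_curve q. s Q \<noteq> 0}. s Q = 0" using AX by blast
  qed
  ultimately show "(\<Sum>Q\<in>{Q\<in>GK_curve q. s Q \<noteq> 0}. s Q) = d * (q ^ 3 + 1)" by (rule trans[rotated])
qed

theorem gk_branched_curve: "branched_curve_of_degree (GK_curve q) gk_branch (q ^ 3 + 1)"
proof -
  have van: "(\<forall>Q\<in>GK_curve q. vanishes_at F Q) \<longleftrightarrow> gk_cong F 0" if "form d F" for d and F :: "'a poly4"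
    using vanishes_on_curve_iff[OF that] vanishes_on_solutions_iff by blast
  have br0: "ev fps_const F (gk_branch P) = 0 \<longleftrightarrow> gk_cong F 0" if "P \<in> GK_curve q" "form d F" for P d F
    using is_branch_gk_branch[OF that(1)] affine_branch_vanish_iff infinity_branch_vanish_iff[OF _ that(2)]
    unfolding is_branch_def by auto
  interpret branched_curve "GK_curve q" gk_branch
  proof
    fix P :: "'a point3" assume P: "P \<in> GK_curve q"
    then consider v u where "infinity_branch v u" "P = P_infinity" "gk_branch P = pt4 1 v fps_X u"
      | x y a where "gk_sol q x y (fps_const a + fps_X)" "P = affine_point (fps_nth x 0) (fps_nth y 0) a"
        "gk_branch P = pt4 x y (fps_const a + fps_X) 1"
      using is_branch_gk_branch unfolding is_branch_def by blast
    note cases = this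
    show "P = proj_point (\<chi> i. fps_nth (gk_branch P i) 0)"
    proof (cases rule: cases)
      case 1
      then show ?thesis
        by (auto simp: P_infinity_def vec_eq_iff forall_4 infinity_branch_def intro!: arg_cong[where f = proj_point])
    next
      case 2
      then show ?thesis
        by (auto simp: affine_point_def vec_eq_iff forall_4 intro!: arg_cong[where f = proj_point])
    qed
    show "\<exists>j. gk_branch P j = 1"
      by (cases rule: cases) (metis pt4_simps(1), metis pt4_simps(4))
    show "\<exists>t. branch_uniformizer (gk_branch P) t"
      by (cases rule: cases) (metis infinity_uniformizer, metis affine_uniformizer)
    fix d and F :: "'a poly4" assume "form d F"
    then show "(\<forall>Q\<in>GK_curve q. vanishes_at F Q) \<longleftrightarrow> ev fps_const F (gk_branch P) = 0"
      using van br0[OF P] by blast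
  qed
  show ?thesis
  proof
    fix P and d and F :: "'a poly4" assume *: "P \<in> GK_curve q" "form d F" "ev fps_const F (gk_branch P) \<noteq> 0"
    then have "\<not> gk_cong F 0" using br0 by blast
    from gk_bezout[OF *(2) this]
    show "finite {Q \<in> GK_curve q. subdegree (ev fps_const F (gk_branch Q)) \<noteq> 0} \<and>
      (\<Sum>Q\<in>{Q \<in> GK_curve q. subdegree (ev fps_const F (gk_branch Q)) \<noteq> 0}.
        subdegree (ev fps_const F (gk_branch Q))) = d * (q ^ 3 + 1)" by blast
  qed
qed

end

section \<open>Rational fibres\<close>

context gk_field
begin

text \<open>
  The set \<open>\<Gamma>\<close> formed in the algebraic closure; \<open>Gamma_rational\<close> shows that nothing is added.
\<close>

definition gk_Gamma :: "'a set" where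
  "gk_Gamma = {c. c ^ ((q ^ 3 + 1) * (q^2 - 1)) + c ^ ((q ^ 3 + 1) * (q^2 - q)) + 1 = 0}"

lemma frobenius_homs: "((x::'a) + y) ^ q = x ^ q + y ^ q" "((x::'a) - y) ^ q = x ^ q - y ^ q"
  "((x::'a) + y) ^ (q^2) = x ^ (q^2) + y ^ (q^2)" "((x::'a) - y) ^ (q^2) = x ^ (q^2) - y ^ (q^2)"
  by (simp_all add: frob_add frob_diff frob2_add frob2_diff)

lemma power_q6: "(x::'a) ^ (q ^ 6) = ((x ^ (q^2)) ^ (q^2)) ^ (q^2)"
proof -
  have "q ^ 6 = q^2 * q^2 * q^2" by (simp add: eval_nat_numeral)
  then show ?thesis by (simp only: power_mult)
qed

lemma power_q3: "(x::'a) ^ (q ^ 3) = (x ^ q) ^ (q^2)"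
proof -
  have "q ^ 3 = q * q^2" by (simp add: eval_nat_numeral)
  then show ?thesis by (simp only: power_mult)
qed

lemma zero_notin_Gamma: "0 \<notin> gk_Gamma"
proof -
  have "q < q^2" using q_ge_2 by (simp add: power2_eq_square)
  then have n: "(q ^ 3 + 1) * (q^2 - 1) \<noteq> 0" "(q ^ 3 + 1) * (q^2 - q) \<noteq> 0"
    using q2_gt_1 by simp_all
  show ?thesis unfolding gk_Gamma_def mem_Collect_eq power_0_left by (simp only: n if_False) simp
qed

text \<open>
  Put \<open>u = c\<close> to the power \<open>q\<^sup>3 + 1\<close>. The defining equation makes \<open>r = 1/u\<close> an element with vanishing trace
  \<open>r + r\<^sup>q + \<dots>\<close> of three terms, hence fixed by the third power of the Frobenius map; so is \<open>u\<close>, and this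
  says that \<open>c\<close> is fixed by the sixth.
\<close>

lemma Gamma_rational:
  assumes c: "c \<in> gk_Gamma"
  shows "c ^ (q ^ 6) = c"
proof -
  have c0: "c \<noteq> 0" using c zero_notin_Gamma by auto
  define u where "u = c ^ (q ^ 3 + 1)"
  have u0: "u \<noteq> 0" using c0 by (simp add: u_def)
  have e: "u ^ (q^2 - 1) + u ^ (q^2 - q) + 1 = 0"
    using c unfolding gk_Gamma_def u_def by (simp only: power_mult mem_Collect_eq)
  define r where "r = inverse u"
  have ru: "r ^ k * u ^ k = 1" for k using u0 by (simp add: r_def flip: power_mult_distrib)
  have s: "r ^ (q^2) * u ^ (q^2 - k) = r ^ k" if "k \<le> q^2" for k
  proof -
    have "r ^ (q^2) = r ^ k * r ^ (q^2 - k)" using that by (simp flip: power_add)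
    then show ?thesis using ru[of "q^2 - k"] by (simp add: mult.assoc)
  qed
  have qq: "q \<le> q^2" "1 \<le> q^2" using q_ge_2 q2_gt_1 by (auto simp: power2_eq_square)
  have "r ^ (q^2) * (u ^ (q^2 - 1) + u ^ (q^2 - q) + 1) = r ^ 1 + r ^ q + r ^ (q^2)"
    using s[OF qq(2)] s[OF qq(1)] by (simp only: distrib_left mult_1_right)
  then have t: "r + r ^ q + r ^ (q^2) = 0" using e by simp
  have "(r + r ^ q + r ^ (q^2)) ^ q = r ^ q + r ^ (q^2) + r ^ (q ^ 3)"
    unfolding frobenius_homs by (simp add: power2_eq_square power3_eq_cube flip: power_mult)
  then have "r ^ q + r ^ (q^2) + r ^ (q ^ 3) = 0" using t q_pos by (simp add: power_0_left)
  with t have "r ^ (q ^ 3) = r"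
    by (metis add.assoc add.commute add_left_cancel)
  then have "inverse (u ^ (q ^ 3)) = inverse u" by (simp only: r_def power_inverse)
  then have "u ^ (q ^ 3) = u" by simp
  then have "c ^ (q ^ 3 * q ^ 3 + q ^ 3) = c ^ (q ^ 3 + 1)"
    unfolding u_def by (simp only: power_mult[symmetric] distrib_right mult_1)
  then have "c ^ (q ^ 3 * q ^ 3) * c ^ (q ^ 3) = c * c ^ (q ^ 3)"
    by (simp add: power_add mult.commute)
  then have "c ^ (q ^ 3 * q ^ 3) = c" using c0 by simp
  then show ?thesis by (simp flip: power_add)
qed

text \<open>
  Modulo the characteristic the leading exponent is \<open>-1\<close> and the other one \<open>0\<close>, so the derivative of the
  defining polynomial vanishes only at \<open>0\<close>, which is not a root.
\<close>

lemma card_Gamma: "finite gk_Gamma" "card gk_Gamma = (q ^ 3 + 1) * (q^2 - 1)"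
proof -
  let ?M = "(q ^ 3 + 1) * (q^2 - 1)" and ?N = "(q ^ 3 + 1) * (q^2 - q)"
  define p where "p = monom 1 ?M + (monom 1 ?N + 1 :: 'a poly)"
  have qq: "1 < q" "1 < q^2" using q_ge_2 q2_gt_1 by auto
  have lt: "?N < ?M" using qq by (intro mult_strict_left_mono) (auto simp: diff_less_mono2)
  have "q < q^2" using qq(1) by (simp add: power2_eq_square)
  then have N0: "0 < ?N" by simp
  have dN: "degree (monom 1 ?N + 1 :: 'a poly) \<le> ?N"
    by (rule degree_add_le) (simp_all add: degree_monom_le)
  have dM: "degree (monom (1::'a) ?M) = ?M" by (rule degree_monom_eq) simp
  have "degree (monom 1 ?N + 1 :: 'a poly) < degree (monom (1::'a) ?M)"
    using lt dN unfolding dM by linarith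
  then have deg: "degree p = ?M"
    unfolding p_def by (simp only: degree_add_eq_left dM)
  have qq0: "of_nat (q^2) = (0::'a)" "of_nat (q ^ 3) = (0::'a)" using of_nat_q by simp_all
  have M: "of_nat ?M = (-1 :: 'a)"
    using qq(2) qq0 by (simp only: of_nat_mult of_nat_add of_nat_diff less_imp_le) simp
  have N: "of_nat ?N = (0 :: 'a)"
    using \<open>q < q^2\<close> qq0 of_nat_q by (simp only: of_nat_mult of_nat_add of_nat_diff less_imp_le) simp
  have pd: "pderiv p = monom (-1) (?M - 1)"
    unfolding p_def pderiv_add pderiv_monom M N by simp
  have ev: "poly p x = x ^ ?M + x ^ ?N + 1" for x by (simp add: p_def poly_monom)
  have p0: "p \<noteq> 0" using deg lt by auto
  have "poly (pderiv p) x \<noteq> 0" if "poly p x = 0" for x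
  proof -
    have "?M \<noteq> 0" "?N \<noteq> 0" using N0 lt by linarith+
    then have "poly p 0 = 1" unfolding ev power_0_left by (simp only: if_False) simp
    then have "x \<noteq> 0" using that by auto
    then show ?thesis unfolding pd by (simp add: poly_monom)
  qed
  then have "card {x. poly p x = 0} = ?M" using card_roots_separable[OF p0] deg by simp
  moreover have "{x. poly p x = 0} = gk_Gamma" unfolding ev gk_Gamma_def ..
  ultimately show "card gk_Gamma = ?M" "finite gk_Gamma"
    using poly_roots_finite[OF p0] by simp_all
qed

text \<open>
  Iterating the second equation, \<open>y\<close> is rational iff the trace \<open>tr\<close> of \<open>e = c\<^sup>n\<close> from the field with \<open>q\<^sup>6\<close>
  elements to the one with \<open>q\<^sup>2\<close> vanishes. The power \<open>u\<close> of \<open>c\<close> with exponent \<open>q\<^sup>3 + 1\<close> is \<open>e\<^bsup>q+1\<^esup>\<close> and lies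
  in the field with \<open>q\<^sup>3\<close> elements. This makes \<open>x\<close> rational as soon as \<open>tr = 0\<close>, and, for \<open>c \<noteq> 0\<close>, turns the
  trace condition into the equation that defines \<open>\<Gamma>\<close>.
\<close>

lemma rational_fibre:
  assumes sol: "gk_sol q x y c" and c: "c ^ (q ^ 6) = c"
  shows "(c = 0 \<or> c \<in> gk_Gamma) \<Longrightarrow> x ^ (q ^ 6) = x \<and> y ^ (q ^ 6) = y"
    and "y ^ (q ^ 6) = y \<Longrightarrow> c = 0 \<or> c \<in> gk_Gamma"
proof -
  define e where "e = c ^ (q^2 - q + 1)"
  define u where "u = c ^ (q ^ 3 + 1)"
  define e2 where "e2 = e ^ (q^2)"
  define e4 where "e4 = e2 ^ (q^2)"
  define tr where "tr = e + e2 + e4"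
  have y2: "y ^ (q^2) = y + e" and xb: "y ^ (q + 1) = x ^ q + x"
    using sol by (simp_all add: gk_sol_def e_def algebra_simps)
  have y6: "y ^ (q ^ 6) = y + tr"
    unfolding power_q6 y2 frobenius_homs by (simp add: tr_def e2_def e4_def add_ac)
  have ue: "e ^ (q + 1) = u"
    unfolding e_def u_def power_mult[symmetric] by (simp only: mult.commute q_times_n)
  have c33: "c ^ (q ^ 3 * q ^ 3) = c" using c by (simp flip: power_add)
  have "u ^ (q ^ 3) = c ^ (q ^ 3 * q ^ 3 + q ^ 3)"
    by (simp only: u_def power_mult[symmetric] distrib_right mult_1)
  also have "\<dots> = c * c ^ (q ^ 3)" by (simp only: power_add[of c "q ^ 3 * q ^ 3"] c33)
  finally have u3: "u ^ (q ^ 3) = u" by (simp add: u_def)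
  have equiv: "tr = 0 \<longleftrightarrow> c = 0 \<or> c \<in> gk_Gamma"
  proof (cases "c = 0")
    case True
    then show ?thesis using q_pos by (simp add: tr_def e4_def e2_def e_def power_0_left)
  next
    case False
    then have nz: "u \<noteq> 0" "e \<noteq> 0" by (simp_all add: u_def e_def)
    obtain r where r: "q = Suc r" using q_pos(1) gr0_implies_Suc by blast
    have "q^2 = 1 + (q + 1) * (q - 1)" by (simp add: r power2_eq_square)
    then have e2: "e2 = e * u ^ (q - 1)"
      unfolding e2_def ue[symmetric] by (metis power_add power_mult power_one_right)
    have e4: "e4 = e * u ^ (q - 1) * (u ^ (q - 1)) ^ (q^2)"
      unfolding e4_def by (subst e2) (simp add: power_mult_distrib e2_def[symmetric] e2)
    have 1: "u ^ (q^2 - q) * u ^ (q - 1) = u ^ (q^2 - 1)"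
    proof -
      have "q^2 - q + (q - 1) = q^2 - 1" by (simp add: r power2_eq_square)
      then show ?thesis by (metis power_add)
    qed
    have 2: "u ^ (q^2 - q) * (u ^ (q - 1) * (u ^ (q - 1)) ^ (q^2)) = 1"
    proof -
      have "q^2 - q + (q - 1 + (q - 1) * q^2) + 1 = q ^ 3"
        by (simp add: r power2_eq_square power3_eq_cube algebra_simps)
      then have "u ^ (q^2 - q) * (u ^ (q - 1) * (u ^ (q - 1)) ^ (q^2)) * u = u ^ (q ^ 3)"
        by (metis power_add power_mult power_one_right)
      then show ?thesis using u3 nz(1) by simp
    qed
    have "u ^ (q^2 - q) * tr = e * (u ^ (q^2 - q) + u ^ (q^2 - q) * u ^ (q - 1)
        + u ^ (q^2 - q) * (u ^ (q - 1) * (u ^ (q - 1)) ^ (q^2)))"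
      unfolding tr_def e2 e4 by (simp add: algebra_simps)
    also have "\<dots> = e * (u ^ (q^2 - 1) + u ^ (q^2 - q) + 1)"
      unfolding 1 2 by (simp add: add_ac)
    finally have "tr = 0 \<longleftrightarrow> u ^ (q^2 - 1) + u ^ (q^2 - q) + 1 = 0"
      using nz by (metis mult_eq_0_iff power_not_zero)
    also have "\<dots> \<longleftrightarrow> c \<in> gk_Gamma"
      unfolding u_def gk_Gamma_def by (simp only: power_mult mem_Collect_eq)
    finally show ?thesis using False by simp
  qed
  show "c = 0 \<or> c \<in> gk_Gamma" if "y ^ (q ^ 6) = y"
    using that y6 equiv by simp
  show "x ^ (q ^ 6) = x \<and> y ^ (q ^ 6) = y" if "c = 0 \<or> c \<in> gk_Gamma"
  proof -
    have t: "tr = 0" using equiv that by simp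
    define d where "d = y ^ q * e"
    have qq: "(z ^ q) ^ q = z ^ (q^2)" for z :: 'a by (simp add: power2_eq_square power_mult)
    have comm: "(z ^ q) ^ (q^2) = (z ^ (q^2)) ^ q" for z :: 'a by (simp add: mult.commute flip: power_mult)
    have xq: "x ^ q = y ^ (q + 1) - x" using xb by simp
    have "x ^ (q^2) = (y ^ (q + 1)) ^ q - x ^ q" by (metis qq xq frobenius_homs(2))
    also have "\<dots> = y ^ q * (y ^ (q^2)) - (y ^ (q + 1) - x)"
      unfolding xq by (simp add: power_mult_distrib qq[symmetric] mult.commute)
    also have "\<dots> = x + d" unfolding y2 by (simp add: d_def algebra_simps)
    finally have x2: "x ^ (q^2) = x + d" .
    have x6: "x ^ (q ^ 6) = x + (d + d ^ (q^2) + (d ^ (q^2)) ^ (q^2))"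
      unfolding power_q6 x2 frobenius_homs by (simp add: add_ac)
    have d2: "d ^ (q^2) = (y ^ q + e ^ q) * e2"
      unfolding d_def power_mult_distrib comm y2 frobenius_homs e2_def ..
    have d4: "(d ^ (q^2)) ^ (q^2) = (y ^ q + e ^ q + e2 ^ q) * e4"
      unfolding d2 power_mult_distrib frobenius_homs comm y2 e2_def[symmetric] e4_def[symmetric] ..
    have "e2 ^ q * e4 = u ^ (q ^ 3)"
    proof -
      have "e2 ^ q = e ^ (q ^ 3)" unfolding power_q3 comm e2_def ..
      moreover have "e4 = (e ^ q) ^ (q ^ 3)"
        unfolding e4_def e2_def power_q3 comm qq[symmetric] by (simp only: comm qq)
      ultimately show ?thesis unfolding ue[symmetric] by (simp add: power_mult_distrib)
    qed
    then have "d + d ^ (q^2) + (d ^ (q^2)) ^ (q^2) = y ^ q * tr + e ^ q * (e2 + e4) + e ^ (q + 1)"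
      unfolding d4 unfolding d2 unfolding d_def tr_def u3 ue by (simp add: algebra_simps)
    also have "\<dots> = (y ^ q + e ^ q) * tr" by (simp add: tr_def algebra_simps)
    finally have "x ^ (q ^ 6) = x" using x6 t by simp
    then show ?thesis using y6 t by simp
  qed
qed

definition fibre_points :: "'a \<Rightarrow> 'a point3 set" where
  "fibre_points c = (\<lambda>(x, y). affine_point x y c) ` gk_fibre c"

lemma fibre_points_card: "finite (fibre_points c)" "card (fibre_points c) = q ^ 3"
  unfolding fibre_points_def using gk_fibre_card[of c]
  by (simp, subst card_image) (auto simp: inj_on_def)

lemma fibre_points_Union_card:
  assumes "finite B"
  shows "finite (\<Union>b\<in>B. fibre_points b)" "card (\<Union>b\<in>B. fibre_points b) = card B * q ^ 3"
proof -
  show "finite (\<Union>b\<in>B. fibre_points b)" using assms fibre_points_card by blast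
  have "card (\<Union>b\<in>B. fibre_points b) = (\<Sum>b\<in>B. card (fibre_points b))"
    using assms fibre_points_card by (intro card_UN_disjoint) (auto simp: fibre_points_def)
  then show "card (\<Union>b\<in>B. fibre_points b) = card B * q ^ 3" by (simp add: fibre_points_card)
qed

lemma P_infinity_notin_fibre: "P_infinity \<notin> fibre_points c"
  by (auto simp: fibre_points_def affine_point_neq_infinity[symmetric])

lemma fibre_points_subset_curve: "fibre_points c \<subseteq> GK_curve q"
  by (auto simp: fibre_points_def gk_fibre_def curve_points)

lemma affine_point_mem_fibre_points:
  "affine_point x y a \<in> fibre_points c \<longleftrightarrow> a = c \<and> gk_sol q x y c"
  by (auto simp: fibre_points_def gk_fibre_def)

text \<open>
  A fibre over a rational \<open>c\<close> consists of rational points if \<open>c \<in> \<Gamma>\<^sub>0\<close> and has none otherwise. Homogeneous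
  coordinates of an affine point may be normalised by dividing by the last one.
\<close>

lemma rational_points_eq:
  "{P \<in> GK_curve q. \<exists>v\<in>P. \<forall>i. (v $ i) ^ (q ^ 6) = v $ i} =
    insert P_infinity (\<Union>c\<in>insert 0 gk_Gamma. fibre_points c)"
proof (intro equalityI subsetI)
  fix P :: "'a point3" assume "P \<in> {P \<in> GK_curve q. \<exists>v\<in>P. \<forall>i. (v $ i) ^ (q ^ 6) = v $ i}"
  then obtain v :: "'a ^ 4" where P: "P \<in> GK_curve q" and v: "v \<in> P" "\<And>i. (v $ i) ^ (q ^ 6) = v $ i" by blast
  show "P \<in> insert P_infinity (\<Union>c\<in>insert 0 gk_Gamma. fibre_points c)"
  proof (cases "P = P_infinity")
    case False
    then obtain x y z where xyz: "P = affine_point x y z" "gk_sol q x y z"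
      using P unfolding curve_points by blast
    then obtain a where a: "a \<noteq> 0" "v = a *s vector [x, y, z, 1]"
      using v(1) by (auto simp: affine_point_def proj_point_def)
    have r: "v $ 2 = a * y" "v $ 3 = a * z" "v $ 4 = a" unfolding a(2) by simp_all
    have ra: "a ^ (q ^ 6) = a" using v(2)[of 4] r by simp
    have "z ^ (q ^ 6) = z" "y ^ (q ^ 6) = y"
      using v(2)[of 2] v(2)[of 3] a(1) unfolding r by (simp_all add: power_mult_distrib ra)
    then have "z \<in> insert 0 gk_Gamma" using rational_fibre(2)[OF xyz(2)] by auto
    then show ?thesis using xyz affine_point_mem_fibre_points by blast
  qed simp
next
  fix P :: "'a point3" assume "P \<in> insert P_infinity (\<Union>c\<in>insert 0 gk_Gamma. fibre_points c)"
  then consider "P = P_infinity" | c where "c \<in> insert 0 gk_Gamma" "P \<in> fibre_points c" by blast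
  then show "P \<in> {P \<in> GK_curve q. \<exists>v\<in>P. \<forall>i. (v $ i) ^ (q ^ 6) = v $ i}"
  proof cases
    case 1
    have "(vector [1, 0, 0, 0] :: 'a ^ 4) \<in> P" unfolding 1 P_infinity_def by (rule proj_point_self)
    moreover have "((vector [1, 0, 0, 0] :: 'a ^ 4) $ i) ^ (q ^ 6) = (vector [1, 0, 0, 0] :: 'a ^ 4) $ i" for i
      using exhaust_4[of i] by (auto simp: power_0_left)
    ultimately show ?thesis using curve_points 1 by blast
  next
    case 2
    then obtain x y where xy: "P = affine_point x y c" "gk_sol q x y c"
      by (auto simp: fibre_points_def gk_fibre_def)
    have c6: "c ^ (q ^ 6) = c" using 2(1) Gamma_rational by (auto simp: power_0_left)
    have r: "x ^ (q ^ 6) = x" "y ^ (q ^ 6) = y" using rational_fibre(1)[OF xy(2) c6] 2(1) by auto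
    have "(vector [x, y, c, 1] :: 'a ^ 4) \<in> P" unfolding xy(1) affine_point_def by (rule proj_point_self)
    moreover have "((vector [x, y, c, 1] :: 'a ^ 4) $ i) ^ (q ^ 6) = (vector [x, y, c, 1] :: 'a ^ 4) $ i" for i
      using exhaust_4[of i] r c6 by auto
    ultimately show ?thesis using fibre_points_subset_curve 2(2) by blast
  qed
qed

end

section \<open>Quotients of products of planes\<close>

definition plane4 :: "'a::field \<Rightarrow> 'a poly4" where
  "plane4 b = var4 3 - const4 b * var4 4"

lemma form_plane4 [simp]: "form (Suc 0) (plane4 b)"
  unfolding plane4_def by (intro form_diff) simp_all

lemma fls_nth_0_divide:
  fixes A B :: "'a::field fps"
  assumes "fps_nth B 0 \<noteq> 0"
  shows "fls_nth (fps_to_fls A / fps_to_fls B) 0 = fps_nth A 0 / fps_nth B 0"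
  unfolding fps_to_fls_divide[OF assms] by (simp add: divide_inverse)

context gk_field
begin

interpretation GK: branched_curve_of_degree "GK_curve q" gk_branch "q ^ 3 + 1"
  by (rule gk_branched_curve)

text \<open>
  The divisor of this function is the sum of the affine points over \<open>B\<close> minus \<open>m\<close> times the sum of
  those over \<open>A\<close>: all planes \<open>Z = bT\<close> meet the curve at infinity with multiplicity one, and these
  contributions cancel when \<open>B\<close> has \<open>m\<close> times as many elements as \<open>A\<close>.
\<close>

definition plane_quotient :: "nat \<Rightarrow> 'a set \<Rightarrow> 'a set \<Rightarrow> 'a ratfun" where
  "plane_quotient m A B = ratfun (GK_curve q) (\<Prod>b\<in>B. plane4 b) ((\<Prod>a\<in>A. plane4 a) ^ m)"

lemma P_infinity_in_curve: "(P_infinity :: 'a point3) \<in> GK_curve q"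
  by (simp add: curve_points)

lemma plane_at_affine:
  "ev fps_const (plane4 b) (pt4 x y (fps_const a + fps_X) 1) = fps_const (a - b) + fps_X"
  by (simp add: plane4_def fpsc.ev_homs algebra_simps flip: fps_const_sub)

lemma plane_at_affine_subdegree:
  fixes a b :: 'a
  shows "fps_const (a - b) + fps_X \<noteq> 0"
    "subdegree (fps_const (a - b) + fps_X) = (if a = b then 1 else 0)"
proof -
  have "fps_nth (fps_const (a - b) + fps_X) 1 = 1" by simp
  then show "fps_const (a - b) + fps_X \<noteq> 0" by (metis fps_zero_nth zero_neq_one)
  show "subdegree (fps_const (a - b) + fps_X) = (if a = b then 1 else 0)"
    by (auto intro!: subdegree_eq_0)
qed

text \<open>
  Since \<open>u = 1/x\<close> vanishes at infinity to order \<open>q\<^sup>3 + 1\<close>, the parameter \<open>t\<close> dominates in \<open>t - b u\<close>, whatever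
  \<open>b\<close> is.
\<close>

lemma plane_at_infinity:
  assumes "infinity_branch v u"
  shows "\<exists>w. fps_nth w 0 = 1 \<and> ev fps_const (plane4 b) (pt4 1 v fps_X u) = fps_X * w"
proof -
  note s = infinity_branch_subdegree(2,4)[OF assms]
  have "0 < q ^ 3" by simp
  then have "2 \<le> subdegree u" unfolding s(2) by linarith
  then obtain r where r: "u = fps_X ^ 2 * r" by (metis subdegree_decompose' mult.commute)
  have "ev fps_const (plane4 b) (pt4 1 v fps_X u) = fps_X * (1 - fps_const b * fps_X * r)"
    unfolding plane4_def fpsc.ev_homs r by (simp add: power2_eq_square algebra_simps)
  then show ?thesis by (intro exI[of _ "1 - fps_const b * fps_X * r"]) simp
qed

context
  fixes m :: nat and A B :: "'a set"
  assumes fin: "finite A" "finite B" and card: "card B = m * card A" and disj: "A \<inter> B = {}"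
begin

lemma planes_quotients:
  "((\<Prod>b\<in>B. plane4 b), (\<Prod>a\<in>A. plane4 a) ^ m) \<in> quotients (GK_curve q)"
proof -
  obtain v u where inf: "infinity_branch v u" "gk_branch P_infinity = pt4 1 v fps_X u"
    using gk_branch_infinity by blast
  have nz: "ev fps_const (plane4 b) (gk_branch P_infinity) \<noteq> 0" for b
    using plane_at_infinity[OF inf(1), of b] unfolding inf(2) by auto
  show ?thesis
  proof (rule GK.quotientsI)
    show "form (m * card A) (\<Prod>b\<in>B. plane4 b)" using form_prod[of B "Suc 0" plane4] by (simp add: card)
    show "form (m * card A) ((\<Prod>a\<in>A. plane4 a) ^ m)"
      using form_power[OF form_prod[of A "Suc 0" plane4], of m] by simp
    show "(P_infinity :: 'a point3) \<in> GK_curve q" by (rule P_infinity_in_curve)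
    show "ev fps_const ((\<Prod>a\<in>A. plane4 a) ^ m) (gk_branch P_infinity) \<noteq> 0"
      using nz fin by (simp add: fpsc.ev_homs prod_zero_iff)
  qed
qed

lemma germ_plane_quotient:
  assumes "P \<in> GK_curve q"
  shows "GK.germ P (plane_quotient m A B) =
    fps_to_fls (\<Prod>b\<in>B. ev fps_const (plane4 b) (gk_branch P)) /
    fps_to_fls ((\<Prod>a\<in>A. ev fps_const (plane4 a) (gk_branch P)) ^ m)"
  unfolding plane_quotient_def GK.germ_ratfun[OF assms planes_quotients] GK.quot_germ_def fpsc.ev_homs ..

lemma germ_plane_quotient_affine:
  assumes "gk_sol q x y z"
  defines "P \<equiv> affine_point x y z"
  shows "fls_subdegree (GK.germ P (plane_quotient m A B)) =
      (if z \<in> B then 1 else 0) - (if z \<in> A then int m else 0)"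
    and "z \<notin> A \<Longrightarrow> fls_nth (GK.germ P (plane_quotient m A B)) 0 = (\<Prod>b\<in>B. z - b) / (\<Prod>a\<in>A. z - a) ^ m"
proof -
  have P: "P \<in> GK_curve q" unfolding P_def by (rule affine_point_in_curve[OF assms(1)])
  obtain xs ys where xs: "gk_sol q xs ys (fps_const z + fps_X)" "fps_nth xs 0 = x" "fps_nth ys 0 = y"
    using affine_branch_exists[OF assms(1)] by blast
  have pl: "ev fps_const (plane4 b) (gk_branch P) = fps_const (z - b) + fps_X" for b
    using gk_branch_affine[OF xs(1)] xs(2,3) plane_at_affine unfolding P_def by simp
  have nz: "(\<Prod>b\<in>S. fps_const (z - b) + fps_X) \<noteq> 0" for S
    by (cases "finite S") (simp_all add: prod_zero_iff plane_at_affine_subdegree(1))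
  have sub: "subdegree (\<Prod>b\<in>S. fps_const (z - b) + fps_X) = (if z \<in> S then 1 else 0)" if "finite S" for S
    using that by (subst subdegree_prod) (simp_all add: plane_at_affine_subdegree)
  note germ = germ_plane_quotient[OF P, unfolded pl]
  show "fls_subdegree (GK.germ P (plane_quotient m A B)) =
      (if z \<in> B then 1 else 0) - (if z \<in> A then int m else 0)"
    unfolding germ using nz sub[OF fin(1)] sub[OF fin(2)]
    by (simp add: fls_divide_subdegree fls_subdegree_fls_to_fps)
  have n0: "fps_nth (\<Prod>b\<in>S. fps_const (z - b) + fps_X) 0 = (\<Prod>b\<in>S. z - b)" for S
    by (simp add: scalar_hom.hom_prod[OF scalar_hom_fps_nth_0])
  show "fls_nth (GK.germ P (plane_quotient m A B)) 0 = (\<Prod>b\<in>B. z - b) / (\<Prod>a\<in>A. z - a) ^ m" if "z \<notin> A"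
  proof -
    have "(\<Prod>a\<in>A. z - a) \<noteq> 0" using that fin by (auto simp: prod_zero_iff)
    then show ?thesis
      unfolding germ by (subst fls_nth_0_divide) (simp_all add: n0 fps_nth_power_0)
  qed
qed

lemma germ_plane_quotient_infinity:
  "fls_subdegree (GK.germ P_infinity (plane_quotient m A B)) = 0"
  "fls_nth (GK.germ P_infinity (plane_quotient m A B)) 0 = 1"
proof -
  note P = P_infinity_in_curve
  obtain v u where inf: "infinity_branch v u" "gk_branch P_infinity = pt4 1 v fps_X u"
    using gk_branch_infinity by blast
  obtain w where w: "\<And>b. fps_nth (w b) 0 = 1"
      "\<And>b. ev fps_const (plane4 b) (gk_branch P_infinity) = fps_X * w b"
    using plane_at_infinity[OF inf(1)] unfolding inf(2) by metis
  let ?W = "\<lambda>S. \<Prod>b\<in>S. w b"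
  have W0: "fps_nth (?W S) 0 = 1" for S
    by (simp add: scalar_hom.hom_prod[OF scalar_hom_fps_nth_0] w(1))
  have "fps_to_fls (fps_X ^ card B * ?W B) / fps_to_fls ((fps_X ^ card A * ?W A) ^ m)
      = fps_to_fls (?W B) / fps_to_fls (?W A ^ m)"
    by (simp add: card power_mult_distrib fls_times_fps_to_fls mult.commute flip: power_mult)
  then have germ: "GK.germ P_infinity (plane_quotient m A B) = fps_to_fls (?W B) / fps_to_fls (?W A ^ m)"
    unfolding germ_plane_quotient[OF P] w(2) by (simp add: prod.distrib)
  have nz: "?W B \<noteq> 0" "?W A \<noteq> 0" and sub: "subdegree (?W B) = 0" "subdegree (?W A) = 0"
    using W0 by (metis fps_zero_nth zero_neq_one, metis fps_zero_nth zero_neq_one,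
        metis subdegree_eq_0 zero_neq_one, metis subdegree_eq_0 zero_neq_one)
  show "fls_subdegree (GK.germ P_infinity (plane_quotient m A B)) = 0"
    unfolding germ using nz sub by (simp add: fls_divide_subdegree fls_subdegree_fls_to_fps)
  show "fls_nth (GK.germ P_infinity (plane_quotient m A B)) 0 = 1"
    unfolding germ by (subst fls_nth_0_divide) (simp_all add: W0 fps_nth_power_0)
qed

end

end

section \<open>Descent to the ground field\<close>

definition rational4 :: "'k::field alg_closure poly4 \<Rightarrow> bool" where
  "rational4 F \<longleftrightarrow> (\<forall>m. Poly_Mapping.lookup F m \<in> range to_ac)"

lemma rational4_mult:
  assumes F: "rational4 F" and G: "rational4 G"
  shows "rational4 (F * G)"
proof -
  obtain f g where f: "\<And>m. Poly_Mapping.lookup F m = to_ac (f m)"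
    and g: "\<And>m. Poly_Mapping.lookup G m = to_ac (g m)"
    using F G unfolding rational4_def image_iff by metis
  have "F * G = (\<Sum>m\<in>Poly_Mapping.keys F. Poly_Mapping.single m (to_ac (f m)))
      * (\<Sum>m\<in>Poly_Mapping.keys G. Poly_Mapping.single m (to_ac (g m)))"
    using poly4_eq_sum_monomials[of F] poly4_eq_sum_monomials[of G] by (simp add: f g)
  also have "\<dots> = (\<Sum>m\<in>Poly_Mapping.keys F. \<Sum>m'\<in>Poly_Mapping.keys G.
      Poly_Mapping.single (m + m') (to_ac (f m * g m')))"
    by (simp add: sum_product mult_single)
  finally have eq: "F * G = (\<Sum>m\<in>Poly_Mapping.keys F. \<Sum>m'\<in>Poly_Mapping.keys G.
      Poly_Mapping.single (m + m') (to_ac (f m * g m')))" .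
  have "Poly_Mapping.lookup (F * G) k = to_ac (\<Sum>m\<in>Poly_Mapping.keys F. \<Sum>m'\<in>Poly_Mapping.keys G.
      if m + m' = k then f m * g m' else 0)" for k
    unfolding eq lookup_sum to_ac_sum by (intro sum.cong refl) (simp add: lookup_single when_def)
  then show ?thesis by (simp add: rational4_def)
qed

lemma rational4_one: "rational4 1"
proof -
  have "Poly_Mapping.lookup (1 :: 'k::field alg_closure poly4) m = to_ac (if m = 0 then 1 else 0)" for m
    by (auto simp: lookup_one when_def)
  then show ?thesis unfolding rational4_def by (metis rangeI)
qed

lemma rational4_prod: "(\<And>x. x \<in> A \<Longrightarrow> rational4 (F x)) \<Longrightarrow> rational4 (\<Prod>x\<in>A. F x)"
  by (induction A rule: infinite_finite_induct) (simp_all add: rational4_one rational4_mult)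

lemma rational4_power: "rational4 F \<Longrightarrow> rational4 (F ^ k)"
  by (induction k) (simp_all add: rational4_one rational4_mult)

lemma rational4_plane4: "rational4 (plane4 (to_ac b))"
proof -
  have "Poly_Mapping.lookup (var4 3) m = to_ac (if m = Poly_Mapping.single 3 1 then 1 else 0)"
    "Poly_Mapping.lookup (const4 (to_ac b) * var4 4) m = to_ac (if m = Poly_Mapping.single 4 1 then b else 0)" for m
    by (auto simp: const4_def var4_def mult_single lookup_single when_def)
  then have "Poly_Mapping.lookup (plane4 (to_ac b)) m = to_ac
      ((if m = Poly_Mapping.single 3 1 then 1 else 0) - (if m = Poly_Mapping.single 4 1 then b else 0))" for m
    unfolding plane4_def lookup_minus to_ac_diff by metis
  then show ?thesis unfolding rational4_def by (metis rangeI)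
qed

lemma power_CARD_eq: "(x :: 'k::{field,finite}) ^ CARD('k) = x"
proof (cases "x = 0")
  case True
  then show ?thesis by (simp add: power_0_left)
next
  case False
  have "(\<Prod>y\<in>UNIV - {0}. x * y) = (\<Prod>y\<in>UNIV - {0}. y)"
    by (rule prod.reindex_bij_witness[of _ "\<lambda>y. y / x" "\<lambda>y. x * y"]) (use False in auto)
  then have "x ^ card (UNIV - {0 :: 'k}) * (\<Prod>y\<in>UNIV - {0}. y) = (\<Prod>y\<in>UNIV - {0}. y)"
    by (simp only: prod.distrib prod_constant)
  moreover have "(\<Prod>y\<in>UNIV - {0 :: 'k}. y) \<noteq> 0" by (simp add: prod_zero_iff)
  ultimately have "x ^ card (UNIV - {0 :: 'k}) = 1" by simp
  moreover have "CARD('k) = Suc (card (UNIV - {0 :: 'k}))"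
    by (rule card.remove) simp_all
  ultimately show ?thesis by (simp only: power_Suc mult_1_right)
qed

text \<open>
  The polynomial \<open>x\<^bsup>|k|\<^esup> - x\<close> has at most \<open>|k|\<close> roots, and the elements of \<open>k\<close> already supply that many.
\<close>

lemma range_to_ac_eq: "range (to_ac :: 'k::{field,finite} \<Rightarrow> _) = {x. x ^ CARD('k) = x}"
proof (rule card_seteq)
  let ?p = "monom 1 CARD('k) + [:0, - 1:] :: 'k alg_closure poly"
  have "card {0, 1 :: 'k} \<le> CARD('k)" by (rule card_mono) simp_all
  then have gt: "1 < CARD('k)" by simp
  then have deg: "degree ?p = CARD('k)"
    by (subst degree_add_eq_left) (simp_all add: degree_monom_eq)
  then have nz: "?p \<noteq> 0" using gt by auto
  have eq: "{x :: 'k alg_closure. x ^ CARD('k) = x} = {x. poly ?p x = 0}"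
    by (auto simp: poly_monom)
  show "finite {x :: 'k alg_closure. x ^ CARD('k) = x}" unfolding eq by (rule poly_roots_finite[OF nz])
  have "card {x. poly ?p x = 0} \<le> CARD('k)" using card_poly_roots_bound[OF nz] deg by simp
  also have "CARD('k) = card (range (to_ac :: 'k \<Rightarrow> _))"
    by (rule card_image[symmetric]) (rule inj_to_ac)
  finally show "card {x :: 'k alg_closure. x ^ CARD('k) = x} \<le> card (range (to_ac :: 'k \<Rightarrow> _))"
    unfolding eq .
  show "range (to_ac :: 'k \<Rightarrow> _) \<subseteq> {x. x ^ CARD('k) = x}"
    by (auto simp: power_CARD_eq simp flip: to_ac_power)
qed

lemma gk_field_alg_closure:
  assumes "primepow q" "CARD('k::{field,finite}) = q ^ 6"
  shows "gk_field TYPE('k alg_closure) q"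
proof
  have "CHAR('k) > 0" by (rule finite_imp_CHAR_pos) simp
  then have pr: "prime CHAR('k)" by (rule prime_CHAR_semidom)
  then show "prime CHAR('k alg_closure)" by simp
  obtain p e where p: "prime p" "e > 0" "q = p ^ e" using assms(1) by (auto simp: primepow_def)
  have "CHAR('k) dvd p ^ (e * 6)"
    using CHAR_dvd_CARD[where ?'a = 'k] unfolding assms(2) p(3) by (simp add: power_mult)
  then have "CHAR('k) dvd p" using pr prime_dvd_power by blast
  then have "CHAR('k) = p" using pr p(1) primes_dvd_imp_eq by blast
  then show "\<exists>e>0. q = CHAR('k alg_closure) ^ e" using p by auto
qed

lemma mem_zeta_plane_iff:
  assumes "P = affine_point x y z"
  shows "P \<in> zeta_plane b \<longleftrightarrow> z = to_ac b"
proof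
  assume "P \<in> zeta_plane b"
  moreover have "vector [x, y, z, 1] \<in> P" unfolding assms affine_point_def by (rule proj_point_self)
  ultimately have "(vector [x, y, z, 1] :: 'a alg_closure ^ 4) $ 3 = to_ac b * (vector [x, y, z, 1] :: 'a alg_closure ^ 4) $ 4"
    unfolding zeta_plane_def by blast
  then show "z = to_ac b" by simp
next
  assume "z = to_ac b"
  then show "P \<in> zeta_plane b"
    using affine_point_in_PG3[of x y z] by (auto simp: zeta_plane_def assms affine_point_def proj_point_def)
qed

lemma div_degree_uniform:
  assumes "finite S"
  shows "div_degree (\<Sum>P\<in>S. frag_cmul k (frag_of P)) = k * int (card S)"
    and "Poly_Mapping.lookup (\<Sum>P\<in>S. frag_cmul k (frag_of P)) Q = (if Q \<in> S then k else 0)"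
proof -
  let ?G = "\<Sum>P\<in>S. frag_cmul k (frag_of P)"
  have l: "Poly_Mapping.lookup ?G Q = (if Q \<in> S then k else 0)" for Q
  proof -
    have "Poly_Mapping.lookup ?G Q = (\<Sum>P\<in>S. if P = Q then k else 0)"
      unfolding lookup_sum by (rule sum.cong) auto
    then show ?thesis using assms by simp
  qed
  then show "Poly_Mapping.lookup ?G Q = (if Q \<in> S then k else 0)" .
  have "div_degree ?G = (\<Sum>P\<in>S. Poly_Mapping.lookup ?G P)"
    unfolding div_degree_def
    by (rule sum.mono_neutral_left) (use assms l in \<open>auto simp: in_keys_iff split: if_splits\<close>)
  then show "div_degree ?G = k * int (card S)" by (simp add: l)
qed

section \<open>The minimum distance\<close>

theorem proposition4p5:
  fixes q m s :: nat
    and c :: "nat \<Rightarrow> 'k::{field,finite}"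
    and \<X> \<G> \<D> :: "'k alg_closure point3 set"
    and G D :: "'k alg_closure divisor3"
    and Ps :: "'k alg_closure point3 list"
    and C :: "'k list set"
    and d :: int
  assumes "primepow q"
    and "CARD('k) = q ^ 6"
    and "c 0 = 0"
    and "inj_on c {0..s}"
    and "\<forall>i\<in>{0..s}. c i \<in> Gamma0_set q"
    and "\<X> = GK_curve q"
    and "\<G> = (\<Union>i\<in>{0..s}. \<X> \<inter> zeta_plane (c i)) - {P_infinity}"
    and "\<D> = rational_points \<X> - \<G>"
    and "G = (\<Sum>P\<in>\<G>. frag_cmul (int m) (frag_of P))"
    and "D = (\<Sum>P\<in>\<D>. frag_of P)"
    and "distinct Ps" and "set Ps = \<D>"
    and "C = functional_code \<X> Ps G"
    and "d = div_degree D - div_degree G"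
  shows "(\<forall>w\<in>C. int (length w) = div_degree D)
    \<and> d = int q ^ 8 - int q ^ 6 + int q ^ 5 - (int m + 1) * (int s + 1) * int q ^ 3 + 1
    \<and> (d > 0 \<longrightarrow> int (minimum_distance C) = d)"
proof -
  interpret gk_field q "TYPE('k alg_closure)"
    by (rule gk_field_alg_closure[OF assms(1,2)])
  interpret GK: branched_curve_of_degree "GK_curve q" gk_branch "q ^ 3 + 1"
    by (rule gk_branched_curve)
  let ?K = "range (to_ac :: 'k \<Rightarrow> _)"
  let ?\<Gamma> = "insert 0 gk_Gamma :: 'k alg_closure set"
  define Z where "Z = to_ac ` c ` {0..s}"
  have K: "?K = {x. x ^ (q ^ 6) = x}" using range_to_ac_eq[where ?'k = 'k] assms(2) by simp
  have Gamma: "to_ac a \<in> ?\<Gamma> \<longleftrightarrow> a \<in> Gamma0_set q" for a :: 'k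
  proof -
    have "to_ac a \<in> gk_Gamma \<longleftrightarrow> to_ac (a ^ ((q ^ 3 + 1) * (q^2 - 1)) + a ^ ((q ^ 3 + 1) * (q^2 - q)) + 1) = 0"
      unfolding gk_Gamma_def by simp
    also have "\<dots> \<longleftrightarrow> a \<in> Gamma_set q" unfolding to_ac_eq_0_iff Gamma_set_def by simp
    finally show ?thesis by (simp add: Gamma0_set_def)
  qed
  have GammaK: "?\<Gamma> \<subseteq> ?K" using Gamma_rational unfolding K by (auto simp: power_0_left)
  have Z: "finite Z" "Z \<subseteq> ?\<Gamma>" and cardZ: "card Z = s + 1"
  proof -
    show "finite Z" by (simp add: Z_def)
    show "Z \<subseteq> ?\<Gamma>"
      unfolding Z_def image_image using Gamma assms(5) by (intro image_subsetI) blast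
    have "card Z = card (c ` {0..s})"
      unfolding Z_def by (rule card_image) (rule inj_on_subset[OF inj_to_ac], simp)
    then show "card Z = s + 1" using card_image[OF assms(4)] by simp
  qed
  have fin\<Gamma>: "finite ?\<Gamma>" using card_Gamma(1) by simp
  have \<Gamma>q: "int (card ?\<Gamma>) * int (q ^ 3) = int q ^ 8 - int q ^ 6 + int q ^ 5"
  proof -
    have "card ?\<Gamma> = (q ^ 3 + 1) * (q^2 - 1) + 1"
      using card_Gamma zero_notin_Gamma by (subst card_insert_disjoint) auto
    moreover have "int (q^2 - 1) = int q ^ 2 - 1" using q2_gt_1 by (simp add: of_nat_diff)
    ultimately have i: "int (card ?\<Gamma>) = (int q ^ 3 + 1) * (int q ^ 2 - 1) + 1"
      by (simp only: of_nat_add of_nat_mult of_nat_power of_nat_1)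
    show ?thesis unfolding i by (simp add: algebra_simps eval_nat_numeral)
  qed
  have G_eq: "\<G> = (\<Union>z\<in>Z. fibre_points z)"
  proof -
    have "\<X> \<inter> zeta_plane b - {P_infinity} = fibre_points (to_ac b)" for b :: 'k
    proof (intro equalityI subsetI)
      fix P assume P: "P \<in> \<X> \<inter> zeta_plane b - {P_infinity}"
      then obtain x y z where "P = affine_point x y z" "gk_sol q x y z"
        unfolding assms(6) curve_points by blast
      then show "P \<in> fibre_points (to_ac b)"
        using P mem_zeta_plane_iff[of P x y z b] by (simp add: affine_point_mem_fibre_points)
    next
      fix P assume P: "P \<in> fibre_points (to_ac b)"
      then obtain x y where "P = affine_point x y (to_ac b)" by (auto simp: fibre_points_def)
      then show "P \<in> \<X> \<inter> zeta_plane b - {P_infinity}"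
        using P mem_zeta_plane_iff[of P x y "to_ac b" b] fibre_points_subset_curve[of "to_ac b"] assms(6)
        by auto
    qed
    then show ?thesis unfolding assms(7) Z_def by auto
  qed
  have finG: "finite \<G>" and cardG: "card \<G> = (s + 1) * q ^ 3"
    using fibre_points_Union_card[OF Z(1)] cardZ by (simp_all add: G_eq)
  have rat: "rational_points \<X> = insert P_infinity (\<Union>z\<in>?\<Gamma>. fibre_points z)"
    unfolding rational_points_eq[symmetric] rational_points_def assms(6) K by simp
  have inf: "P_infinity \<notin> (\<Union>z\<in>S. fibre_points z)" for S :: "'k alg_closure set"
    using P_infinity_notin_fibre by blast
  have GR: "\<G> \<subseteq> rational_points \<X>" using Z(2) unfolding rat G_eq by blast
  have finR: "finite (rational_points \<X>)" and cardR: "card (rational_points \<X>) = card ?\<Gamma> * q ^ 3 + 1"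
    using fibre_points_Union_card[OF fin\<Gamma>] inf[of ?\<Gamma>] unfolding rat by simp_all
  have finD: "finite \<D>" using finR assms(8) by simp
  have "card \<D> = card (rational_points \<X>) - card \<G>"
    unfolding assms(8) by (rule card_Diff_subset[OF finG GR])
  moreover have "card \<G> \<le> card (rational_points \<X>)" by (rule card_mono[OF finR GR])
  ultimately have cardD: "int (card \<D>) = int (card ?\<Gamma>) * int (q ^ 3) + 1 - int ((s + 1) * q ^ 3)"
    by (simp add: of_nat_diff cardR cardG del: of_nat_add of_nat_mult of_nat_power) simp
  have degD: "div_degree D = int (card \<D>)"
    using div_degree_uniform(1)[OF finD, of 1] unfolding assms(10) by simp
  have degG: "div_degree G = int m * int (card \<G>)"
    unfolding assms(9) by (rule div_degree_uniform(1)[OF finG])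
  have lookG: "Poly_Mapping.lookup G Q = (if Q \<in> \<G> then int m else 0)" for Q
    unfolding assms(9) by (rule div_degree_uniform(2)[OF finG])
  have lenPs: "length Ps = card \<D>" using assms(11,12) distinct_card by metis
  have len: "length w = length Ps" if "w \<in> C" for w
    using that unfolding assms(13) functional_code_def by (auto dest: map_eq_imp_length_eq)
  have d_eq: "d = int q ^ 8 - int q ^ 6 + int q ^ 5 - (int m + 1) * (int s + 1) * int q ^ 3 + 1"
    unfolding assms(14) degD degG cardD cardG \<Gamma>q by (simp add: algebra_simps)
  have keysG: "Poly_Mapping.keys G \<subseteq> \<G>" using lookG by (auto simp: in_keys_iff split: if_splits)
  have GX: "\<G> \<subseteq> GK_curve q" and DX: "\<D> \<subseteq> GK_curve q"
    using fibre_points_subset_curve by (auto simp: G_eq assms(8,6) rational_points_def)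
  have lower: "d \<le> int (hamming_distance u w)" if "u \<in> C" "w \<in> C" "u \<noteq> w" for u w
  proof -
    have "set Ps \<subseteq> GK_curve q - Poly_Mapping.keys G"
      using DX keysG assms(8,12) by blast
    then have "int (length Ps) - div_degree G \<le> int (hamming_distance u w)"
      using functional_code_distance_ge[OF gk_branched_curve _ assms(11)] that keysG GX
      unfolding assms(13,6) by blast
    then show ?thesis by (simp add: assms(14) degD lenPs)
  qed
  have "int (minimum_distance C) = d" if "d > 0"
  proof -
    \<comment> \<open>Positivity of \<open>d\<close> leaves room for \<open>m (s + 1)\<close> further planes over \<open>\<Gamma>\<^sub>0\<close>.\<close>
    have "m * card Z \<le> card (?\<Gamma> - Z)"
    proof -
      have "int ((m + 1) * (s + 1)) * int (q ^ 3) < int (card ?\<Gamma>) * int (q ^ 3) + 1"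
        using that unfolding d_eq \<Gamma>q by (simp add: algebra_simps)
      then have "int ((m + 1) * (s + 1)) * int (q ^ 3) \<le> int (card ?\<Gamma>) * int (q ^ 3)" by linarith
      then have "int ((m + 1) * (s + 1)) \<le> int (card ?\<Gamma>)" by (rule mult_right_le_imp_le) simp
      then have "(m + 1) * (s + 1) \<le> card ?\<Gamma>" by (simp only: of_nat_le_iff)
      moreover have "card (?\<Gamma> - Z) = card ?\<Gamma> - card Z" by (rule card_Diff_subset[OF Z])
      ultimately show ?thesis by (simp add: cardZ)
    qed
    then obtain B where B: "B \<subseteq> ?\<Gamma> - Z" "card B = m * card Z" "finite B"
      by (rule obtain_subset_with_card_n)
    have ZB: "Z \<inter> B = {}" using B(1) by blast
    note pq = Z(1) B(3,2) ZB
    let ?f = "plane_quotient m Z B"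
    have fQ: "((\<Prod>b\<in>B. plane4 b), (\<Prod>a\<in>Z. plane4 a) ^ m) \<in> quotients (GK_curve q)"
      by (rule planes_quotients[OF pq])
    have fc: "?f \<in> carrier GK.KX"
      unfolding plane_quotient_def by (rule GK.ratfun_in_carrier[OF fQ])
    have Pinf: "(P_infinity :: 'k alg_closure point3) \<in> GK_curve q" by (rule P_infinity_in_curve)
    have "GK.germ P_infinity ?f \<noteq> 0" using germ_plane_quotient_infinity(2)[OF pq] by auto
    then have fnz: "?f \<noteq> \<zero>\<^bsub>GK.KX\<^esub>" using GK.germ_zero_one(1)[OF Pinf] by auto
    \<comment> \<open>As \<open>B\<close> avoids \<open>Z\<close>, the order of \<open>?f\<close> above \<open>Z\<close> is \<open>-m\<close>, which \<open>G\<close> compensates.\<close>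
    have sub: "fls_subdegree (GK.germ P ?f) + Poly_Mapping.lookup G P \<ge> 0" if P: "P \<in> GK_curve q" for P
    proof (cases "P = P_infinity")
      case True
      then show ?thesis using germ_plane_quotient_infinity(1)[OF pq] by (simp add: lookG)
    next
      case False
      then obtain x y z where xyz: "P = affine_point x y z" "gk_sol q x y z"
        using P unfolding curve_points by blast
      have "P \<in> \<G> \<longleftrightarrow> z \<in> Z"
        using xyz by (auto simp: G_eq affine_point_mem_fibre_points)
      then show ?thesis
        using germ_plane_quotient_affine(1)[OF pq xyz(2)] xyz(1) lookG[of P] by auto
    qed
    have rat4: "rational4 (\<Prod>a\<in>S. plane4 a)" if "S \<subseteq> ?K" for S
      using that by (intro rational4_prod) (auto simp: rational4_plane4)
    have "?f \<in> rational_functions (GK_curve q)"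
      using fQ rat4[of B] rational4_power[OF rat4[of Z]] B(1) Z(2) GammaK
      unfolding rational_functions_def plane_quotient_def rational4_def by blast
    then have fL: "?f \<in> riemann_roch_space \<X> G"
      using fnz sub GK.ord_at_eq_subdegree[OF _ fc fnz] by (simp add: riemann_roch_space_def assms(6))
    \<comment> \<open>Above a rational \<open>z\<close> the value is a quotient of products of differences of elements of the ground field.\<close>
    have val: "value_at P ?f \<in> ?K \<and> (value_at P ?f = 0 \<longleftrightarrow> P \<in> (\<Union>b\<in>B. fibre_points b))"
      if P: "P \<in> \<D>" for P
    proof -
      have PX: "P \<in> GK_curve q" and PG: "P \<notin> \<G>" using P DX assms(8) by auto
      have "fls_subdegree (GK.germ P ?f) \<ge> 0" using sub[OF PX] PG by (simp add: lookG)
      then have v: "value_at P ?f = fls_nth (GK.germ P ?f) 0" by (rule GK.value_at_germ[OF PX fc])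
      show ?thesis
      proof (cases "P = P_infinity")
        case True
        then have "value_at P ?f = 1" using v germ_plane_quotient_infinity(2)[OF pq] by simp
        moreover have "1 \<in> ?K" using to_ac_1 by (metis rangeI)
        ultimately show ?thesis using True inf[of B] by simp
      next
        case False
        then obtain x y z where xyz: "P = affine_point x y z" "gk_sol q x y z"
          using PX unfolding curve_points by blast
        have zZ: "z \<notin> Z" using PG xyz by (auto simp: G_eq affine_point_mem_fibre_points)
        have "P \<in> rational_points \<X>" using P assms(8) by blast
        then have "z \<in> ?\<Gamma>" using xyz(1) unfolding rat by (auto simp: affine_point_mem_fibre_points)
        then have zK: "z \<in> ?K" using GammaK by blast
        have quot: "value_at P ?f = (\<Prod>b\<in>B. z - b) / (\<Prod>a\<in>Z. z - a) ^ m"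
          using v germ_plane_quotient_affine(2)[OF pq xyz(2) zZ] xyz(1) by simp
        have prodK: "(\<Prod>a\<in>S. z - a) \<in> ?K" if "S \<subseteq> ?K" for S
        proof -
          have "(\<Prod>a\<in>S. z - a) = (\<Prod>a\<in>S. to_ac (of_ac z - of_ac a))"
            using zK that by (intro prod.cong) (auto simp: to_ac_of_ac)
          then show ?thesis unfolding to_ac_prod[symmetric] by simp
        qed
        have "B \<subseteq> ?K" "Z \<subseteq> ?K" using B(1) Z(2) GammaK by blast+
        then obtain b z' where "(\<Prod>b\<in>B. z - b) = to_ac b" "(\<Prod>a\<in>Z. z - a) = to_ac z'"
          using prodK by blast
        then have "value_at P ?f = to_ac (b / z' ^ m)" unfolding quot by simp
        then have "value_at P ?f \<in> ?K" by (metis rangeI)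
        moreover have "(\<Prod>a\<in>Z. z - a) \<noteq> 0" using zZ Z(1) by (auto simp: prod_zero_iff)
        then have "value_at P ?f = 0 \<longleftrightarrow> z \<in> B"
          unfolding quot using B(3) by (auto simp: prod_zero_iff)
        ultimately show ?thesis using xyz by (auto simp: affine_point_mem_fibre_points)
      qed
    qed
    define u where "u = map (\<lambda>P. of_ac (value_at P ?f)) Ps"
    define w0 where "w0 = map (\<lambda>P. 0 :: 'k) Ps"
    have "map to_ac u = map (\<lambda>P. value_at P ?f) Ps"
      unfolding u_def map_map using val assms(12) by (auto simp: to_ac_of_ac)
    then have uC: "u \<in> C" using fL by (auto simp: assms(13) functional_code_def)
    have "value_at P \<zero>\<^bsub>GK.KX\<^esub> = 0" if "P \<in> \<D>" for P
    proof -
      have P: "P \<in> GK_curve q" using that DX by blast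
      show ?thesis
        using GK.value_at_germ[OF P GK.zero_one_carrier(1)[OF P]] GK.germ_zero_one(1)[OF P] by simp
    qed
    then have "map to_ac w0 = map (\<lambda>P. value_at P \<zero>\<^bsub>GK.KX\<^esub>) Ps"
      unfolding w0_def map_map using assms(12) by auto
    moreover have "\<zero>\<^bsub>GK.KX\<^esub> \<in> riemann_roch_space \<X> G" by (simp add: riemann_roch_space_def assms(6))
    ultimately have oC: "w0 \<in> C" by (auto simp: assms(13) functional_code_def)
    have dist: "int (hamming_distance u w0) = d"
    proof -
      let ?F = "\<Union>b\<in>B. fibre_points b"
      have FD: "?F \<subseteq> \<D>"
        using B(1) unfolding assms(8) rat G_eq by (auto simp: fibre_points_def)
      have "{i. i < length u \<and> u ! i \<noteq> w0 ! i} = {i. i < length Ps \<and> Ps ! i \<in> \<D> - ?F}"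
      proof -
        have "u ! i \<noteq> w0 ! i \<longleftrightarrow> Ps ! i \<in> \<D> - ?F" if "i < length Ps" for i
        proof -
          have P: "Ps ! i \<in> \<D>" using that assms(12) by auto
          then have "to_ac (u ! i) = value_at (Ps ! i) ?f"
            using val that by (simp add: u_def to_ac_of_ac)
          then have "u ! i = 0 \<longleftrightarrow> value_at (Ps ! i) ?f = 0" by (metis to_ac_eq_0_iff)
          then show ?thesis using val[OF P] P that by (simp add: w0_def)
        qed
        moreover have "length u = length Ps" by (simp add: u_def)
        ultimately show ?thesis by (intro Collect_cong conj_cong) simp_all
      qed
      moreover have "card {i. i < length Ps \<and> Ps ! i \<in> \<D> - ?F} = card (\<D> - ?F)"
      proof -
        have inj: "inj_on ((!) Ps) {i. i < length Ps \<and> Ps ! i \<in> \<D> - ?F}"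
          using assms(11) by (auto simp: inj_on_def nth_eq_iff_index_eq)
        have img: "(!) Ps ` {i. i < length Ps \<and> Ps ! i \<in> \<D> - ?F} = \<D> - ?F"
        proof (intro equalityI subsetI)
          fix P assume P: "P \<in> \<D> - ?F"
          then obtain i where "i < length Ps" "P = Ps ! i" using assms(12) by (metis DiffD1 in_set_conv_nth)
          then show "P \<in> (!) Ps ` {i. i < length Ps \<and> Ps ! i \<in> \<D> - ?F}" using P by blast
        qed blast
        show ?thesis using card_image[OF inj] unfolding img by (rule sym)
      qed
      ultimately have "hamming_distance u w0 = card (\<D> - ?F)"
        unfolding hamming_distance_def by simp
      also have "\<dots> = card \<D> - card ?F"
        using fibre_points_Union_card(1)[OF B(3)] FD by (rule card_Diff_subset)
      finally have "int (hamming_distance u w0) = int (card \<D>) - int (card ?F)"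
        using card_mono[OF finD FD] by (simp add: of_nat_diff)
      also have "\<dots> = d"
        unfolding assms(14) degD degG cardG fibre_points_Union_card(2)[OF B(3)] B(2) cardZ
        by (simp add: algebra_simps)
      finally show ?thesis .
    qed
    have ne: "u \<noteq> w0"
    proof
      assume "u = w0"
      then have "hamming_distance u w0 = 0" by (simp add: hamming_distance_def)
      then show False using dist that by simp
    qed
    have "minimum_distance C = hamming_distance u w0"
      unfolding minimum_distance_def
    proof (rule cInf_eq_minimum)
      show "hamming_distance u w0 \<in> {hamming_distance u w |u w. u \<in> C \<and> w \<in> C \<and> u \<noteq> w}"
        using uC oC ne by blast
      fix k assume "k \<in> {hamming_distance u w |u w. u \<in> C \<and> w \<in> C \<and> u \<noteq> w}"
      then show "hamming_distance u w0 \<le> k" using lower dist by force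
    qed
    then show ?thesis using dist by simp
  qed
  then show ?thesis using len lenPs degD d_eq by simp
qed

end
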